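(* Let $0<M<1/2$ and $\mathbb{D}=\begin{pmatrix}0&-\frac{d}{d\rho}+M\sec\rho\\ \frac{d}{d\rho}+M\sec\rho&0\end{pmatrix}$ on $(-\pi/2,\pi/2)$. For each of the following boundary conditions, the set of $\omega\in\mathbb{R}$ for which $\mathbb{D}\Phi=\omega\Phi$ has a non-zero solution satisfying the condition is as stated; for each such $\omega$ the solution is unique up to scalars, and $\Psi(t,\rho)=\Phi(\rho)e^{-i\omega t}$ is, after normalization, the given mode. (I) $\widetilde{\Phi^{(2)}}(\frac\pi2)=0=\widetilde{\Phi^{(1)}}(-\frac\pi2)$: $\omega=\pm\omega_n^{I}$, $\omega^{I}_n=\frac12+M+n$, $n\ge0$, with modes $$\Psi^{I,\pm}_{n}=N^I_n(\cos\rho)^M\begin{pmatrix}(1+\sin\rho)^{1/2}P_n^{(-\frac12+M,\frac12+M)}(\sin\rho)\\ \pm(1-\sin\rho)^{1/2}P_n^{(\frac12+M,-\frac12+M)}(\sin\rho)\end{pmatrix}e^{\mp i\omega^I_nt},\quad N^I_n=\frac{\sqrt{n!\,\Gamma(n+2M+1)}}{2^{M+1/2}\Gamma(\frac12+M+n)}.$$ The spans of $\{\Psi^{I,+}_n\}_{n\geq 0}$ and of $\{\Psi^{I,-}_n\}_{n\geq 0}$ are invariant and form $\mathscr{D}^+_{1/2+M}$ and $\mathscr{D}^-_{1/2+M}$, respectively. (II) $\widetilde{\Phi^{(1)}}(\frac\pi2)=0=\widetilde{\Phi^{(2)}}(-\frac\pi2)$: $\omega=\pm\omega_n^{II}$,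 $\omega^{II}_n=\frac12-M+n$, $n\ge0$, with modes $$\Psi^{II,\pm}_{n}=N^{II}_n(\cos\rho)^{-M}\begin{pmatrix}(1-\sin\rho)^{1/2}P_n^{(\frac12-M,-\frac12-M)}(\sin\rho)\\ \mp(1+\sin\rho)^{1/2}P_n^{(-\frac12-M,\frac12-M)}(\sin\rho)\end{pmatrix}e^{\mp i\omega^{II}_nt},\quad N^{II}_n=\frac{\sqrt{n!\,\Gamma(n-2M+1)}}{2^{\frac12-M}\Gamma(\frac12-M+n)}.$$ The spans of $\{\Psi^{II,+}_n\}_{n\geq 0}$ and of $\{\Psi^{II,-}_n\}_{n\geq 0}$ are invariant and form $\mathscr{D}^+_{1/2-M}$ and $\mathscr{D}^-_{1/2-M}$, respectively. (III) $\widetilde{\Phi^{(1)}}(\frac\pi2)=0=\widetilde{\Phi^{(1)}}(-\frac\pi2)$: $\omega\in\mathbb{Z}$, with modes, for $n\ge1$, $$\Psi^{III}_{\pm n}=N_n\Big(\tfrac{1+\sin\rho}{1-\sin\rho}\Big)^{M/2}\begin{pmatrix}\cos\rho\,P_{n-1}^{(\frac12-M,\frac12+M)}(\sin\rho)\\ \mp2P_n^{(-\frac12-M,-\frac12+M)}(\sin\rho)\end{pmatrix}e^{\mp int},\qquad \Psi_0^{III}=N_0\Big(\tfrac{1+\sin\rho}{1-\sin\rho}\Big)^{M/2}\begin{pmatrix}0\\-2\end{pmatrix}.$$ (IV) $\widetilde{\Phi^{(2)}}(\frac\pi2)=0=\widetilde{\Phi^{(2)}}(-\frac\pi2)$: $\omega\in\mathbb{Z}$,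 with modes, for $n\ge1$, $$\Psi^{IV}_{\pm n}=N_n\Big(\tfrac{1-\sin\rho}{1+\sin\rho}\Big)^{M/2}\begin{pmatrix}2P_n^{(-\frac12+M,-\frac12-M)}(\sin\rho)\\ \pm\cos\rho\,P_{n-1}^{(\frac12+M,\frac12-M)}(\sin\rho)\end{pmatrix}e^{\mp int},\qquad \Psi_0^{IV}=N_0\Big(\tfrac{1-\sin\rho}{1+\sin\rho}\Big)^{M/2}\begin{pmatrix}2\\0\end{pmatrix}.$$ Here $N_n=\dfrac{n!}{2\sqrt{\Gamma(\frac12+M+n)\Gamma(\frac12-M+n)}}$ for $n\ge0$. In each of the cases (III) and (IV), the span of all the modes is an irreducible unitary representation, namely the complementary series $\mathscr{C}^0_{1/2+M}$; in particular it does not split into invariant positive- and negative-frequency subspaces.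
   Context: $\sigma(\rho)=\left(\frac{1-\sin\rho}{1+\sin\rho}\right)^{1/2}$; for $\Phi=(\Phi^{(1)},\Phi^{(2)})^T$, $\widetilde{\Phi^{(1)}}=\sigma^{-M}\Phi^{(1)}$, $\widetilde{\Phi^{(2)}}=\sigma^{M}\Phi^{(2)}$, with values at $\pm\pi/2$ understood as limits. $P_n^{(a,b)}$ are Jacobi polynomials, $P_{n}^{(a,b)}(x)=\frac{\Gamma(n+a+1)}{n!\,\Gamma(a+1)}\,{}_2F_1(n+a+b+1,-n;a+1;\frac{1-x}{2})$. The inner product is $\langle\Psi_1,\Psi_2\rangle=\int_{-\pi/2}^{\pi/2}\Psi_1(t,\rho)^\dagger\Psi_2(t,\rho)\,d\rho$ (independent of $t$ for the solutions considered). A mode has positive (negative) frequency if its time dependence is $e^{-i\omega t}$ with $\omega>0$ ($\omega<0$). The infinitesimal action of $\widetilde{\mathrm{SL}}(2,\mathbb{R})$ on spinors $\Psi(t,\rho)$ is $L_0=i\partial_t$ and $$L_\pm=e^{\mp it}\Big(\pm i\cos\rho\,\partial_\rho\mp\tfrac{i}{2}\sin\rho+\sin\rho\,\partial_t+\cos\rho\,\Sigma^{01}\Big),\qquad \Sigma^{01}=\tfrac12\begin{pmatrix}0&i\\-i&0\end{pmatrix},$$ with $[L_0,L_\pm]=\pm L_\pm$, $[L_+,L_-]=2L_0$, and Casimir $Q=L_0^2+\frac12(L_+L_-+L_-L_+)$. "Invariant" and "irreducible" refer to $L_0,L_+,L_-$. A space of modes forms a unitary representation (at the Lie algebra level) when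 it has an orthonormal basis of $L_0$-eigenvectors and $L_\pm^\dagger=-L_\mp$ on it. The irreducible unitary representations involved are: for $\lambda>0$, $\mathscr{D}^\pm_\lambda$ with $L_0$-eigenvalues $\pm(\lambda+n)$, $n\in\mathbb{N}\cup\{0\}$, each of multiplicity one, and $Q=\lambda(\lambda-1)$; and $\mathscr{C}^0_{1/2+M}$ with $L_0$-eigenvalues all integers, each of multiplicity one, and $Q=M^2-\frac14$. *)

theory Defs
  imports
    "HOL-Analysis.Analysis"
    "HOL-Library.Function_Algebras"
begin

section \<open>Spinor fields on the strip\<close>

abbreviation rho_interval :: "real set"
  where "rho_interval \<equiv> {- pi / 2 <..< pi / 2}"

text \<open>
  A spinor field depends on \<open>t\<close> and on \<open>\<rho> \<in> (-\<pi>/2, \<pi>/2)\<close>. HOL functions being total, fields are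
  extended by zero outside the interval, so that equality of functions is equality on the strip
  \<open>\<real> \<times> (-\<pi>/2, \<pi>/2)\<close>.
\<close>

type_synonym spinor_field = "real \<Rightarrow> real \<Rightarrow> complex^2"

definition on_strip :: "spinor_field \<Rightarrow> spinor_field"
  where "on_strip \<Psi> = (\<lambda>t \<rho>. if \<rho> \<in> rho_interval then \<Psi> t \<rho> else 0)"

definition spinor_scale :: "complex \<Rightarrow> spinor_field \<Rightarrow> spinor_field"  (infixr "*\<^sub>\<Psi>" 75)
  where "c *\<^sub>\<Psi> \<Psi> = (\<lambda>t \<rho>. c *s \<Psi> t \<rho>)"

global_interpretation spinor: vector_space spinor_scale
  by unfold_locales
    (auto simp: spinor_scale_def fun_eq_iff vec_eq_iff algebra_simps)

definition spinor_inner :: "real \<Rightarrow> spinor_field \<Rightarrow> spinor_field \<Rightarrow> complex"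
  where "spinor_inner t \<Psi>\<^sub>1 \<Psi>\<^sub>2 =
    (LINT \<rho>:rho_interval|lborel. \<Sum>j\<in>UNIV. cnj (\<Psi>\<^sub>1 t \<rho> $ j) * \<Psi>\<^sub>2 t \<rho> $ j)"

definition square_integrable :: "spinor_field \<Rightarrow> bool"
  where "square_integrable \<Psi> \<longleftrightarrow>
    (\<forall>t. \<forall>j. set_borel_measurable lborel rho_interval (\<lambda>\<rho>. \<Psi> t \<rho> $ j) \<and>
             set_integrable lborel rho_interval (\<lambda>\<rho>. (cmod (\<Psi> t \<rho> $ j))\<^sup>2))"

definition stationary :: "real \<Rightarrow> (real \<Rightarrow> complex^2) \<Rightarrow> spinor_field"
  where "stationary \<omega> \<Phi> = on_strip (\<lambda>t \<rho>. exp (- \<i> * of_real (\<omega> * t)) *s \<Phi> \<rho>)"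

definition has_frequency :: "real \<Rightarrow> spinor_field \<Rightarrow> bool"
  where "has_frequency \<omega> \<Psi> \<longleftrightarrow> (\<exists>\<Phi>. \<Psi> = stationary \<omega> \<Phi>)"


section \<open>The infinitesimal action\<close>

definition d_t :: "spinor_field \<Rightarrow> spinor_field"
  where "d_t \<Psi> = (\<lambda>t \<rho>. vector_derivative (\<lambda>u. \<Psi> u \<rho>) (at t))"

definition d_rho :: "spinor_field \<Rightarrow> spinor_field"
  where "d_rho \<Psi> = (\<lambda>t \<rho>. vector_derivative (\<lambda>r. \<Psi> t r) (at \<rho>))"

definition Sigma01 :: "complex^2^2"
  where "Sigma01 = vector [vector [0, \<i> / 2], vector [- \<i> / 2, 0]]"

definition L0 :: "spinor_field \<Rightarrow> spinor_field"
  where "L0 \<Psi> = on_strip (\<lambda>t \<rho>. \<i> *s d_t \<Psi> t \<rho>)"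

text \<open>\<open>ladder 1\<close> is \<open>L\<^sub>+\<close> and \<open>ladder (-1)\<close> is \<open>L\<^sub>-\<close>.\<close>

definition ladder :: "real \<Rightarrow> spinor_field \<Rightarrow> spinor_field"
  where "ladder s \<Psi> = on_strip (\<lambda>t \<rho>. exp (- \<i> * of_real (s * t)) *s
      ((of_real s * \<i> * of_real (cos \<rho>)) *s d_rho \<Psi> t \<rho>
       - (of_real s * \<i> / 2 * of_real (sin \<rho>)) *s \<Psi> t \<rho>
       + of_real (sin \<rho>) *s d_t \<Psi> t \<rho>
       + of_real (cos \<rho>) *s (Sigma01 *v \<Psi> t \<rho>)))"

abbreviation L_plus :: "spinor_field \<Rightarrow> spinor_field"
  where "L_plus \<equiv> ladder 1"

abbreviation L_minus :: "spinor_field \<Rightarrow> spinor_field"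
  where "L_minus \<equiv> ladder (- 1)"

definition Casimir :: "spinor_field \<Rightarrow> spinor_field"
  where "Casimir \<Psi> = L0 (L0 \<Psi>) + (1 / 2) *\<^sub>\<Psi> (L_plus (L_minus \<Psi>) + L_minus (L_plus \<Psi>))"


section \<open>Representations on spaces of spinor fields\<close>

definition invariant :: "spinor_field set \<Rightarrow> bool"
  where "invariant V \<longleftrightarrow> spinor.subspace V \<and>
    (\<forall>\<Psi>\<in>V. L0 \<Psi> \<in> V \<and> L_plus \<Psi> \<in> V \<and> L_minus \<Psi> \<in> V)"

definition irreducible_rep :: "spinor_field set \<Rightarrow> bool"
  where "irreducible_rep V \<longleftrightarrow> invariant V \<and> V \<noteq> {0} \<and>
    (\<forall>W. W \<subseteq> V \<and> invariant W \<longrightarrow> W = {0} \<or> W = V)"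

definition commutation_relations_on :: "spinor_field set \<Rightarrow> bool"
  where "commutation_relations_on V \<longleftrightarrow> (\<forall>\<Psi>\<in>V.
    L0 (L_plus \<Psi>) - L_plus (L0 \<Psi>) = L_plus \<Psi> \<and>
    L0 (L_minus \<Psi>) - L_minus (L0 \<Psi>) = - L_minus \<Psi> \<and>
    L_plus (L_minus \<Psi>) - L_minus (L_plus \<Psi>) = 2 *\<^sub>\<Psi> L0 \<Psi>)"

text \<open>
  Bases are algebraic: \<open>spinor.span\<close> consists of finite linear combinations. Square integrability is
  required explicitly because the integral of a non-integrable function is \<open>0\<close> by convention.
\<close>

definition unitary_rep :: "spinor_field set \<Rightarrow> bool"
  where "unitary_rep V \<longleftrightarrow>
    invariant V \<and> commutation_relations_on V \<and>
    (\<forall>\<Psi>\<in>V. square_integrable \<Psi>) \<and>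
    (\<forall>\<Psi>\<^sub>1\<in>V. \<forall>\<Psi>\<^sub>2\<in>V. \<forall>t t'. spinor_inner t \<Psi>\<^sub>1 \<Psi>\<^sub>2 = spinor_inner t' \<Psi>\<^sub>1 \<Psi>\<^sub>2) \<and>
    (\<exists>B. spinor.span B = V \<and>
         (\<forall>b\<in>B. \<exists>\<mu>::real. L0 b = of_real \<mu> *\<^sub>\<Psi> b) \<and>
         (\<forall>b\<in>B. \<forall>b'\<in>B. \<forall>t. spinor_inner t b b' = (if b = b' then 1 else 0))) \<and>
    (\<forall>\<Psi>\<^sub>1\<in>V. \<forall>\<Psi>\<^sub>2\<in>V. \<forall>t.
       spinor_inner t (L_plus \<Psi>\<^sub>1) \<Psi>\<^sub>2 = - spinor_inner t \<Psi>\<^sub>1 (L_minus \<Psi>\<^sub>2) \<and>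
       spinor_inner t (L_minus \<Psi>\<^sub>1) \<Psi>\<^sub>2 = - spinor_inner t \<Psi>\<^sub>1 (L_plus \<Psi>\<^sub>2))"

definition L0_eigenspace :: "spinor_field set \<Rightarrow> complex \<Rightarrow> spinor_field set"
  where "L0_eigenspace V \<mu> = {\<Psi> \<in> V. L0 \<Psi> = \<mu> *\<^sub>\<Psi> \<Psi>}"

definition simple_L0_spectrum :: "spinor_field set \<Rightarrow> complex set \<Rightarrow> bool"
  where "simple_L0_spectrum V S \<longleftrightarrow>
    {\<mu>. L0_eigenspace V \<mu> \<noteq> {0}} = S \<and> (\<forall>\<mu>\<in>S. spinor.dim (L0_eigenspace V \<mu>) = 1)"

text \<open>\<open>discrete_series 1 \<lambda>\<close> is \<open>\<D>\<^sup>+\<^sub>\<lambda>\<close> and \<open>discrete_series (-1) \<lambda>\<close> is \<open>\<D>\<^sup>-\<^sub>\<lambda>\<close>.\<close>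

definition discrete_series :: "real \<Rightarrow> real \<Rightarrow> spinor_field set \<Rightarrow> bool"
  where "discrete_series s lam V \<longleftrightarrow>
    irreducible_rep V \<and> unitary_rep V \<and>
    simple_L0_spectrum V (range (\<lambda>n::nat. of_real (s * (lam + real n)))) \<and>
    (\<forall>\<Psi>\<in>V. Casimir \<Psi> = of_real (lam * (lam - 1)) *\<^sub>\<Psi> \<Psi>)"

text \<open>\<open>complementary_series M\<close> is \<open>\<C>\<^sup>0\<close> with index \<open>1/2 + M\<close>.\<close>

definition complementary_series :: "real \<Rightarrow> spinor_field set \<Rightarrow> bool"
  where "complementary_series M V \<longleftrightarrow>
    irreducible_rep V \<and> unitary_rep V \<and>
    simple_L0_spectrum V \<int> \<and>
    (\<forall>\<Psi>\<in>V. Casimir \<Psi> = of_real (M\<^sup>2 - 1 / 4) *\<^sub>\<Psi> \<Psi>)"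

definition positive_frequency_part :: "spinor_field set \<Rightarrow> spinor_field set"
  where "positive_frequency_part V = spinor.span {\<Psi> \<in> V. \<exists>\<omega>>0. has_frequency \<omega> \<Psi>}"

definition negative_frequency_part :: "spinor_field set \<Rightarrow> spinor_field set"
  where "negative_frequency_part V = spinor.span {\<Psi> \<in> V. \<exists>\<omega><0. has_frequency \<omega> \<Psi>}"

text \<open>
  A zero-frequency mode is neither of positive nor of negative frequency; so that its presence alone
  does not rule out a splitting, it may be placed in either summand.
\<close>

definition splits_by_frequency :: "spinor_field set \<Rightarrow> bool"
  where "splits_by_frequency V \<longleftrightarrow> (\<exists>U W. invariant U \<and> invariant W \<and>
    positive_frequency_part V \<subseteq> U \<and> negative_frequency_part V \<subseteq> W \<and>
    U \<inter> W = {0} \<and> {u + w | u w. u \<in> U \<and> w \<in> W} = V)"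


section \<open>The radial operator and the boundary conditions\<close>

definition radial_op :: "real \<Rightarrow> (real \<Rightarrow> complex^2) \<Rightarrow> real \<Rightarrow> complex^2"
  where "radial_op M \<Phi> \<rho> = vector
    [- vector_derivative (\<lambda>r. \<Phi> r $ 2) (at \<rho>) + of_real (M / cos \<rho>) * \<Phi> \<rho> $ 2,
     vector_derivative (\<lambda>r. \<Phi> r $ 1) (at \<rho>) + of_real (M / cos \<rho>) * \<Phi> \<rho> $ 1]"

definition radial_solution :: "real \<Rightarrow> real \<Rightarrow> (real \<Rightarrow> complex^2) \<Rightarrow> bool"
  where "radial_solution M \<omega> \<Phi> \<longleftrightarrow> \<Phi> differentiable_on rho_interval \<and>
    (\<forall>\<rho>\<in>rho_interval. radial_op M \<Phi> \<rho> = of_real \<omega> *s \<Phi> \<rho>)"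

definition sigma :: "real \<Rightarrow> real"
  where "sigma \<rho> = ((1 - sin \<rho>) / (1 + sin \<rho>)) powr (1 / 2)"

definition tilde1 :: "real \<Rightarrow> (real \<Rightarrow> complex^2) \<Rightarrow> real \<Rightarrow> complex"
  where "tilde1 M \<Phi> \<rho> = of_real (sigma \<rho> powr (- M)) * \<Phi> \<rho> $ 1"

definition tilde2 :: "real \<Rightarrow> (real \<Rightarrow> complex^2) \<Rightarrow> real \<Rightarrow> complex"
  where "tilde2 M \<Phi> \<rho> = of_real (sigma \<rho> powr M) * \<Phi> \<rho> $ 2"

definition zero_right :: "(real \<Rightarrow> complex) \<Rightarrow> bool"
  where "zero_right f \<longleftrightarrow> (f \<longlongrightarrow> 0) (at_left (pi / 2))"

definition zero_left :: "(real \<Rightarrow> complex) \<Rightarrow> bool"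
  where "zero_left f \<longleftrightarrow> (f \<longlongrightarrow> 0) (at_right (- pi / 2))"

definition bc_I :: "real \<Rightarrow> (real \<Rightarrow> complex^2) \<Rightarrow> bool"
  where "bc_I M \<Phi> \<longleftrightarrow> zero_right (tilde2 M \<Phi>) \<and> zero_left (tilde1 M \<Phi>)"

definition bc_II :: "real \<Rightarrow> (real \<Rightarrow> complex^2) \<Rightarrow> bool"
  where "bc_II M \<Phi> \<longleftrightarrow> zero_right (tilde1 M \<Phi>) \<and> zero_left (tilde2 M \<Phi>)"

definition bc_III :: "real \<Rightarrow> (real \<Rightarrow> complex^2) \<Rightarrow> bool"
  where "bc_III M \<Phi> \<longleftrightarrow> zero_right (tilde1 M \<Phi>) \<and> zero_left (tilde1 M \<Phi>)"

definition bc_IV :: "real \<Rightarrow> (real \<Rightarrow> complex^2) \<Rightarrow> bool"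
  where "bc_IV M \<Phi> \<longleftrightarrow> zero_right (tilde2 M \<Phi>) \<and> zero_left (tilde2 M \<Phi>)"

definition bvp_solution ::
    "real \<Rightarrow> (real \<Rightarrow> (real \<Rightarrow> complex^2) \<Rightarrow> bool) \<Rightarrow> real \<Rightarrow> (real \<Rightarrow> complex^2) \<Rightarrow> bool"
  where "bvp_solution M bc \<omega> \<Phi> \<longleftrightarrow> radial_solution M \<omega> \<Phi> \<and> bc M \<Phi>"

definition nonzero_spinor :: "(real \<Rightarrow> complex^2) \<Rightarrow> bool"
  where "nonzero_spinor \<Phi> \<longleftrightarrow> (\<exists>\<rho>\<in>rho_interval. \<Phi> \<rho> \<noteq> 0)"

definition frequencies :: "real \<Rightarrow> (real \<Rightarrow> (real \<Rightarrow> complex^2) \<Rightarrow> bool) \<Rightarrow> real set"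
  where "frequencies M bc = {\<omega>. \<exists>\<Phi>. bvp_solution M bc \<omega> \<Phi> \<and> nonzero_spinor \<Phi>}"

definition unique_up_to_scalars ::
    "real \<Rightarrow> (real \<Rightarrow> (real \<Rightarrow> complex^2) \<Rightarrow> bool) \<Rightarrow> real \<Rightarrow> bool"
  where "unique_up_to_scalars M bc \<omega> \<longleftrightarrow>
    (\<forall>\<Phi> \<Phi>'. bvp_solution M bc \<omega> \<Phi> \<and> nonzero_spinor \<Phi> \<and> bvp_solution M bc \<omega> \<Phi>' \<longrightarrow>
       (\<exists>c. \<forall>\<rho>\<in>rho_interval. \<Phi>' \<rho> = c *s \<Phi> \<rho>))"

definition normalized_mode ::
    "real \<Rightarrow> (real \<Rightarrow> (real \<Rightarrow> complex^2) \<Rightarrow> bool) \<Rightarrow> real \<Rightarrow> spinor_field \<Rightarrow> bool"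
  where "normalized_mode M bc \<omega> \<Psi> \<longleftrightarrow>
    (\<forall>\<Phi>. bvp_solution M bc \<omega> \<Phi> \<and> nonzero_spinor \<Phi> \<longrightarrow>
       (\<exists>c. c \<noteq> 0 \<and> \<Psi> = c *\<^sub>\<Psi> stationary \<omega> \<Phi>)) \<and>
    (\<forall>t. spinor_inner t \<Psi> \<Psi> = 1)"


section \<open>The modes\<close>

definition hyp2F1 :: "real \<Rightarrow> real \<Rightarrow> real \<Rightarrow> real \<Rightarrow> real"
  where "hyp2F1 a b c z = eval_fps (fps_hypergeo [a, b] [c] 1) z"

definition jacobi_P :: "nat \<Rightarrow> real \<Rightarrow> real \<Rightarrow> real \<Rightarrow> real"
  where "jacobi_P n a b x = Gamma (real n + a + 1) / (fact n * Gamma (a + 1)) *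
    hyp2F1 (real n + a + b + 1) (- real n) (a + 1) ((1 - x) / 2)"

definition real_spinor :: "real \<Rightarrow> real \<Rightarrow> complex^2"
  where "real_spinor x y = vector [of_real x, of_real y]"

definition omega_I :: "real \<Rightarrow> nat \<Rightarrow> real"
  where "omega_I M n = 1 / 2 + M + real n"

definition N_I :: "real \<Rightarrow> nat \<Rightarrow> real"
  where "N_I M n = sqrt (fact n * Gamma (real n + 2 * M + 1)) /
    (2 powr (M + 1 / 2) * Gamma (1 / 2 + M + real n))"

text \<open>
  In \<open>Psi_I\<close> and \<open>Psi_II\<close>, the argument \<open>s \<in> {1, -1}\<close> is the sign in the superscript
  \<open>\<plusminus>\<close> of the mode.
\<close>

definition Psi_I :: "real \<Rightarrow> real \<Rightarrow> nat \<Rightarrow> spinor_field"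
  where "Psi_I M s n = stationary (s * omega_I M n) (\<lambda>\<rho>.
    of_real (N_I M n * cos \<rho> powr M) *s real_spinor
      ((1 + sin \<rho>) powr (1 / 2) * jacobi_P n (- 1 / 2 + M) (1 / 2 + M) (sin \<rho>))
      (s * ((1 - sin \<rho>) powr (1 / 2) * jacobi_P n (1 / 2 + M) (- 1 / 2 + M) (sin \<rho>))))"

definition omega_II :: "real \<Rightarrow> nat \<Rightarrow> real"
  where "omega_II M n = 1 / 2 - M + real n"

definition N_II :: "real \<Rightarrow> nat \<Rightarrow> real"
  where "N_II M n = sqrt (fact n * Gamma (real n - 2 * M + 1)) /
    (2 powr (1 / 2 - M) * Gamma (1 / 2 - M + real n))"

definition Psi_II :: "real \<Rightarrow> real \<Rightarrow> nat \<Rightarrow> spinor_field"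
  where "Psi_II M s n = stationary (s * omega_II M n) (\<lambda>\<rho>.
    of_real (N_II M n * cos \<rho> powr (- M)) *s real_spinor
      ((1 - sin \<rho>) powr (1 / 2) * jacobi_P n (1 / 2 - M) (- 1 / 2 - M) (sin \<rho>))
      (- s * ((1 + sin \<rho>) powr (1 / 2) * jacobi_P n (- 1 / 2 - M) (1 / 2 - M) (sin \<rho>))))"

definition N_int :: "real \<Rightarrow> nat \<Rightarrow> real"
  where "N_int M n = fact n / (2 * sqrt (Gamma (1 / 2 + M + real n) * Gamma (1 / 2 - M + real n)))"

text \<open>
  For \<open>k \<noteq> 0\<close>, the modes \<open>Psi_III M k\<close> and \<open>Psi_IV M k\<close> are those with index \<open>\<plusminus>n\<close>, where
  \<open>n = \<bar>k\<bar>\<close> and the sign is \<open>sgn k\<close>.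
\<close>

definition Psi_III :: "real \<Rightarrow> int \<Rightarrow> spinor_field"
  where "Psi_III M k = (let n = nat \<bar>k\<bar> in stationary (of_int k) (\<lambda>\<rho>.
    of_real (N_int M n * ((1 + sin \<rho>) / (1 - sin \<rho>)) powr (M / 2)) *s
      (if k = 0 then real_spinor 0 (- 2)
       else real_spinor
         (cos \<rho> * jacobi_P (n - 1) (1 / 2 - M) (1 / 2 + M) (sin \<rho>))
         (- of_int (sgn k) * 2 * jacobi_P n (- 1 / 2 - M) (- 1 / 2 + M) (sin \<rho>)))))"

definition Psi_IV :: "real \<Rightarrow> int \<Rightarrow> spinor_field"
  where "Psi_IV M k = (let n = nat \<bar>k\<bar> in stationary (of_int k) (\<lambda>\<rho>.
    of_real (N_int M n * ((1 - sin \<rho>) / (1 + sin \<rho>)) powr (M / 2)) *s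
      (if k = 0 then real_spinor 2 0
       else real_spinor
         (2 * jacobi_P n (- 1 / 2 + M) (- 1 / 2 - M) (sin \<rho>))
         (of_int (sgn k) * (cos \<rho> * jacobi_P (n - 1) (1 / 2 + M) (1 / 2 - M) (sin \<rho>))))))"

end

theory Submission
  imports Defs
begin

text \<open>
  The rescaled components \<open>f, g\<close> of a solution satisfy \<open>f' = \<omega> \<sigma>\<^sup>-\<^sup>2\<^sup>M g\<close> and \<open>g' = - \<omega> \<sigma>\<^sup>2\<^sup>M f\<close>,
  and for \<open>\<bar>M\<bar> < 1/2\<close> both weights are integrable. Hence \<open>f\<close> and \<open>g\<close> are bounded and a Wronskian,
  which is constant and tends to \<open>0\<close> under the boundary conditions, gives uniqueness for each
  frequency. On solutions \<open>L\<^sub>\<plusminus>\<close> act algebraically; they respect each of the four boundary conditions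
  and are anti-adjoint up to a total derivative, so the representations are determined by
  uniqueness and the ladder relations alone. These also propagate the norms, starting from a Beta
  integral, by comparison of boundary values at \<open>\<pi>/2\<close>. There are no further frequencies because a
  solution orthogonal to all modes has vanishing polynomial moments in \<open>sin \<rho>\<close>. Cases (II) and (IV)
  follow from (I) and (III) by \<open>(\<Phi>\<^sub>1, \<Phi>\<^sub>2) \<mapsto> (\<Phi>\<^sub>2, - \<Phi>\<^sub>1)\<close>, \<open>M \<mapsto> - M\<close>.
\<close>

section \<open>The weight\<close>

text \<open>The working hypothesis is \<open>\<bar>M\<bar> < 1/2\<close> instead of
  \<open>0 < M\<close>, so that exchanging the components, which replaces \<open>M\<close> by
  \<open>- M\<close>, stays within it. Spectral theory is avoided when excluding further
  frequencies. The modes at \<omega> and at - \<omega> differ only in the sign of the second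
  component, so orthogonality to both separates the two components. In case (I) each component of
  the n-th mode is that of the lowest mode times a polynomial of degree n, and Weierstrass
  approximation applies; in case (III) this holds for the second component, and the equation then
  yields the first.

  Squares of Jacobi polynomials are never integrated beyond the lowest mode. Raising a mode gives a
  multiple of the next one; anti-adjointness gives the norm of the result, and the modulus of the
  multiple is a ratio of boundary values. At \<pi>/2 these values are explicit Gamma quotients, so
  the norms obey a recursion that the stated constants solve.\<close>

lemma cos_pos_rho: "\<rho> \<in> rho_interval \<Longrightarrow> 0 < cos \<rho>"
  by (intro cos_gt_zero_pi) auto

lemma sin_bounds_rho:
  assumes "\<rho> \<in> rho_interval"
  shows "- 1 < sin \<rho>" "sin \<rho> < 1"
proof -
  have "0 < (cos \<rho>)\<^sup>2" using cos_pos_rho[OF assms] by simp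
  then have "(sin \<rho>)\<^sup>2 < 1" by (simp add: cos_squared_eq)
  then show "- 1 < sin \<rho>" "sin \<rho> < 1"
    using abs_square_less_1[of "sin \<rho>"] by auto
qed

lemma sigma_pos: "\<rho> \<in> rho_interval \<Longrightarrow> 0 < sigma \<rho>"
  using sin_bounds_rho[of \<rho>] by (simp add: sigma_def)

lemma cos_eq_powr_sin:
  assumes "\<rho> \<in> rho_interval"
  shows "cos \<rho> = (1 - sin \<rho>) powr (1/2) * (1 + sin \<rho>) powr (1/2)"
proof -
  have "cos \<rho> = sqrt ((cos \<rho>)\<^sup>2)" using cos_pos_rho[OF assms] by simp
  also have "(cos \<rho>)\<^sup>2 = (1 - sin \<rho>) * (1 + sin \<rho>)"
    by (simp add: cos_squared_eq power2_eq_square algebra_simps)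
  finally show ?thesis
    using sin_bounds_rho[OF assms] by (simp add: powr_half_sqrt real_sqrt_mult)
qed

lemma sigma_powr:
  assumes "\<rho> \<in> rho_interval"
  shows "sigma \<rho> powr a = (1 - sin \<rho>) powr (a/2) * (1 + sin \<rho>) powr (- a/2)"
  using sin_bounds_rho[OF assms]
  by (simp add: sigma_def powr_powr powr_divide powr_minus_divide divide_simps)

lemma cos_sigma_powr:
  assumes "\<rho> \<in> rho_interval"
  shows "cos \<rho> * sigma \<rho> powr a = (1 - sin \<rho>) powr (1/2 + a/2) * (1 + sin \<rho>) powr (1/2 - a/2)"
  using sin_bounds_rho[OF assms] unfolding sigma_powr[OF assms] 
  by (subst cos_eq_powr_sin[OF assms]) (simp add: powr_add powr_diff powr_minus_divide)

lemma sigma_powr_cancel: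
  assumes "\<rho> \<in> rho_interval"
  shows "sigma \<rho> powr a * sigma \<rho> powr (- a) = 1" "sigma \<rho> powr (- a) * sigma \<rho> powr a = 1"
  using sigma_pos[OF assms] by (simp_all flip: powr_add)

text \<open>The logarithmic derivative of \<sigma> is \<open>- 1 / cos \<rho>\<close>; this is why
  rescaling by powers of \<sigma> absorbs the mass term. The exponential \<open>?E\<close> agrees
  with the power on the open interval, which is enough for the derivative.\<close>

lemma has_real_derivative_sigma_powr:
  assumes "\<rho> \<in> rho_interval"
  shows "((\<lambda>r. sigma r powr a) has_real_derivative - a / cos \<rho> * sigma \<rho> powr a) (at \<rho>)"
proof -
  let ?E = "\<lambda>r. exp (a/2 * (ln (1 - sin r) - ln (1 + sin r)))"
  have eq: "?E r = sigma r powr a" if "r \<in> rho_interval" for r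
    using sin_bounds_rho[OF that]
    unfolding sigma_powr[OF that] by (simp add: powr_def exp_add[symmetric] algebra_simps)
  have "(?E has_real_derivative ?E \<rho> * (a/2 * (- cos \<rho> / (1 - sin \<rho>) - cos \<rho> / (1 + sin \<rho>)))) (at \<rho>)"
    using sin_bounds_rho[OF assms]
    by (intro DERIV_fun_exp DERIV_cmult DERIV_diff) (auto intro!: derivative_eq_intros)
  also have "- cos \<rho> / (1 - sin \<rho>) - cos \<rho> / (1 + sin \<rho>) = - 2 * cos \<rho> / ((1 - sin \<rho>) * (1 + sin \<rho>))"
    using sin_bounds_rho[OF assms] by (simp add: divide_simps) (simp add: algebra_simps)
  also have "(1 - sin \<rho>) * (1 + sin \<rho>) = cos \<rho> * cos \<rho>"
    using sin_cos_squared_add[of \<rho>] by (simp add: power2_eq_square algebra_simps)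
  also have "?E \<rho> * (a/2 * (- 2 * cos \<rho> / (cos \<rho> * cos \<rho>))) = - a / cos \<rho> * ?E \<rho>"
    using cos_pos_rho[OF assms] by simp
  finally have "(?E has_real_derivative - a / cos \<rho> * sigma \<rho> powr a) (at \<rho>)"
    by (simp only: eq[OF assms])
  then show ?thesis
    by (rule has_field_derivative_transform_within_open[where S = rho_interval])
      (use assms eq in auto)
qed

section \<open>Integrable majorant for the powers of the weight\<close>

lemma tan_ge_self:
  fixes x :: real
  assumes "0 \<le> x" "x < pi/2"
  shows "x \<le> tan x"
proof -
  have "(\<lambda>y. tan y - y) 0 \<le> (\<lambda>y. tan y - y) x"
  proof (rule DERIV_nonneg_imp_nondecreasing[OF assms(1)])
    fix y assume y: "0 \<le> y" "y \<le> x"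
    then have c: "0 < cos y" using assms by (intro cos_gt_zero_pi) auto
    have "((\<lambda>y. tan y - y) has_real_derivative (inverse ((cos y)\<^sup>2) - 1)) (at y)"
      using c by (auto intro!: derivative_eq_intros)
    moreover have "0 \<le> inverse ((cos y)\<^sup>2) - 1"
      using c by (simp add: one_le_inverse_iff abs_square_le_1)
    ultimately show "\<exists>z. ((\<lambda>y. tan y - y) has_real_derivative z) (at y) \<and> 0 \<le> z" by blast
  qed
  then show ?thesis by simp
qed

lemma sigma_eq_tan:
  assumes "\<rho> \<in> rho_interval"
  shows "sigma \<rho> = tan (pi/4 - \<rho>/2)"
proof -
  define \<theta> where "\<theta> = pi/4 - \<rho>/2"
  have \<theta>: "0 < \<theta>" "\<theta> < pi/2" using assms by (auto simp: \<theta>_def)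
  have s: "sin \<rho> = cos (2 * \<theta>)" by (simp add: \<theta>_def cos_diff)
  have c: "0 < cos \<theta>" "0 < sin \<theta>" using \<theta> by (auto intro!: cos_gt_zero_pi sin_gt_zero)
  have "(1 - sin \<rho>) / (1 + sin \<rho>) = (tan \<theta>)\<^sup>2"
    using c unfolding s cos_double_cos
    by (simp add: tan_def power_divide sin_squared_eq)
      (simp add: divide_simps)
  then show ?thesis
    using tan_gt_zero[OF \<theta>] by (simp add: sigma_def powr_half_sqrt \<theta>_def)
qed

lemma sigma_minus:
  assumes "\<rho> \<in> rho_interval"
  shows "sigma (- \<rho>) = 1 / sigma \<rho>"
  using sin_bounds_rho[OF assms] by (simp add: sigma_def powr_divide)

text \<open>From \<open>\<sigma> = tan (\<pi>/4 - \<rho>/2) \<ge> \<pi>/4 - \<rho>/2\<close> and the same bound for \<open>1/\<sigma>\<close>.\<close>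

definition sigma_majorant :: "real \<Rightarrow> real \<Rightarrow> real" where
  "sigma_majorant m \<rho> = (pi/4 - \<rho>/2) powr (- 2 * m) + (pi/4 + \<rho>/2) powr (- 2 * m)"

text \<open>For \<open>m < 1/2\<close> the exponent \<open>1 - 2 * m\<close> is positive, so this
  function stays finite up to both ends although its derivative blows up there. This is where the
  restriction on \<open>\<bar>M\<bar>\<close> makes the weights integrable.\<close>

definition sigma_majorant_primitive :: "real \<Rightarrow> real \<Rightarrow> real" where
  "sigma_majorant_primitive m \<rho> =
    2 / (1 - 2 * m) * ((pi/4 + \<rho>/2) powr (1 - 2 * m) - (pi/4 - \<rho>/2) powr (1 - 2 * m))"

text \<open>Only the power with negative exponent is estimated: the reflection \<rho> \<mapsto> -
  \<rho> inverts \<sigma> and turns that estimate into one for the positive exponent. Adding both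
  powers gives a bound that is symmetric in the sign of \<open>M\<close>.\<close>

lemma sigma_powr_le_majorant:
  assumes "\<rho> \<in> rho_interval"
  shows "sigma \<rho> powr (2 * M) + sigma \<rho> powr (- 2 * M) \<le> sigma_majorant \<bar>M\<bar> \<rho>"
proof -
  have 1: "sigma r powr (- 2 * \<bar>M\<bar>) \<le> (pi/4 - r/2) powr (- 2 * \<bar>M\<bar>)" if "r \<in> rho_interval" for r
    using that by (intro powr_mono2') (auto simp: sigma_eq_tan[OF that] intro!: tan_ge_self)
  have 2: "sigma \<rho> powr (2 * \<bar>M\<bar>) = sigma (- \<rho>) powr (- 2 * \<bar>M\<bar>)"
    using sigma_pos[OF assms] by (simp add: sigma_minus[OF assms] powr_minus powr_divide divide_simps)
  have "- \<rho> \<in> rho_interval" using assms by auto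
  from 1[OF this] 1[OF assms] have "sigma \<rho> powr (2 * \<bar>M\<bar>) + sigma \<rho> powr (- 2 * \<bar>M\<bar>) \<le> sigma_majorant \<bar>M\<bar> \<rho>"
    unfolding 2 sigma_majorant_def by simp
  then show ?thesis by (cases "M \<ge> 0") auto
qed

lemma sigma_majorant_ge_1:
  assumes "\<rho> \<in> rho_interval"
  shows "1 \<le> sigma_majorant \<bar>M\<bar> \<rho>"
proof -
  let ?a = "sigma \<rho> powr (2 * M)"
  have a: "0 < ?a" using sigma_pos[OF assms] by simp
  have "1 \<le> ?a + inverse ?a" 
    using a by (cases "1 \<le> ?a") (auto simp: one_le_inverse_iff intro: add_increasing add_increasing2)
  also have "\<dots> = ?a + sigma \<rho> powr (- 2 * M)" using powr_minus[of "sigma \<rho>" "2*M"] by simp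
  finally show ?thesis using sigma_powr_le_majorant[OF assms, of M] by linarith
qed

lemma sigma_majorant_primitive_deriv:
  assumes "\<rho> \<in> rho_interval" "m < 1/2"
  shows "(sigma_majorant_primitive m has_real_derivative sigma_majorant m \<rho>) (at \<rho>)"
proof -
  have "((\<lambda>r. (pi/4 + r/2) powr (1 - 2 * m)) has_real_derivative
      (1 - 2 * m) * (pi/4 + \<rho>/2) powr (1 - 2 * m - of_nat 1) * (1/2)) (at \<rho>)"
    using assms by (intro DERIV_fun_powr) (auto intro!: derivative_eq_intros)
  moreover have "((\<lambda>r. (pi/4 - r/2) powr (1 - 2 * m)) has_real_derivative
      (1 - 2 * m) * (pi/4 - \<rho>/2) powr (1 - 2 * m - of_nat 1) * (- 1/2)) (at \<rho>)"
    using assms by (intro DERIV_fun_powr) (auto intro!: derivative_eq_intros)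
  ultimately have "(sigma_majorant_primitive m has_real_derivative 2 / (1 - 2 * m) *
      ((1 - 2 * m) * (pi/4 + \<rho>/2) powr (1 - 2 * m - of_nat 1) * (1/2) -
       (1 - 2 * m) * (pi/4 - \<rho>/2) powr (1 - 2 * m - of_nat 1) * (- 1/2))) (at \<rho>)"
    unfolding sigma_majorant_primitive_def by (intro DERIV_cmult DERIV_diff)
  also have "2 / (1 - 2 * m) *
      ((1 - 2 * m) * (pi/4 + \<rho>/2) powr (1 - 2 * m - of_nat 1) * (1/2) -
       (1 - 2 * m) * (pi/4 - \<rho>/2) powr (1 - 2 * m - of_nat 1) * (- 1/2)) = sigma_majorant m \<rho>"
    using assms unfolding sigma_majorant_def by (simp add: divide_simps) (simp add: algebra_simps)
  finally show ?thesis .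
qed

lemma continuous_on_majorant: "continuous_on rho_interval (sigma_majorant m)"
  unfolding sigma_majorant_def by (intro continuous_intros) auto

lemma sigma_majorant_primitive_bounded:
  assumes "\<rho> \<in> rho_interval" "0 \<le> m" "m < 1/2"
  shows "\<bar>sigma_majorant_primitive m \<rho>\<bar> \<le> 2 / (1 - 2 * m) * (pi/2) powr (1 - 2 * m)"
proof -
  have "(pi/4 + \<rho>/2) powr (1 - 2 * m) \<le> (pi/2) powr (1 - 2 * m)"
       "(pi/4 - \<rho>/2) powr (1 - 2 * m) \<le> (pi/2) powr (1 - 2 * m)"
    using assms by (auto intro!: powr_mono2)
  moreover have "0 \<le> (pi/4 + \<rho>/2) powr (1 - 2 * m)" "0 \<le> (pi/4 - \<rho>/2) powr (1 - 2 * m)" by auto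
  ultimately have "\<bar>(pi/4 + \<rho>/2) powr (1 - 2 * m) - (pi/4 - \<rho>/2) powr (1 - 2 * m)\<bar> \<le> (pi/2) powr (1 - 2 * m)"
    by linarith
  then show ?thesis
    using assms unfolding sigma_majorant_primitive_def abs_mult by (intro mult_mono) auto
qed

lemma rho_einterval: "einterval (ereal (- pi/2)) (ereal (pi/2)) = rho_interval"
  by (simp add: einterval_eq)

text \<open>The primitive is continuous on the closed interval, so it has finite limits at the ends,
  and the fundamental theorem for non-negative integrands turns this into integrability.\<close>

lemma set_integrable_majorant:
  assumes "0 \<le> m" "m < 1/2"
  shows "set_integrable lborel rho_interval (sigma_majorant m)"
proof -
  let ?K = "sigma_majorant_primitive m"
  have K: "continuous_on {-pi/2..pi/2} ?K"
    unfolding sigma_majorant_primitive_def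
    by (intro continuous_on_mult_left continuous_on_diff continuous_on_powr')
      (use assms in \<open>auto intro!: continuous_intros\<close>)
  have cont: "(?K \<longlongrightarrow> ?K x) (at x within S)" if "x \<in> {-pi/2..pi/2}" "S \<subseteq> {-pi/2..pi/2}" for x S
    using K that by (meson continuous_on_def tendsto_within_subset)
  have l: "(?K \<longlongrightarrow> ?K (-pi/2)) (at_right (-pi/2))"
    using cont[of "-pi/2" "{-pi/2..pi/2}"] by (simp add: at_within_Icc_at_right)
  have r: "(?K \<longlongrightarrow> ?K (pi/2)) (at_left (pi/2))"
    using cont[of "pi/2" "{-pi/2..pi/2}"] by (simp add: at_within_Icc_at_left)
  show ?thesis
    unfolding rho_einterval[symmetric]
  proof (rule interval_integral_FTC_nonneg(1))
    show "isCont (sigma_majorant m) x" if "ereal (- pi/2) < ereal x" "ereal x < ereal (pi/2)" for x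
      using continuous_on_majorant[of m] that by (simp add: continuous_on_eq_continuous_at)
    show "((?K \<circ> real_of_ereal) \<longlongrightarrow> ?K (-pi/2)) (at_right (ereal (-pi/2)))"
      using l by (simp add: ereal_tendsto_simps)
    show "((?K \<circ> real_of_ereal) \<longlongrightarrow> ?K (pi/2)) (at_left (ereal (pi/2)))"
      using r by (simp add: ereal_tendsto_simps)
  qed (use assms sigma_majorant_primitive_deriv in \<open>auto simp: sigma_majorant_def\<close>)
qed

lemma set_integrable_of_majorant:
  fixes h :: "real \<Rightarrow> 'b :: euclidean_space"
  assumes "continuous_on rho_interval h" "0 \<le> m" "m < 1/2"
    and "\<And>\<rho>. \<rho> \<in> rho_interval \<Longrightarrow> norm (h \<rho>) \<le> C * sigma_majorant m \<rho>"
  shows "set_integrable lborel rho_interval h"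
proof (rule set_integrable_bound)
  show "set_integrable lborel rho_interval (\<lambda>\<rho>. C * sigma_majorant m \<rho>)"
    using set_integrable_majorant[OF assms(2,3)] by (intro set_integrable_mult_right)
  show "set_borel_measurable lborel rho_interval h"
    using borel_measurable_continuous_on_indicator[OF _ assms(1)] by (simp add: set_borel_measurable_def)
  show "AE \<rho> in lborel. \<rho> \<in> rho_interval \<longrightarrow> norm (h \<rho>) \<le> norm (C * sigma_majorant m \<rho>)"
    using assms(4) by (intro AE_I2 impI) (force intro: order_trans[OF _ abs_ge_self])
qed

text \<open>The common form of the two integrations by parts: with the Wronskian it gives
  orthogonality, with the combination in \<open>radial_ladder_adjoint_deriv\<close> the adjointness
  of the ladder operators.\<close>

lemma integral_rho_derivative_eq_0:
  fixes G g :: "real \<Rightarrow> complex"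
  assumes "\<And>\<rho>. \<rho> \<in> rho_interval \<Longrightarrow> (G has_vector_derivative g \<rho>) (at \<rho>)"
    and "continuous_on rho_interval g" "set_integrable lborel rho_interval g"
    and "(G \<longlongrightarrow> 0) (at_right (- pi / 2))" "(G \<longlongrightarrow> 0) (at_left (pi / 2))"
  shows "(LINT \<rho>:rho_interval|lborel. g \<rho>) = 0"
proof -
  have "(LBINT x=ereal (-pi/2)..ereal (pi/2). g x) = 0 - 0"
  proof (rule interval_integral_FTC_integrable)
    show "isCont g x" if "ereal (- pi/2) < ereal x" "ereal x < ereal (pi/2)" for x
      using assms(2) that by (simp add: continuous_on_eq_continuous_at)
    show "set_integrable lborel (einterval (ereal (- pi / 2)) (ereal (pi / 2))) g"
      using assms(3) by (simp add: rho_einterval)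
  qed (use assms in \<open>auto simp: ereal_tendsto_simps\<close>)
  then show ?thesis
    by (simp add: interval_lebesgue_integral_def rho_einterval)
qed

section \<open>Limits at the two ends\<close>

lemma isCont_imp_tendsto_at_left: "isCont f x \<Longrightarrow> (f \<longlongrightarrow> f x) (at_left x)"
  and isCont_imp_tendsto_at_right: "isCont f x \<Longrightarrow> (f \<longlongrightarrow> f x) (at_right x)"
  for f :: "real \<Rightarrow> 'b :: topological_space"
  by (auto simp: isCont_def intro: tendsto_within_subset)

lemma eventually_rho_left: "\<forall>\<^sub>F \<rho> in at_right (- pi / 2). \<rho> \<in> rho_interval"
  and eventually_rho_right: "\<forall>\<^sub>F \<rho> in at_left (pi / 2). \<rho> \<in> rho_interval"
  using eventually_at_right_real[of "-pi/2" "pi/2"] eventually_at_left_real[of "-pi/2" "pi/2"]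
  by simp_all

text \<open>Since \<open>cos \<rho>\<close> is a product of two square roots, the product has the
  positive exponents \<open>1/2 + a/2\<close> and \<open>1/2 - a/2\<close>. Applied with exponents
  \<open>2 * M\<close> and \<open>- 2 * M\<close>, it removes the off-diagonal ladder terms and the
  singularity of the density at the ends.\<close>

lemma cos_sigma_powr_tendsto_0:
  assumes "\<bar>a\<bar> < 1"
  shows "((\<lambda>\<rho>. cos \<rho> * sigma \<rho> powr a) \<longlongrightarrow> 0) (at_left (pi / 2))"
    "((\<lambda>\<rho>. cos \<rho> * sigma \<rho> powr a) \<longlongrightarrow> 0) (at_right (- pi / 2))"
proof -
  let ?h = "\<lambda>\<rho>. (1 - sin \<rho>) powr (1/2 + a/2) * (1 + sin \<rho>) powr (1/2 - a/2)"
  have exps: "0 < 1/2 + a/2" "0 < 1/2 - a/2" using assms by auto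
  have "continuous_on UNIV ?h"
    using exps sin_ge_minus_one
    by (intro continuous_on_mult continuous_on_powr') (auto intro!: continuous_intros simp: add.commute[of 1] simp flip: diff_le_eq)
  then have c: "isCont ?h x" for x by (simp add: continuous_on_eq_continuous_at)
  have "(?h \<longlongrightarrow> ?h (pi/2)) (at_left (pi/2))" "(?h \<longlongrightarrow> ?h (-pi/2)) (at_right (-pi/2))"
    by (intro isCont_imp_tendsto_at_left isCont_imp_tendsto_at_right c)+
  then have h: "(?h \<longlongrightarrow> 0) (at_left (pi/2))" "(?h \<longlongrightarrow> 0) (at_right (-pi/2))"
    using exps by (simp_all add: sin_minus)
  show "((\<lambda>\<rho>. cos \<rho> * sigma \<rho> powr a) \<longlongrightarrow> 0) (at_left (pi / 2))"
    by (rule Lim_transform_eventually[OF h(1)])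
      (use eventually_rho_right in \<open>eventually_elim, simp only: cos_sigma_powr\<close>)
  show "((\<lambda>\<rho>. cos \<rho> * sigma \<rho> powr a) \<longlongrightarrow> 0) (at_right (- pi / 2))"
    by (rule Lim_transform_eventually[OF h(2)])
      (use eventually_rho_left in \<open>eventually_elim, simp only: cos_sigma_powr\<close>)
qed

section \<open>Radial solutions\<close>

lemma has_vector_derivative_vec2_iff:
  fixes \<Phi> :: "real \<Rightarrow> complex^2"
  fixes x S
  defines "F \<equiv> at x within S"
  shows "(\<Phi> has_vector_derivative D) F \<longleftrightarrow>
    ((\<lambda>r. \<Phi> r $ 1) has_vector_derivative D $ 1) F \<and> ((\<lambda>r. \<Phi> r $ 2) has_vector_derivative D $ 2) F"
proof
  assume "(\<Phi> has_vector_derivative D) F"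
  then show "((\<lambda>r. \<Phi> r $ 1) has_vector_derivative D $ 1) F \<and> ((\<lambda>r. \<Phi> r $ 2) has_vector_derivative D $ 2) F"
    using bounded_linear.has_vector_derivative[OF bounded_linear_vec_nth] by blast
next
  assume *: "((\<lambda>r. \<Phi> r $ 1) has_vector_derivative D $ 1) F \<and> ((\<lambda>r. \<Phi> r $ 2) has_vector_derivative D $ 2) F"
  have "((\<lambda>r. \<Phi> r $ i) has_vector_derivative D $ i) F" for i
    using * exhaust_2[of i] by auto
  then have "((\<lambda>r. \<Phi> r $ i \<bullet> b) has_derivative (\<lambda>h. (h *\<^sub>R D $ i) \<bullet> b)) F" for i b
    unfolding has_vector_derivative_def by (intro has_derivative_inner_left) auto
  then show "(\<Phi> has_vector_derivative D) F"
    unfolding has_vector_derivative_def F_def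
    by (subst has_derivative_componentwise_within) (auto simp: Basis_vec_def inner_axis)
qed

definition radial_rhs :: "real \<Rightarrow> real \<Rightarrow> (real \<Rightarrow> complex^2) \<Rightarrow> real \<Rightarrow> complex^2" where
  "radial_rhs M \<omega> \<Phi> \<rho> = vector
    [of_real \<omega> * \<Phi> \<rho> $ 2 - of_real (M / cos \<rho>) * \<Phi> \<rho> $ 1,
     of_real (M / cos \<rho>) * \<Phi> \<rho> $ 2 - of_real \<omega> * \<Phi> \<rho> $ 1]"

text \<open>\<open>vector_derivative\<close> has some value even where no derivative exists, so the
  eigenvalue equation carries information only together with differentiability. Both are merged here
  into one statement about an actual derivative.\<close>

lemma radial_solution_iff:
  "radial_solution M \<omega> \<Phi> \<longleftrightarrow>
    (\<forall>\<rho>\<in>rho_interval. (\<Phi> has_vector_derivative radial_rhs M \<omega> \<Phi> \<rho>) (at \<rho>))" (is "?L \<longleftrightarrow> ?R")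
proof
  assume L: ?L
  show ?R
  proof
    fix \<rho> assume \<rho>: "\<rho> \<in> rho_interval"
    then have "\<Phi> differentiable (at \<rho>)"
      using L by (simp add: radial_solution_def differentiable_on_eq_differentiable_at)
    then obtain D where D: "(\<Phi> has_vector_derivative D) (at \<rho>)"
      by (auto simp: vector_derivative_works)
    then have c: "((\<lambda>r. \<Phi> r $ 1) has_vector_derivative D $ 1) (at \<rho>)"
      "((\<lambda>r. \<Phi> r $ 2) has_vector_derivative D $ 2) (at \<rho>)"
      by (simp_all add: has_vector_derivative_vec2_iff)
    have "radial_op M \<Phi> \<rho> = of_real \<omega> *s \<Phi> \<rho>" using L \<rho> by (simp add: radial_solution_def)
    then have "D = radial_rhs M \<omega> \<Phi> \<rho>"
      unfolding radial_op_def vector_derivative_at[OF c(1)] vector_derivative_at[OF c(2)]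
      by (simp add: vec_eq_iff forall_2 radial_rhs_def algebra_simps)
    with D show "(\<Phi> has_vector_derivative radial_rhs M \<omega> \<Phi> \<rho>) (at \<rho>)" by simp
  qed
next
  assume R: ?R
  have "radial_op M \<Phi> \<rho> = of_real \<omega> *s \<Phi> \<rho>" if \<rho>: "\<rho> \<in> rho_interval" for \<rho>
  proof -
    have c: "((\<lambda>r. \<Phi> r $ 1) has_vector_derivative radial_rhs M \<omega> \<Phi> \<rho> $ 1) (at \<rho>)"
      "((\<lambda>r. \<Phi> r $ 2) has_vector_derivative radial_rhs M \<omega> \<Phi> \<rho> $ 2) (at \<rho>)"
      using R \<rho> by (simp_all add: has_vector_derivative_vec2_iff)
    show ?thesis
      unfolding radial_op_def vector_derivative_at[OF c(1)] vector_derivative_at[OF c(2)]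
      by (simp add: vec_eq_iff forall_2 radial_rhs_def)
  qed
  moreover have "\<Phi> differentiable (at \<rho>)" if "\<rho> \<in> rho_interval" for \<rho>
    using R that differentiableI_vector by blast
  ultimately show ?L
    by (simp add: radial_solution_def differentiable_on_eq_differentiable_at)
qed

lemma radial_solution_deriv:
  assumes "radial_solution M \<omega> \<Phi>" "\<rho> \<in> rho_interval"
  shows "((\<lambda>r. \<Phi> r $ 1) has_vector_derivative
      of_real \<omega> * \<Phi> \<rho> $ 2 - of_real (M / cos \<rho>) * \<Phi> \<rho> $ 1) (at \<rho>)"
    "((\<lambda>r. \<Phi> r $ 2) has_vector_derivative
      of_real (M / cos \<rho>) * \<Phi> \<rho> $ 2 - of_real \<omega> * \<Phi> \<rho> $ 1) (at \<rho>)"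
  using assms by (simp_all add: radial_solution_iff has_vector_derivative_vec2_iff radial_rhs_def)

lemma radial_solutionI:
  assumes "\<And>\<rho>. \<rho> \<in> rho_interval \<Longrightarrow> ((\<lambda>r. \<Phi> r $ 1) has_vector_derivative
      of_real \<omega> * \<Phi> \<rho> $ 2 - of_real (M / cos \<rho>) * \<Phi> \<rho> $ 1) (at \<rho>)"
    "\<And>\<rho>. \<rho> \<in> rho_interval \<Longrightarrow> ((\<lambda>r. \<Phi> r $ 2) has_vector_derivative
      of_real (M / cos \<rho>) * \<Phi> \<rho> $ 2 - of_real \<omega> * \<Phi> \<rho> $ 1) (at \<rho>)"
  shows "radial_solution M \<omega> \<Phi>"
  using assms by (simp add: radial_solution_iff has_vector_derivative_vec2_iff radial_rhs_def)

lemma radial_solution_continuous_on: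
  assumes "radial_solution M \<omega> \<Phi>"
  shows "continuous_on rho_interval (\<lambda>\<rho>. \<Phi> \<rho> $ j)"
proof -
  have "isCont \<Phi> \<rho>" if "\<rho> \<in> rho_interval" for \<rho>
    using assms that has_vector_derivative_continuous unfolding radial_solution_iff by blast
  then have "continuous_on rho_interval \<Phi>" by (simp add: continuous_on_eq_continuous_at)
  then show ?thesis by (intro continuous_intros)
qed

lemma radial_solution_lincomb:
  assumes "radial_solution M \<omega> \<Phi>" "radial_solution M \<omega> \<Phi>'"
  shows "radial_solution M \<omega> (\<lambda>\<rho>. a *s \<Phi> \<rho> + b *s \<Phi>' \<rho>)"
proof (rule radial_solutionI)
  fix \<rho> assume \<rho>: "\<rho> \<in> rho_interval"
  note d = radial_solution_deriv[OF assms(1) \<rho>] radial_solution_deriv[OF assms(2) \<rho>]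
  show "((\<lambda>r. (a *s \<Phi> r + b *s \<Phi>' r) $ 1) has_vector_derivative
      of_real \<omega> * (a *s \<Phi> \<rho> + b *s \<Phi>' \<rho>) $ 2 - of_real (M / cos \<rho>) * (a *s \<Phi> \<rho> + b *s \<Phi>' \<rho>) $ 1) (at \<rho>)"
    using has_vector_derivative_add[OF has_vector_derivative_mult_right[OF d(1), of a]
        has_vector_derivative_mult_right[OF d(3), of b]]
    by (simp add: algebra_simps)
  show "((\<lambda>r. (a *s \<Phi> r + b *s \<Phi>' r) $ 2) has_vector_derivative
      of_real (M / cos \<rho>) * (a *s \<Phi> \<rho> + b *s \<Phi>' \<rho>) $ 2 - of_real \<omega> * (a *s \<Phi> \<rho> + b *s \<Phi>' \<rho>) $ 1) (at \<rho>)"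
    using has_vector_derivative_add[OF has_vector_derivative_mult_right[OF d(2), of a]
        has_vector_derivative_mult_right[OF d(4), of b]]
    by (simp add: algebra_simps)
qed

section \<open>Rescaled components and the four boundary conditions\<close>

definition chirality :: "2 \<Rightarrow> real" where
  "chirality j = (if j = 1 then - 1 else 1)"

definition tilde :: "2 \<Rightarrow> real \<Rightarrow> (real \<Rightarrow> complex^2) \<Rightarrow> real \<Rightarrow> complex" where
  "tilde j M \<Phi> \<rho> = of_real (sigma \<rho> powr (chirality j * M)) * \<Phi> \<rho> $ j"

text \<open>The indices record which rescaled component vanishes at the left and at the right end,
  so that one proof serves all four boundary conditions.\<close>

definition bc_gen :: "2 \<Rightarrow> 2 \<Rightarrow> real \<Rightarrow> (real \<Rightarrow> complex^2) \<Rightarrow> bool" where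
  "bc_gen l r M \<Phi> \<longleftrightarrow> zero_left (tilde l M \<Phi>) \<and> zero_right (tilde r M \<Phi>)"

lemma chirality_simps [simp]: "chirality 1 = - 1" "chirality 2 = 1"
  by (simp_all add: chirality_def)

lemma tilde12: "tilde1 = tilde 1" "tilde2 = tilde 2"
  by (simp_all add: fun_eq_iff tilde_def tilde1_def tilde2_def)

lemma bc_eq_bc_gen:
  "bc_I = bc_gen 1 2" "bc_II = bc_gen 2 1" "bc_III = bc_gen 1 1" "bc_IV = bc_gen 2 2"
  by (auto simp: fun_eq_iff bc_I_def bc_II_def bc_III_def bc_IV_def bc_gen_def tilde12)

lemma component_eq_tilde:
  assumes "\<rho> \<in> rho_interval"
  shows "\<Phi> \<rho> $ j = of_real (sigma \<rho> powr (- chirality j * M)) * tilde j M \<Phi> \<rho>"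
  using sigma_powr_cancel(2)[OF assms, of "chirality j * M"]
  by (simp add: tilde_def mult.assoc[symmetric] flip: of_real_mult)

lemma tilde_deriv:
  assumes "radial_solution M \<omega> \<Phi>" "\<rho> \<in> rho_interval"
  shows "(tilde 1 M \<Phi> has_vector_derivative (\<omega> * sigma \<rho> powr (- 2 * M)) *\<^sub>R tilde 2 M \<Phi> \<rho>) (at \<rho>)"
    "(tilde 2 M \<Phi> has_vector_derivative (- \<omega> * sigma \<rho> powr (2 * M)) *\<^sub>R tilde 1 M \<Phi> \<rho>) (at \<rho>)"
proof -
  have s: "sigma \<rho> \<noteq> 0" using sigma_pos[OF assms(2)] by simp
  have p1: "sigma \<rho> powr (- M) = sigma \<rho> powr (- 2 * M) * sigma \<rho> powr M"
    and p2: "sigma \<rho> powr M = sigma \<rho> powr (2 * M) * sigma \<rho> powr (- M)"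
    by (simp_all flip: powr_add)
  note d = has_real_derivative_sigma_powr[OF assms(2), THEN has_vector_derivative_of_real]
  show "(tilde 1 M \<Phi> has_vector_derivative (\<omega> * sigma \<rho> powr (- 2 * M)) *\<^sub>R tilde 2 M \<Phi> \<rho>) (at \<rho>)"
    unfolding tilde_def[abs_def]
    using has_vector_derivative_mult[OF d radial_solution_deriv(1)[OF assms], of "- M"]
    by (simp add: scaleR_conv_of_real p1 algebra_simps)
  show "(tilde 2 M \<Phi> has_vector_derivative (- \<omega> * sigma \<rho> powr (2 * M)) *\<^sub>R tilde 1 M \<Phi> \<rho>) (at \<rho>)"
    unfolding tilde_def[abs_def]
    using has_vector_derivative_mult[OF d radial_solution_deriv(2)[OF assms], of "M"]
    by (simp add: scaleR_conv_of_real p2 algebra_simps)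
qed

section \<open>Gronwall estimate and boundedness of the rescaled components\<close>

lemma gronwall_majorant:
  fixes F F' :: "real \<Rightarrow> real"
  assumes m: "0 \<le> m" "m < 1/2"
    and F: "\<And>\<rho>. \<rho> \<in> rho_interval \<Longrightarrow> (F has_real_derivative F' \<rho>) (at \<rho>)"
    and bd: "\<And>\<rho>. \<rho> \<in> rho_interval \<Longrightarrow> \<bar>F' \<rho>\<bar> \<le> B * sigma_majorant m \<rho> * F \<rho>"
    and pos: "\<And>\<rho>. 0 \<le> F \<rho>" and B: "0 \<le> B"
    and \<rho>: "\<rho> \<in> rho_interval" and \<rho>0: "\<rho>0 \<in> rho_interval"
  shows "F \<rho> \<le> F \<rho>0 * exp (B * \<bar>sigma_majorant_primitive m \<rho> - sigma_majorant_primitive m \<rho>0\<bar>)"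
proof -
  let ?K = "sigma_majorant_primitive m"
  have d: "((\<lambda>r. F r * exp (c * ?K r)) has_real_derivative
      (F' r + c * sigma_majorant m r * F r) * exp (c * ?K r)) (at r)" if "r \<in> rho_interval" for c r
    using DERIV_mult[OF F[OF that] DERIV_fun_exp[OF DERIV_cmult[OF sigma_majorant_primitive_deriv[OF that m(2)]]], of c]
    by (simp add: algebra_simps)
  \<comment> \<open>The integrating factor is \<open>exp (c * ?K)\<close>, with
    \<open>c = - B\<close> to the right of the base point, where the product decreases, and
    \<open>c = B\<close> to the left, where it increases.\<close>
  have "\<exists>c. \<bar>c\<bar> = B \<and> F \<rho> * exp (c * ?K \<rho>) \<le> F \<rho>0 * exp (c * ?K \<rho>0)"
  proof (cases "\<rho>0 \<le> \<rho>")
    case True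
    have "F \<rho> * exp (- B * ?K \<rho>) \<le> F \<rho>0 * exp (- B * ?K \<rho>0)"
    proof (rule DERIV_nonpos_imp_nonincreasing[OF True])
      fix r assume "\<rho>0 \<le> r" "r \<le> \<rho>"
      then have r: "r \<in> rho_interval" using \<rho> \<rho>0 by auto
      have "(F' r + - B * sigma_majorant m r * F r) * exp (- B * ?K r) \<le> 0"
        using bd[OF r] by (intro mult_nonpos_nonneg) auto
      then show "\<exists>y. ((\<lambda>r. F r * exp (- B * ?K r)) has_real_derivative y) (at r) \<and> y \<le> 0"
        using d[OF r, of "- B"] by blast
    qed
    then show ?thesis using B by (intro exI[of _ "- B"]) auto
  next
    case False
    then have le: "\<rho> \<le> \<rho>0" by simp
    have "F \<rho> * exp (B * ?K \<rho>) \<le> F \<rho>0 * exp (B * ?K \<rho>0)"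
    proof (rule DERIV_nonneg_imp_nondecreasing[OF le])
      fix r assume "\<rho> \<le> r" "r \<le> \<rho>0"
      then have r: "r \<in> rho_interval" using \<rho> \<rho>0 by auto
      have "0 \<le> (F' r + B * sigma_majorant m r * F r) * exp (B * ?K r)"
        using bd[OF r] by (intro mult_nonneg_nonneg) auto
      then show "\<exists>y. ((\<lambda>r. F r * exp (B * ?K r)) has_real_derivative y) (at r) \<and> 0 \<le> y"
        using d[OF r, of B] by blast
    qed
    then show ?thesis using B by (intro exI[of _ B]) auto
  qed
  then obtain c where c: "\<bar>c\<bar> = B" "F \<rho> * exp (c * ?K \<rho>) \<le> F \<rho>0 * exp (c * ?K \<rho>0)" by blast
  have "F \<rho> = F \<rho> * exp (c * ?K \<rho>) * exp (- c * ?K \<rho>)" by (simp add: exp_add[symmetric])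
  also have "\<dots> \<le> F \<rho>0 * exp (c * ?K \<rho>0) * exp (- c * ?K \<rho>)" using c(2) by (intro mult_right_mono) auto
  also have "\<dots> = F \<rho>0 * exp (c * (?K \<rho>0 - ?K \<rho>))" by (simp add: exp_add[symmetric] exp_diff algebra_simps)
  also have "\<dots> \<le> F \<rho>0 * exp (B * \<bar>?K \<rho> - ?K \<rho>0\<bar>)"
    using pos[of \<rho>0] c(1) abs_ge_self[of "c * (?K \<rho>0 - ?K \<rho>)"]
    by (intro mult_left_mono) (auto simp: abs_mult abs_minus_commute)
  finally show ?thesis .
qed

text \<open>The derivative of \<open>F\<close> is 2 \<omega> times the difference of the two weights
  times the real inner product of the rescaled components. That inner product is at most half of
  \<open>F\<close> by Cauchy-Schwarz and the arithmetic-geometric mean inequality, and the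
  difference of the weights is at most the majorant.\<close>

lemma tilde_gronwall:
  assumes "radial_solution M \<omega> \<Phi>" "\<bar>M\<bar> < 1/2" "\<rho> \<in> rho_interval" "\<rho>0 \<in> rho_interval"
  defines "F \<equiv> \<lambda>\<rho>. (cmod (tilde 1 M \<Phi> \<rho>))\<^sup>2 + (cmod (tilde 2 M \<Phi> \<rho>))\<^sup>2"
  shows "F \<rho> \<le> F \<rho>0 * exp (\<bar>\<omega>\<bar> * \<bar>sigma_majorant_primitive \<bar>M\<bar> \<rho> - sigma_majorant_primitive \<bar>M\<bar> \<rho>0\<bar>)"
proof (rule gronwall_majorant)
  let ?t = "tilde 1 M \<Phi>" and ?u = "tilde 2 M \<Phi>"
  let ?w = "\<lambda>r. sigma r powr (2 * M)" and ?v = "\<lambda>r. sigma r powr (- 2 * M)"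
  let ?F' = "\<lambda>r. 2 * (\<omega> * (?v r - ?w r)) * (?t r \<bullet> ?u r)"
  fix r assume r: "r \<in> rho_interval"
  note bl = bounded_bilinear.has_vector_derivative[OF bounded_bilinear_inner]
  note t = tilde_deriv[OF assms(1) r]
  show "(F has_real_derivative ?F' r) (at r)"
    unfolding has_real_derivative_iff_has_vector_derivative F_def power2_norm_eq_inner
    using has_vector_derivative_add[OF bl[OF t(1) t(1)] bl[OF t(2) t(2)]]
    by (rule back_subst[where P = "\<lambda>D. (_ has_vector_derivative D) _"])
      (simp add: inner_commute[of "?u r"] algebra_simps)
  have wv: "0 \<le> ?w r" "0 \<le> ?v r" "?w r + ?v r \<le> sigma_majorant \<bar>M\<bar> r"
    using sigma_powr_le_majorant[OF r, of M] by auto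
  have "2 * \<bar>?t r \<bullet> ?u r\<bar> \<le> 2 * (cmod (?t r) * cmod (?u r))"
    using Cauchy_Schwarz_ineq2[of "?t r" "?u r"] by simp
  also have "\<dots> \<le> F r"
    using sum_squares_bound[of "cmod (?t r)" "cmod (?u r)"] by (simp add: F_def)
  finally have ip: "2 * \<bar>?t r \<bullet> ?u r\<bar> \<le> F r" .
  have "\<bar>?F' r\<bar> = \<bar>\<omega>\<bar> * \<bar>?v r - ?w r\<bar> * (2 * \<bar>?t r \<bullet> ?u r\<bar>)" by (simp add: abs_mult)
  also have "\<dots> \<le> \<bar>\<omega>\<bar> * sigma_majorant \<bar>M\<bar> r * F r"
    by (intro mult_mono mult_nonneg_nonneg order_refl ip) (use wv in linarith)+
  finally show "\<bar>?F' r\<bar> \<le> \<bar>\<omega>\<bar> * sigma_majorant \<bar>M\<bar> r * F r" .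
qed (use assms in \<open>auto simp: F_def\<close>)

lemma tilde_bounded:
  assumes "radial_solution M \<omega> \<Phi>" "\<bar>M\<bar> < 1/2"
  shows "\<exists>C. \<forall>\<rho>\<in>rho_interval. \<forall>j. cmod (tilde j M \<Phi> \<rho>) \<le> C"
proof -
  let ?F = "\<lambda>\<rho>. (cmod (tilde 1 M \<Phi> \<rho>))\<^sup>2 + (cmod (tilde 2 M \<Phi> \<rho>))\<^sup>2"
  define K where "K = 2 / (1 - 2 * \<bar>M\<bar>) * (pi/2) powr (1 - 2 * \<bar>M\<bar>)"
  define C where "C = ?F 0 * exp (\<bar>\<omega>\<bar> * (2 * K))"
  have C0: "0 \<le> C" by (simp add: C_def)
  have "cmod (tilde j M \<Phi> \<rho>) \<le> sqrt C" if \<rho>: "\<rho> \<in> rho_interval" for j \<rho>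
  proof -
    have 0: "0 \<in> rho_interval" by simp
    have "\<bar>sigma_majorant_primitive \<bar>M\<bar> \<rho> - sigma_majorant_primitive \<bar>M\<bar> 0\<bar> \<le> 2 * K"
      using sigma_majorant_primitive_bounded[OF \<rho>, of "\<bar>M\<bar>"]
        sigma_majorant_primitive_bounded[OF 0, of "\<bar>M\<bar>"] assms(2) unfolding K_def by linarith
    then have "?F \<rho> \<le> C"
      unfolding C_def by (intro order_trans[OF tilde_gronwall[OF assms \<rho> 0]] mult_left_mono) (auto intro: mult_left_mono)
    moreover have "(cmod (tilde j M \<Phi> \<rho>))\<^sup>2 \<le> ?F \<rho>"
      using exhaust_2[of j] by auto
    ultimately show ?thesis by (intro real_le_rsqrt) simp
  qed
  then show ?thesis by blast
qed

text \<open>Uniqueness for the initial value problem: with zero data at one point the Gronwall bound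
  is zero everywhere.\<close>

lemma radial_solution_zero:
  assumes "radial_solution M \<omega> \<Phi>" "\<bar>M\<bar> < 1/2" "\<rho>0 \<in> rho_interval" "\<Phi> \<rho>0 = 0" "\<rho> \<in> rho_interval"
  shows "\<Phi> \<rho> = 0"
proof -
  have "tilde 1 M \<Phi> \<rho>0 = 0" "tilde 2 M \<Phi> \<rho>0 = 0" using assms(4) by (simp_all add: tilde_def)
  with tilde_gronwall[OF assms(1,2,5,3)]
  have "(cmod (tilde 1 M \<Phi> \<rho>))\<^sup>2 + (cmod (tilde 2 M \<Phi> \<rho>))\<^sup>2 \<le> 0" by simp
  then have "tilde 1 M \<Phi> \<rho> = 0" "tilde 2 M \<Phi> \<rho> = 0"
    by (simp_all add: sum_power2_le_zero_iff)
  then show ?thesis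
    using component_eq_tilde[OF assms(5), of \<Phi> _ M] by (simp add: vec_eq_iff forall_2)
qed

section \<open>Wronskian, integrability and orthogonality\<close>

definition spinor_density :: "(real \<Rightarrow> complex^2) \<Rightarrow> (real \<Rightarrow> complex^2) \<Rightarrow> real \<Rightarrow> complex" where
  "spinor_density \<Phi> \<Psi> \<rho> = (\<Sum>j\<in>UNIV. cnj (\<Phi> \<rho> $ j) * \<Psi> \<rho> $ j)"

text \<open>A sesquilinear version: conjugating the first argument makes its derivative proportional
  to the density of the inner product, with factor the difference of the frequencies, while the mass
  terms cancel.\<close>

definition wronskian :: "(real \<Rightarrow> complex^2) \<Rightarrow> (real \<Rightarrow> complex^2) \<Rightarrow> real \<Rightarrow> complex" where
  "wronskian \<Phi> \<Psi> \<rho> = cnj (\<Phi> \<rho> $ 2) * \<Psi> \<rho> $ 1 - cnj (\<Phi> \<rho> $ 1) * \<Psi> \<rho> $ 2"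

definition radial_inner :: "(real \<Rightarrow> complex^2) \<Rightarrow> (real \<Rightarrow> complex^2) \<Rightarrow> complex" where
  "radial_inner \<Phi> \<Psi> = (LINT \<rho>:rho_interval|lborel. spinor_density \<Phi> \<Psi> \<rho>)"

text \<open>The square is bounded instead of the function itself: then the product of any two tame
  functions is dominated by the integrable majorant, and the class is closed under linear
  combinations, as finite combinations of modes with different frequencies require.\<close>

definition tame :: "real \<Rightarrow> (real \<Rightarrow> complex) \<Rightarrow> bool" where
  "tame m f \<longleftrightarrow> continuous_on rho_interval f \<and> (\<exists>C. \<forall>\<rho>\<in>rho_interval. (cmod (f \<rho>))\<^sup>2 \<le> C * sigma_majorant m \<rho>)"

lemma tame_product:
  assumes "0 \<le> m" "m < 1/2" "tame m f" "tame m g"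
  shows "set_integrable lborel rho_interval (\<lambda>\<rho>. cnj (f \<rho>) * g \<rho>)"
proof -
  obtain C D where C: "\<forall>\<rho>\<in>rho_interval. (cmod (f \<rho>))\<^sup>2 \<le> C * sigma_majorant m \<rho>"
    and D: "\<forall>\<rho>\<in>rho_interval. (cmod (g \<rho>))\<^sup>2 \<le> D * sigma_majorant m \<rho>"
    using assms by (auto simp: tame_def)
  show ?thesis
  proof (rule set_integrable_of_majorant[OF _ assms(1,2), where C = "C + D"])
    show "continuous_on rho_interval (\<lambda>\<rho>. cnj (f \<rho>) * g \<rho>)"
      using assms by (intro continuous_on_mult continuous_on_cnj) (auto simp: tame_def)
    fix \<rho> assume \<rho>: "\<rho> \<in> rho_interval"
    have "cmod (cnj (f \<rho>) * g \<rho>) \<le> (cmod (f \<rho>))\<^sup>2 + (cmod (g \<rho>))\<^sup>2"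
      using sum_squares_bound[of "cmod (f \<rho>)" "cmod (g \<rho>)"] mult_nonneg_nonneg[OF norm_ge_zero norm_ge_zero, of "f \<rho>" "g \<rho>"]
      by (simp only: norm_mult complex_mod_cnj)
    also have "\<dots> \<le> (C + D) * sigma_majorant m \<rho>" using C D \<rho> by (simp add: distrib_right add_mono)
    finally show "cmod (cnj (f \<rho>) * g \<rho>) \<le> (C + D) * sigma_majorant m \<rho>" .
  qed
qed

lemma tame_lincomb:
  assumes "tame m f" "tame m g"
  shows "tame m (\<lambda>\<rho>. a * f \<rho> + b * g \<rho>)"
proof -
  obtain C D where C: "\<forall>\<rho>\<in>rho_interval. (cmod (f \<rho>))\<^sup>2 \<le> C * sigma_majorant m \<rho>"
    and D: "\<forall>\<rho>\<in>rho_interval. (cmod (g \<rho>))\<^sup>2 \<le> D * sigma_majorant m \<rho>"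
    using assms by (auto simp: tame_def)
  let ?E = "2 * (cmod a)\<^sup>2 * C + 2 * (cmod b)\<^sup>2 * D"
  have "(cmod (a * f \<rho> + b * g \<rho>))\<^sup>2 \<le> ?E * sigma_majorant m \<rho>" if \<rho>: "\<rho> \<in> rho_interval" for \<rho>
  proof -
    have "(cmod (a * f \<rho> + b * g \<rho>))\<^sup>2 \<le> (cmod (a * f \<rho>) + cmod (b * g \<rho>))\<^sup>2"
      by (intro power_mono norm_triangle_ineq norm_ge_zero)
    also have "\<dots> \<le> 2 * (cmod (a * f \<rho>))\<^sup>2 + 2 * (cmod (b * g \<rho>))\<^sup>2"
      using sum_squares_bound[of "cmod (a * f \<rho>)" "cmod (b * g \<rho>)"] by (simp add: power2_sum)
    also have "\<dots> = 2 * (cmod a)\<^sup>2 * (cmod (f \<rho>))\<^sup>2 + 2 * (cmod b)\<^sup>2 * (cmod (g \<rho>))\<^sup>2"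
      by (simp add: norm_mult power_mult_distrib)
    also have "\<dots> \<le> 2 * (cmod a)\<^sup>2 * (C * sigma_majorant m \<rho>) + 2 * (cmod b)\<^sup>2 * (D * sigma_majorant m \<rho>)"
      using C D \<rho> by (intro add_mono mult_left_mono) auto
    finally show ?thesis by (simp add: distrib_right mult.assoc)
  qed
  moreover have "continuous_on rho_interval (\<lambda>\<rho>. a * f \<rho> + b * g \<rho>)"
    using assms by (intro continuous_on_add continuous_on_mult_left) (auto simp: tame_def)
  ultimately show ?thesis unfolding tame_def by blast
qed

lemma tame_radial_solution:
  assumes "radial_solution M \<omega> \<Phi>" "\<bar>M\<bar> < 1/2"
  shows "tame \<bar>M\<bar> (\<lambda>\<rho>. \<Phi> \<rho> $ j)"
proof -
  obtain C where C: "\<forall>\<rho>\<in>rho_interval. \<forall>j. cmod (tilde j M \<Phi> \<rho>) \<le> C"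
    using tilde_bounded[OF assms] by blast
  have "(cmod (\<Phi> \<rho> $ j))\<^sup>2 \<le> C\<^sup>2 * sigma_majorant \<bar>M\<bar> \<rho>" if \<rho>: "\<rho> \<in> rho_interval" for \<rho>
  proof -
    let ?p = "sigma \<rho> powr (- chirality j * M)"
    have "?p\<^sup>2 = sigma \<rho> powr (- 2 * chirality j * M)" by (simp add: power2_eq_square mult_ac flip: powr_add)
    also have "\<dots> \<le> sigma \<rho> powr (2 * M) + sigma \<rho> powr (- 2 * M)" using exhaust_2[of j] by auto
    finally have p: "?p\<^sup>2 \<le> sigma_majorant \<bar>M\<bar> \<rho>" using sigma_powr_le_majorant[OF \<rho>, of M] by linarith
    have "(cmod (\<Phi> \<rho> $ j))\<^sup>2 = ?p\<^sup>2 * (cmod (tilde j M \<Phi> \<rho>))\<^sup>2"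
      by (subst component_eq_tilde[OF \<rho>, of \<Phi> j M]) (simp add: norm_mult power_mult_distrib)
    also have "\<dots> \<le> sigma_majorant \<bar>M\<bar> \<rho> * C\<^sup>2"
      using C \<rho> sigma_majorant_ge_1[OF \<rho>, of M] by (intro mult_mono p power_mono) auto
    finally show ?thesis by (simp add: mult.commute)
  qed
  then show ?thesis using radial_solution_continuous_on[OF assms(1)] unfolding tame_def by blast
qed

lemma set_integrable_component_product:
  assumes "radial_solution M \<omega> \<Phi>" "radial_solution M \<omega>' \<Psi>" "\<bar>M\<bar> < 1/2"
  shows "set_integrable lborel rho_interval (\<lambda>\<rho>. cnj (\<Phi> \<rho> $ i) * \<Psi> \<rho> $ j)"
  using assms by (intro tame_product[of "\<bar>M\<bar>"] tame_radial_solution) auto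

lemma set_integrable_spinor_density:
  assumes "radial_solution M \<omega> \<Phi>" "radial_solution M \<omega>' \<Psi>" "\<bar>M\<bar> < 1/2"
  shows "set_integrable lborel rho_interval (spinor_density \<Phi> \<Psi>)"
  using set_integral_add(1)[OF set_integrable_component_product[OF assms, of 1 1]
      set_integrable_component_product[OF assms, of 2 2]]
  by (simp add: spinor_density_def[abs_def] sum_2)

lemma continuous_on_spinor_density:
  assumes "radial_solution M \<omega> \<Phi>" "radial_solution M' \<omega>' \<Psi>"
  shows "continuous_on rho_interval (spinor_density \<Phi> \<Psi>)"
  unfolding spinor_density_def[abs_def]
  by (intro continuous_on_sum continuous_on_mult continuous_on_cnj
      radial_solution_continuous_on[OF assms(1)] radial_solution_continuous_on[OF assms(2)])

lemma wronskian_deriv: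
  assumes "radial_solution M \<omega> \<Phi>" "radial_solution M \<omega>' \<Psi>" "\<rho> \<in> rho_interval"
  shows "(wronskian \<Phi> \<Psi> has_vector_derivative of_real (\<omega>' - \<omega>) * spinor_density \<Phi> \<Psi> \<rho>) (at \<rho>)"
proof -
  note a = radial_solution_deriv[OF assms(1,3)]
  note b = radial_solution_deriv[OF assms(2,3)]
  show ?thesis
    unfolding wronskian_def[abs_def]
    using has_vector_derivative_diff[OF
        has_vector_derivative_mult[OF has_vector_derivative_cnj[OF a(2)] b(1)]
        has_vector_derivative_mult[OF has_vector_derivative_cnj[OF a(1)] b(2)]]
    by (simp add: spinor_density_def sum_2 algebra_simps)
qed

text \<open>Each term pairs a first with a second component, so the weights \<sigma>^M and
  \<sigma>^(-M) cancel and the boundary behaviour can be read off from the rescaled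
  components.\<close>

lemma wronskian_eq_tilde:
  assumes "\<rho> \<in> rho_interval"
  shows "wronskian \<Phi> \<Psi> \<rho> =
    cnj (tilde 2 M \<Phi> \<rho>) * tilde 1 M \<Psi> \<rho> - cnj (tilde 1 M \<Phi> \<rho>) * tilde 2 M \<Psi> \<rho>"
proof -
  have "wronskian \<Phi> \<Psi> \<rho> = of_real (sigma \<rho> powr M * sigma \<rho> powr (- M)) * wronskian \<Phi> \<Psi> \<rho>"
    using sigma_powr_cancel[OF assms] by simp
  also have "\<dots> = cnj (tilde 2 M \<Phi> \<rho>) * tilde 1 M \<Psi> \<rho> - cnj (tilde 1 M \<Phi> \<rho>) * tilde 2 M \<Psi> \<rho>"
    unfolding of_real_mult by (simp add: tilde_def wronskian_def algebra_simps)
  finally show ?thesis .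
qed

text \<open>Every term of the Wronskian contains the component \<open>j\<close> of one of the two
  solutions. That factor tends to 0 and the other one is bounded, so no information about the limit
  of the other component is required.\<close>

lemma tilde_products_tendsto_0:
  assumes "\<bar>M\<bar> < 1/2" "radial_solution M \<omega> \<Phi>" "radial_solution M \<omega>' \<Psi>"
    and F: "\<forall>\<^sub>F \<rho> in F. \<rho> \<in> rho_interval"
    and "(tilde j M \<Phi> \<longlongrightarrow> 0) F" "(tilde j M \<Psi> \<longlongrightarrow> 0) F"
  shows "(wronskian \<Phi> \<Psi> \<longlongrightarrow> 0) F"
proof -
  obtain C C' where C: "\<forall>\<rho>\<in>rho_interval. \<forall>j. cmod (tilde j M \<Phi> \<rho>) \<le> C"
    and C': "\<forall>\<rho>\<in>rho_interval. \<forall>j. cmod (tilde j M \<Psi> \<rho>) \<le> C'"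
    using tilde_bounded[OF assms(2,1)] tilde_bounded[OF assms(3,1)] by blast
  have b: "\<forall>\<^sub>F \<rho> in F. cmod (cnj (tilde i M \<Phi> \<rho>)) \<le> C" "\<forall>\<^sub>F \<rho> in F. cmod (tilde i M \<Psi> \<rho>) \<le> C'" for i
    using F by (eventually_elim; use C C' in auto)+
  have z: "((\<lambda>\<rho>. cnj (tilde j M \<Phi> \<rho>)) \<longlongrightarrow> 0) F"
    using tendsto_cnj[OF assms(5)] by simp
  have p: "((\<lambda>\<rho>. cnj (tilde i M \<Phi> \<rho>) * tilde k M \<Psi> \<rho>) \<longlongrightarrow> 0) F" if "i = j \<or> k = j" for i k
    using that lim_null_mult_right_bounded[OF z b(2)] lim_null_mult_left_bounded[OF b(1) assms(6)] by blast
  have "j = 1 \<or> j = 2" by (rule exhaust_2)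
  then have "((\<lambda>\<rho>. cnj (tilde 2 M \<Phi> \<rho>) * tilde 1 M \<Psi> \<rho> - cnj (tilde 1 M \<Phi> \<rho>) * tilde 2 M \<Psi> \<rho>) \<longlongrightarrow> 0 - 0) F"
    by (intro tendsto_diff p) auto
  then show ?thesis
    unfolding diff_zero by (rule Lim_transform_eventually)
      (use F in \<open>eventually_elim, simp only: wronskian_eq_tilde[of _ _ _ M]\<close>)
qed

lemma wronskian_tendsto_0:
  assumes "\<bar>M\<bar> < 1/2" "bvp_solution M (bc_gen l r) \<omega> \<Phi>" "bvp_solution M (bc_gen l r) \<omega>' \<Psi>"
  shows "(wronskian \<Phi> \<Psi> \<longlongrightarrow> 0) (at_right (- pi / 2))" "(wronskian \<Phi> \<Psi> \<longlongrightarrow> 0) (at_left (pi / 2))"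
  using assms eventually_rho_left eventually_rho_right
  by (auto simp: bvp_solution_def bc_gen_def zero_left_def zero_right_def intro: tilde_products_tendsto_0)

lemma radial_orthogonal:
  assumes "\<bar>M\<bar> < 1/2" "bvp_solution M (bc_gen l r) \<omega> \<Phi>" "bvp_solution M (bc_gen l r) \<omega>' \<Psi>" "\<omega> \<noteq> \<omega>'"
  shows "radial_inner \<Phi> \<Psi> = 0"
proof -
  have s: "radial_solution M \<omega> \<Phi>" "radial_solution M \<omega>' \<Psi>" using assms by (auto simp: bvp_solution_def)
  have "(LINT \<rho>:rho_interval|lborel. of_real (\<omega>' - \<omega>) * spinor_density \<Phi> \<Psi> \<rho>) = 0"
    by (rule integral_rho_derivative_eq_0[OF wronskian_deriv[OF s]
          continuous_on_mult_left[OF continuous_on_spinor_density[OF s]]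
          set_integrable_mult_right[OF set_integrable_spinor_density[OF s assms(1)]]
          wronskian_tendsto_0[OF assms(1-3)]])
  then show ?thesis using assms(4) by (simp add: radial_inner_def)
qed

lemma wronskian_eq_0:
  assumes "\<bar>M\<bar> < 1/2" "bvp_solution M (bc_gen l r) \<omega> \<Phi>" "bvp_solution M (bc_gen l r) \<omega> \<Psi>" "\<rho> \<in> rho_interval"
  shows "wronskian \<Phi> \<Psi> \<rho> = 0"
proof -
  have s: "radial_solution M \<omega> \<Phi>" "radial_solution M \<omega> \<Psi>" using assms by (auto simp: bvp_solution_def)
  have z: "(wronskian \<Phi> \<Psi> has_vector_derivative 0) (at r within rho_interval)" if "r \<in> rho_interval" for r
    using wronskian_deriv[OF s that] by (simp add: has_vector_derivative_at_within)
  obtain c where c: "\<And>\<rho>. \<rho> \<in> rho_interval \<Longrightarrow> wronskian \<Phi> \<Psi> \<rho> = c"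
    using has_vector_derivative_zero_constant[OF convex_real_interval(8) z] by metis
  have "((\<lambda>_. c) \<longlongrightarrow> 0) (at_left (pi/2))"
    by (rule Lim_transform_eventually[OF wronskian_tendsto_0(2)[OF assms(1-3)] eventually_mono[OF eventually_rho_right c]])
  then have "c = 0" by (simp add: tendsto_const_iff)
  with c assms(4) show ?thesis by simp
qed

text \<open>Vanishing Wronskians make the values proportional at one point; the corresponding
  combination of the solutions vanishes there, hence everywhere by
  \<open>radial_solution_zero\<close>.\<close>

lemma unique_up_to_scalars_bc_gen:
  assumes "\<bar>M\<bar> < 1/2"
  shows "unique_up_to_scalars M (bc_gen l r) \<omega>"
  unfolding unique_up_to_scalars_def
proof (intro allI impI, elim conjE)
  fix \<Phi> \<Psi> assume sol: "bvp_solution M (bc_gen l r) \<omega> \<Phi>" "bvp_solution M (bc_gen l r) \<omega> \<Psi>"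
    and nz: "nonzero_spinor \<Phi>"
  then obtain r0 where r0: "r0 \<in> rho_interval" "\<Phi> r0 \<noteq> 0" by (auto simp: nonzero_spinor_def)
  have w: "wronskian \<Phi> \<Phi> r0 = 0" "wronskian \<Phi> \<Psi> r0 = 0"
    using wronskian_eq_0[OF assms] sol r0 by auto
  have "\<exists>c. \<Psi> r0 = c *s \<Phi> r0"
  proof (cases "\<Phi> r0 $ 1 = 0")
    case False
    \<comment> \<open>The vanishing Wronskian of \<Phi> and \<Psi> involves conjugates of \<Phi>.
      The Wronskian of \<Phi> with itself says that
      \<open>cnj (\<Phi> r0 $ 2) * \<Phi> r0 $ 1\<close> is real, which allows trading the conjugate
      for the value.\<close>
    have "cnj (\<Phi> r0 $ 1) * (\<Phi> r0 $ 1 * \<Psi> r0 $ 2) = cnj (\<Phi> r0 $ 1) * (\<Psi> r0 $ 1 * \<Phi> r0 $ 2)"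
      using w unfolding wronskian_def by algebra
    then have "\<Psi> r0 = (\<Psi> r0 $ 1 / \<Phi> r0 $ 1) *s \<Phi> r0"
      using False by (simp add: vec_eq_iff forall_2 field_simps)
    then show ?thesis by blast
  next
    case True
    then have 2: "\<Phi> r0 $ 2 \<noteq> 0" using r0(2) by (auto simp: vec_eq_iff forall_2)
    then have "\<Psi> r0 $ 1 = 0" using w(2) True by (simp add: wronskian_def)
    then have "\<Psi> r0 = (\<Psi> r0 $ 2 / \<Phi> r0 $ 2) *s \<Phi> r0"
      using 2 True by (simp add: vec_eq_iff forall_2)
    then show ?thesis by blast
  qed
  then obtain c where c: "\<Psi> r0 = c *s \<Phi> r0" by blast
  have d: "radial_solution M \<omega> (\<lambda>\<rho>. 1 *s \<Psi> \<rho> + (- c) *s \<Phi> \<rho>)"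
    using sol by (intro radial_solution_lincomb) (auto simp: bvp_solution_def)
  have z: "1 *s \<Psi> r0 + (- c) *s \<Phi> r0 = 0" using c by (simp add: vec_eq_iff)
  have "\<Psi> \<rho> = c *s \<Phi> \<rho>" if "\<rho> \<in> rho_interval" for \<rho>
    using radial_solution_zero[OF d assms r0(1) z that] by (simp add: vec_eq_iff)
  then show "\<exists>c. \<forall>\<rho>\<in>rho_interval. \<Psi> \<rho> = c *s \<Phi> \<rho>" by blast
qed

section \<open>Ladder operators on radial solutions\<close>

text \<open>\<open>L\<^sub>\<plusminus>\<close> with the radial derivative eliminated by the equation at frequency \<open>\<omega>\<close>, up to a factor \<open>i\<close> that \<open>ladder_stationary\<close> makes explicit.\<close>

definition radial_ladder :: "real \<Rightarrow> real \<Rightarrow> real \<Rightarrow> (real \<Rightarrow> complex^2) \<Rightarrow> real \<Rightarrow> complex^2" where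
  "radial_ladder M s \<omega> \<Phi> \<rho> = vector
    [of_real ((1/2 + s * \<omega>) * s * cos \<rho>) * \<Phi> \<rho> $ 2 - of_real ((1/2 + s * \<omega>) * sin \<rho> + M) * \<Phi> \<rho> $ 1,
     of_real (M - (1/2 + s * \<omega>) * sin \<rho>) * \<Phi> \<rho> $ 2 - of_real ((1/2 + s * \<omega>) * s * cos \<rho>) * \<Phi> \<rho> $ 1]"

text \<open>The shift of the frequency by \<open>s\<close> is the radial form of
  \<open>[L\<^sub>0, L\<^sub>\<plusminus>] = \<plusminus> L\<^sub>\<plusminus>\<close>. It holds at
  every frequency and is checked by differentiating the coefficients, with
  \<open>s * s = 1\<close>.\<close>

lemma radial_ladder_solution:
  assumes sol: "radial_solution M \<omega> \<Phi>" and s: "s \<in> {1, - 1}"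
  shows "radial_solution M (\<omega> + s) (radial_ladder M s \<omega> \<Phi>)"
proof (rule radial_solutionI; unfold radial_ladder_def vector_2)
  fix \<rho> assume \<rho>: "\<rho> \<in> rho_interval"
  note d = radial_solution_deriv[OF sol \<rho>]
  have c: "cos \<rho> \<noteq> 0" using cos_pos_rho[OF \<rho>] by simp
  let ?a = "1/2 + s * \<omega>" and ?p = "\<Phi> \<rho> $ 1" and ?q = "\<Phi> \<rho> $ 2"
  let ?T1 = "of_real (?a * s * cos \<rho>) * ?q - of_real (?a * sin \<rho> + M) * ?p"
  let ?T2 = "of_real (M - ?a * sin \<rho>) * ?q - of_real (?a * s * cos \<rho>) * ?p"
  have r: "((\<lambda>r. complex_of_real (?a * s * cos r)) has_vector_derivative of_real (- ?a * s * sin \<rho>)) (at \<rho>)"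
    "((\<lambda>r. complex_of_real (?a * sin r + M)) has_vector_derivative of_real (?a * cos \<rho>)) (at \<rho>)"
    "((\<lambda>r. complex_of_real (M - ?a * sin r)) has_vector_derivative of_real (- ?a * cos \<rho>)) (at \<rho>)"
    by (rule has_vector_derivative_of_real; auto intro!: derivative_eq_intros simp: algebra_simps)+
  show "((\<lambda>r. of_real (?a * s * cos r) * \<Phi> r $ 2 - of_real (?a * sin r + M) * \<Phi> r $ 1) has_vector_derivative
      of_real (\<omega> + s) * ?T2 - of_real (M / cos \<rho>) * ?T1) (at \<rho>)"
    by (rule has_vector_derivative_eq_rhs[OF has_vector_derivative_diff[OF
          has_vector_derivative_mult[OF r(1) d(2)] has_vector_derivative_mult[OF r(2) d(1)]]])
      (use c s in \<open>auto simp: field_simps\<close>)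
  show "((\<lambda>r. of_real (M - ?a * sin r) * \<Phi> r $ 2 - of_real (?a * s * cos r) * \<Phi> r $ 1) has_vector_derivative
      of_real (M / cos \<rho>) * ?T2 - of_real (\<omega> + s) * ?T1) (at \<rho>)"
    by (rule has_vector_derivative_eq_rhs[OF has_vector_derivative_diff[OF
          has_vector_derivative_mult[OF r(3) d(2)] has_vector_derivative_mult[OF r(1) d(1)]]])
      (use c s in \<open>auto simp: field_simps\<close>)
qed

text \<open>Pointwise matrix algebra: since
  \<open>1/2 - s * (\<omega> + s) = - (1/2 + s * \<omega>)\<close>, the step back uses the same
  coefficient \<open>A\<close> with opposite sign, and the product of the two matrices is scalar
  because of \<open>sin\<^sup>2 + cos\<^sup>2 = 1\<close>. This scalar governs the Casimir element,
  the commutator, the norms and the end of the ladder.\<close>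

lemma radial_ladder_comp:
  assumes "s \<in> {1, - 1}"
  shows "radial_ladder M (- s) (\<omega> + s) (radial_ladder M s \<omega> \<Phi>) \<rho> = of_real (M\<^sup>2 - (1/2 + s * \<omega>)\<^sup>2) *s \<Phi> \<rho>"
proof -
  define A where "A = 1/2 + s * \<omega>"
  have a: "1/2 + - s * (\<omega> + s) = - A" using assms by (auto simp: A_def algebra_simps)
  have tr: "(A * s * cos \<rho>) * (A * s * cos \<rho>) = A\<^sup>2 - A\<^sup>2 * (sin \<rho>)\<^sup>2"
    using assms by (auto simp: cos_squared_eq algebra_simps simp flip: power2_eq_square power_mult_distrib)
      (auto simp: cos_squared_eq algebra_simps power_mult_distrib)
  define B where "B = complex_of_real (A * s * cos \<rho>)"
  define S where "S = complex_of_real (A * sin \<rho>)"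
  define m where "m = complex_of_real M"
  have BB: "B * B = of_real A * of_real A - S * S"
    unfolding B_def S_def of_real_mult[symmetric] tr by (simp add: power2_eq_square)
  have e: "of_real (- A * - s * cos \<rho>) = B" "of_real (A * s * cos \<rho>) = B" "of_real (A * sin \<rho> + M) = S + m"
    "of_real (M - A * sin \<rho>) = m - S" "of_real (- A * sin \<rho> + M) = m - S" "of_real (M - - A * sin \<rho>) = m + S"
    "complex_of_real (M\<^sup>2 - A\<^sup>2) = m * m - of_real A * of_real A"
    by (simp_all add: B_def S_def m_def power2_eq_square)
  have "B * ((m - S) * q - B * p) - (m - S) * (B * q - (S + m) * p) = (m * m - of_real A * of_real A) * p"
    "(m + S) * ((m - S) * q - B * p) - B * (B * q - (S + m) * p) = (m * m - of_real A * of_real A) * q" for p q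
    using BB by algebra+
  then show ?thesis
    unfolding vec_eq_iff forall_2 radial_ladder_def a A_def[symmetric] vector_2 vector_smult_component e by blast
qed

text \<open>In rescaled form the other component enters only with the factor
  \<open>cos \<rho> * sigma \<rho> powr (2 * chirality j * M)\<close>, which vanishes at both ends;
  a zero boundary value therefore stays zero. In the two-element index type, \<open>3 - j\<close> is
  the other component.\<close>

lemma tilde_radial_ladder:
  assumes "\<rho> \<in> rho_interval"
  shows "tilde j M (radial_ladder M s \<omega> \<Phi>) \<rho> =
    of_real (chirality j * M - (1/2 + s * \<omega>) * sin \<rho>) * tilde j M \<Phi> \<rho> -
    of_real ((1/2 + s * \<omega>) * s * chirality j * (cos \<rho> * sigma \<rho> powr (2 * chirality j * M))) * tilde (3 - j) M \<Phi> \<rho>"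
proof -
  have p: "sigma \<rho> powr M = sigma \<rho> powr (2 * M) * sigma \<rho> powr (- M)"
    "sigma \<rho> powr (- M) = sigma \<rho> powr (- 2 * M) * sigma \<rho> powr M"
    by (simp_all flip: powr_add)
  have "j = 1 \<or> j = 2" by (rule exhaust_2)
  then show ?thesis
  proof
    assume "j = 1"
    then show ?thesis by (simp add: tilde_def radial_ladder_def p(2) algebra_simps)
  next
    assume "j = 2"
    then show ?thesis by (simp add: tilde_def radial_ladder_def p(1) algebra_simps)
  qed
qed

text \<open>The limit \<open>L\<close> is arbitrary because both cases are used:
  \<open>L = 0\<close> shows that the boundary conditions are preserved, and a non-zero
  \<open>L\<close> supplies the multiplier in \<open>norm_recursion\<close>.\<close>

lemma tilde_radial_ladder_tendsto:
  assumes "\<bar>M\<bar> < 1/2" "radial_solution M \<omega> \<Phi>" "(tilde j M \<Phi> \<longlongrightarrow> L) F"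
    and F: "F = at_left (pi/2) \<or> F = at_right (- pi/2)" and e: "(sin \<longlongrightarrow> e) F"
  shows "(tilde j M (radial_ladder M s \<omega> \<Phi>) \<longlongrightarrow> of_real (chirality j * M - (1/2 + s * \<omega>) * e) * L) F"
proof -
  have ev: "\<forall>\<^sub>F \<rho> in F. \<rho> \<in> rho_interval" using F eventually_rho_left eventually_rho_right by auto
  obtain C where C: "\<forall>\<rho>\<in>rho_interval. \<forall>j. cmod (tilde j M \<Phi> \<rho>) \<le> C"
    using tilde_bounded[OF assms(2,1)] by blast
  have b: "\<forall>\<^sub>F \<rho> in F. cmod (tilde (3 - j) M \<Phi> \<rho>) \<le> C"
    using ev by eventually_elim (use C in auto)
  have "\<bar>2 * chirality j * M\<bar> < 1" using assms(1) by (simp add: chirality_def abs_mult)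
  then have z: "((\<lambda>\<rho>. cos \<rho> * sigma \<rho> powr (2 * chirality j * M)) \<longlongrightarrow> 0) F"
    using F cos_sigma_powr_tendsto_0[of "2 * chirality j * M"] by auto
  have "((\<lambda>\<rho>. of_real ((1/2 + s * \<omega>) * s * chirality j * (cos \<rho> * sigma \<rho> powr (2 * chirality j * M))))
      \<longlongrightarrow> complex_of_real ((1/2 + s * \<omega>) * s * chirality j * 0)) F"
    by (intro tendsto_intros z)
  then have z': "((\<lambda>\<rho>. of_real ((1/2 + s * \<omega>) * s * chirality j * (cos \<rho> * sigma \<rho> powr (2 * chirality j * M)))
      * tilde (3 - j) M \<Phi> \<rho>) \<longlongrightarrow> 0) F"
    by (intro lim_null_mult_right_bounded[OF _ b]) simp
  have "((\<lambda>\<rho>. of_real (chirality j * M - (1/2 + s * \<omega>) * sin \<rho>) * tilde j M \<Phi> \<rho> -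
    of_real ((1/2 + s * \<omega>) * s * chirality j * (cos \<rho> * sigma \<rho> powr (2 * chirality j * M))) * tilde (3 - j) M \<Phi> \<rho>)
      \<longlongrightarrow> of_real (chirality j * M - (1/2 + s * \<omega>) * e) * L - 0) F"
    by (intro tendsto_intros z' e assms(3))
  then show ?thesis
    unfolding diff_zero by (rule Lim_transform_eventually)
      (use ev in \<open>eventually_elim, simp only: tilde_radial_ladder\<close>)
qed

lemma bvp_radial_ladder:
  assumes "\<bar>M\<bar> < 1/2" "bvp_solution M (bc_gen l r) \<omega> \<Phi>" "s \<in> {1, - 1}"
  shows "bvp_solution M (bc_gen l r) (\<omega> + s) (radial_ladder M s \<omega> \<Phi>)"
proof -
  have sin: "(sin \<longlongrightarrow> 1) (at_left (pi/2))" "(sin \<longlongrightarrow> - 1) (at_right (- pi/2))"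
    using isCont_imp_tendsto_at_left[where f = sin and x = "pi/2"] isCont_imp_tendsto_at_right[where f = sin and x = "- pi/2"]
    by (simp_all add: isCont_sin)
  show ?thesis
    using assms radial_ladder_solution
      tilde_radial_ladder_tendsto[OF assms(1) _ _ _ sin(1), of \<omega> \<Phi> r 0 s]
      tilde_radial_ladder_tendsto[OF assms(1) _ _ _ sin(2), of \<omega> \<Phi> l 0 s]
    by (simp add: bvp_solution_def bc_gen_def zero_left_def zero_right_def)
qed

text \<open>Both sides equal \<open>2 * M\<close> times the second minus the first summand of the
  density. On the left the two terms with \<open>sin \<rho>\<close> times the density cancel,
  because the frequencies differ by \<open>s\<close> and \<open>s * s = 1\<close>, and so do the
  Wronskian terms; on the right the terms with the factor \<open>1/2 + s * \<omega>\<close>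
  cancel.\<close>

lemma radial_ladder_adjoint_deriv:
  assumes "radial_solution M \<omega> \<Phi>" "radial_solution M (\<omega> + s) \<Psi>" "s \<in> {1, - 1}" "\<rho> \<in> rho_interval"
  shows "((\<lambda>r. of_real (cos r) * spinor_density \<Phi> \<Psi> r + of_real (s * sin r) * wronskian \<Phi> \<Psi> r) has_vector_derivative
    spinor_density (radial_ladder M s \<omega> \<Phi>) \<Psi> \<rho> + spinor_density \<Phi> (radial_ladder M (- s) (\<omega> + s) \<Psi>) \<rho>) (at \<rho>)"
proof -
  have c: "complex_of_real (cos \<rho>) \<noteq> 0" using cos_pos_rho[OF assms(4)] by simp
  note a = radial_solution_deriv[OF assms(1,4)]
  note b = radial_solution_deriv[OF assms(2,4)]
  have dens: "(spinor_density \<Phi> \<Psi> has_vector_derivative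
      of_real s * (cnj (\<Phi> \<rho> $ 1) * \<Psi> \<rho> $ 2 - cnj (\<Phi> \<rho> $ 2) * \<Psi> \<rho> $ 1) +
      of_real (2 * M / cos \<rho>) * (cnj (\<Phi> \<rho> $ 2) * \<Psi> \<rho> $ 2 - cnj (\<Phi> \<rho> $ 1) * \<Psi> \<rho> $ 1)) (at \<rho>)"
    unfolding spinor_density_def[abs_def] sum_2
    using has_vector_derivative_add[OF
        has_vector_derivative_mult[OF has_vector_derivative_cnj[OF a(1)] b(1)]
        has_vector_derivative_mult[OF has_vector_derivative_cnj[OF a(2)] b(2)]]
    by (simp add: algebra_simps)
  note w = wronskian_deriv[OF assms(1,2,4)]
  have r: "((\<lambda>r. complex_of_real (cos r)) has_vector_derivative of_real (- sin \<rho>)) (at \<rho>)"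
    "((\<lambda>r. complex_of_real (s * sin r)) has_vector_derivative of_real (s * cos \<rho>)) (at \<rho>)"
    by (rule has_vector_derivative_of_real; auto intro!: derivative_eq_intros simp: algebra_simps)+
  have s: "s = 1 \<or> s = - 1" using assms(3) by simp
  show ?thesis
    using has_vector_derivative_add[OF has_vector_derivative_mult[OF r(1) dens] has_vector_derivative_mult[OF r(2) w]] s c
    by (elim disjE) (simp_all add: spinor_density_def wronskian_def radial_ladder_def sum_2 algebra_simps)
qed

text \<open>The density itself may blow up at the ends like \<sigma>^(2M) or \<sigma>^(-2M); the
  factor \<open>cos \<rho>\<close> beats this growth for \<open>\<bar>M\<bar> < 1/2\<close>.\<close>

lemma cos_spinor_density_tendsto_0:
  assumes "\<bar>M\<bar> < 1/2" "radial_solution M \<omega> \<Phi>" "radial_solution M \<omega>' \<Psi>"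
    and F: "F = at_left (pi/2) \<or> F = at_right (- pi/2)"
  shows "((\<lambda>\<rho>. of_real (cos \<rho>) * spinor_density \<Phi> \<Psi> \<rho>) \<longlongrightarrow> 0) F"
proof -
  have ev: "\<forall>\<^sub>F \<rho> in F. \<rho> \<in> rho_interval" using F eventually_rho_left eventually_rho_right by auto
  obtain C C' where C: "\<forall>\<rho>\<in>rho_interval. \<forall>j. cmod (tilde j M \<Phi> \<rho>) \<le> C"
    and C': "\<forall>\<rho>\<in>rho_interval. \<forall>j. cmod (tilde j M \<Psi> \<rho>) \<le> C'"
    using tilde_bounded[OF assms(2,1)] tilde_bounded[OF assms(3,1)] by blast
  let ?g = "\<lambda>j \<rho>. cnj (tilde j M \<Phi> \<rho>) * tilde j M \<Psi> \<rho>"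
  let ?c = "\<lambda>j \<rho>. cos \<rho> * sigma \<rho> powr (- 2 * chirality j * M)"
  have b: "\<forall>\<^sub>F \<rho> in F. cmod (?g j \<rho>) \<le> C * C'" for j
    using ev
  proof eventually_elim
    case (elim \<rho>)
    then have "0 \<le> C" using C order_trans[OF norm_ge_zero] by blast
    then show ?case using C C' elim by (auto simp: norm_mult intro!: mult_mono)
  qed
  have z: "((\<lambda>\<rho>. complex_of_real (?c j \<rho>)) \<longlongrightarrow> 0) F" for j
  proof -
    have "\<bar>- 2 * chirality j * M\<bar> < 1" using assms(1) by (simp add: chirality_def abs_mult)
    then have "(?c j \<longlongrightarrow> 0) F" using F cos_sigma_powr_tendsto_0[of "- 2 * chirality j * M"] by auto
    then show ?thesis using tendsto_of_real[of "?c j" 0 F] by simp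
  qed
  have "((\<lambda>\<rho>. \<Sum>j\<in>UNIV. of_real (?c j \<rho>) * ?g j \<rho>) \<longlongrightarrow> (\<Sum>j\<in>(UNIV :: 2 set). 0)) F"
    by (intro tendsto_sum lim_null_mult_right_bounded[OF z b])
  moreover have "\<forall>\<^sub>F \<rho> in F. (\<Sum>j\<in>UNIV. of_real (?c j \<rho>) * ?g j \<rho>) = of_real (cos \<rho>) * spinor_density \<Phi> \<Psi> \<rho>"
    using ev
  proof eventually_elim
    case (elim \<rho>)
    have "cnj (\<Phi> \<rho> $ j) * \<Psi> \<rho> $ j = of_real (sigma \<rho> powr (- 2 * chirality j * M)) * ?g j \<rho>" for j
    proof -
      have "sigma \<rho> powr (- 2 * chirality j * M) =
          sigma \<rho> powr (- chirality j * M) * sigma \<rho> powr (- chirality j * M)"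
        by (simp add: mult_ac flip: powr_add)
      then show ?thesis
        by (subst (1 2) component_eq_tilde[OF elim, of _ j M]) simp
    qed
    then show ?case by (simp add: spinor_density_def sum_distrib_left mult.assoc)
  qed
  ultimately show ?thesis by (simp add: tendsto_cong)
qed

text \<open>The boundary term has two parts: the one with \<open>cos\<close> vanishes for any two
  solutions, the one with \<open>sin\<close> because both arguments obey the same boundary condition
  and their Wronskian tends to 0.\<close>

lemma radial_ladder_adjoint:
  assumes M: "\<bar>M\<bar> < 1/2" and s: "s \<in> {1, - 1}"
    and \<Phi>: "bvp_solution M (bc_gen l r) \<omega> \<Phi>" and \<Psi>: "bvp_solution M (bc_gen l r) (\<omega> + s) \<Psi>"
  shows "radial_inner (radial_ladder M s \<omega> \<Phi>) \<Psi> = - radial_inner \<Phi> (radial_ladder M (- s) (\<omega> + s) \<Psi>)"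
proof -
  have sol: "radial_solution M \<omega> \<Phi>" "radial_solution M (\<omega> + s) \<Psi>"
    using \<Phi> \<Psi> by (auto simp: bvp_solution_def)
  have sol1: "radial_solution M (\<omega> + s) (radial_ladder M s \<omega> \<Phi>)"
    by (rule radial_ladder_solution[OF sol(1) s])
  have sol2: "radial_solution M ((\<omega> + s) + (- s)) (radial_ladder M (- s) (\<omega> + s) \<Psi>)"
    by (rule radial_ladder_solution[OF sol(2)]) (use s in auto)
  let ?A = "spinor_density (radial_ladder M s \<omega> \<Phi>) \<Psi>"
  let ?B = "spinor_density \<Phi> (radial_ladder M (- s) (\<omega> + s) \<Psi>)"
  note iA = set_integrable_spinor_density[OF sol1 sol(2) M]
  note iB = set_integrable_spinor_density[OF sol(1) sol2 M]
  let ?G = "\<lambda>r. complex_of_real (cos r) * spinor_density \<Phi> \<Psi> r + complex_of_real (s * sin r) * wronskian \<Phi> \<Psi> r"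
  have bs: "cmod (complex_of_real (s * sin x)) \<le> 1" for x :: real
    using s abs_sin_le_one[of x] by (auto simp: abs_mult simp del: of_real_mult)
  have lim: "(?G \<longlongrightarrow> 0 + 0) F" if "F = at_left (pi/2) \<or> F = at_right (- pi/2)" for F
    by (intro tendsto_add cos_spinor_density_tendsto_0[OF M sol that]
        lim_null_mult_left_bounded[where B = 1] always_eventually allI bs)
      (use that wronskian_tendsto_0[OF M \<Phi> \<Psi>] in auto)
  have "(LINT \<rho>:rho_interval|lborel. ?A \<rho> + ?B \<rho>) = 0"
  proof (rule integral_rho_derivative_eq_0[OF radial_ladder_adjoint_deriv[OF sol s]])
    show "continuous_on rho_interval (\<lambda>\<rho>. ?A \<rho> + ?B \<rho>)"
      by (intro continuous_on_add continuous_on_spinor_density[OF sol1 sol(2)] continuous_on_spinor_density[OF sol(1) sol2])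
    show "set_integrable lborel rho_interval (\<lambda>\<rho>. ?A \<rho> + ?B \<rho>)"
      by (rule set_integral_add(1)[OF iA iB])
  qed (use lim in auto)
  then show ?thesis
    using set_integral_add(2)[OF iA iB] by (simp add: radial_inner_def eq_neg_iff_add_eq_0)
qed

lemma radial_inner_scale_right: "radial_inner \<Phi> (\<lambda>\<rho>. c *s \<Psi> \<rho>) = c * radial_inner \<Phi> \<Psi>"
  by (simp add: radial_inner_def spinor_density_def sum_2 mult.left_commute flip: distrib_left)

text \<open>Adjointness moves one ladder operator across, and \<open>radial_ladder_comp\<close>
  collapses the composition. The zeros of the factor end the ladder; its non-zero values drive
  \<open>norm_recursion\<close>.\<close>

lemma radial_ladder_norm:
  assumes "\<bar>M\<bar> < 1/2" "s \<in> {1, - 1}" "bvp_solution M (bc_gen l r) \<omega> \<Phi>"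
  shows "radial_inner (radial_ladder M s \<omega> \<Phi>) (radial_ladder M s \<omega> \<Phi>) =
    of_real ((1/2 + s * \<omega>)\<^sup>2 - M\<^sup>2) * radial_inner \<Phi> \<Phi>"
  unfolding radial_ladder_adjoint[OF assms bvp_radial_ladder[OF assms(1,3,2)]]
    radial_ladder_comp[OF assms(2), abs_def] radial_inner_scale_right
  by (simp add: algebra_simps)

section \<open>Definiteness of the inner product on solutions\<close>

lemma continuous_integral_eq_0:
  fixes g :: "real \<Rightarrow> real"
  assumes g: "continuous_on rho_interval g" "set_integrable lborel rho_interval g"
    and nonneg: "\<And>\<rho>. \<rho> \<in> rho_interval \<Longrightarrow> 0 \<le> g \<rho>"
    and int: "(LINT \<rho>:rho_interval|lborel. g \<rho>) = 0" and \<rho>: "\<rho> \<in> rho_interval"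
  shows "g \<rho> = 0"
proof (rule ccontr)
  assume "g \<rho> \<noteq> 0"
  define U where "U = rho_interval \<inter> g -` {0<..}"
  have "\<rho> \<in> U" using \<open>g \<rho> \<noteq> 0\<close> nonneg[OF \<rho>] \<rho> by (auto simp: U_def)
  moreover have "open U"
    unfolding U_def by (rule continuous_open_preimage[OF g(1)]) auto
  ultimately have "\<not> negligible U" using open_not_negligible by blast
  have "AE x in lborel. indicator rho_interval x *\<^sub>R g x = 0"
    using int g(2) nonneg unfolding set_lebesgue_integral_def set_integrable_def
    by (subst (asm) integral_nonneg_eq_0_iff_AE) (auto simp: indicator_def)
  then have "AE x in lborel. x \<notin> U"
    by eventually_elim (auto simp: U_def indicator_def)
  then have "U \<in> null_sets lborel"
    using \<open>open U\<close> by (subst (asm) AE_iff_null_sets[symmetric]) auto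
  then have "negligible U"
    using negligible_iff_null_sets null_sets_completionI by blast
  with \<open>\<not> negligible U\<close> show False by simp
qed

definition radial_norm_sq :: "(real \<Rightarrow> complex^2) \<Rightarrow> real" where
  "radial_norm_sq \<Phi> = (LINT \<rho>:rho_interval|lborel. (cmod (\<Phi> \<rho> $ 1))\<^sup>2 + (cmod (\<Phi> \<rho> $ 2))\<^sup>2)"

lemma spinor_density_self:
  "spinor_density \<Phi> \<Phi> = (\<lambda>\<rho>. complex_of_real ((cmod (\<Phi> \<rho> $ 1))\<^sup>2 + (cmod (\<Phi> \<rho> $ 2))\<^sup>2))"
  by (simp add: fun_eq_iff spinor_density_def sum_2 complex_norm_square mult.commute del: of_real_power)

lemma radial_inner_self: "radial_inner \<Phi> \<Phi> = of_real (radial_norm_sq \<Phi>)"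
  unfolding radial_inner_def spinor_density_self radial_norm_sq_def
  by (simp only: set_integral_complex_of_real)

lemma set_integrable_radial_norm_sq:
  assumes "radial_solution M \<omega> \<Phi>" "\<bar>M\<bar> < 1/2"
  shows "set_integrable lborel rho_interval (\<lambda>\<rho>. (cmod (\<Phi> \<rho> $ 1))\<^sup>2 + (cmod (\<Phi> \<rho> $ 2))\<^sup>2)"
proof -
  let ?g = "\<lambda>\<rho>. (cmod (\<Phi> \<rho> $ 1))\<^sup>2 + (cmod (\<Phi> \<rho> $ 2))\<^sup>2"
  have "set_integrable lborel rho_interval (\<lambda>\<rho>. complex_of_real (?g \<rho>))"
    using set_integrable_spinor_density[OF assms(1,1,2)] by (simp only: spinor_density_self)
  then have "set_integrable lborel rho_interval (\<lambda>\<rho>. Re (complex_of_real (?g \<rho>)))"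
    unfolding set_integrable_def by (drule_tac integrable_Re) simp
  then show ?thesis by simp
qed

lemma radial_inner_self_eq_0:
  assumes "\<bar>M\<bar> < 1/2" "radial_solution M \<omega> \<Phi>" "radial_inner \<Phi> \<Phi> = 0" "\<rho> \<in> rho_interval"
  shows "\<Phi> \<rho> = 0"
proof -
  let ?g = "\<lambda>\<rho>. (cmod (\<Phi> \<rho> $ 1))\<^sup>2 + (cmod (\<Phi> \<rho> $ 2))\<^sup>2"
  have "(LINT \<rho>:rho_interval|lborel. ?g \<rho>) = 0"
    using assms(3) by (simp only: radial_inner_self radial_norm_sq_def of_real_eq_0_iff)
  moreover have "continuous_on rho_interval ?g"
    by (intro continuous_on_add continuous_on_power continuous_on_norm radial_solution_continuous_on[OF assms(2)])
  ultimately have "?g \<rho> = 0"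
    using set_integrable_radial_norm_sq[OF assms(2,1)] assms(4)
    by (intro continuous_integral_eq_0[where g = ?g]) auto
  then show ?thesis by (simp add: sum_power2_eq_zero_iff vec_eq_iff forall_2)
qed


section \<open>Operators on fields\<close>

text \<open>The domain on which the operators are linear: \<open>d_t\<close> and
  \<open>d_rho\<close> are total, but respect linear combinations only where the derivatives
  exist.\<close>

definition differentiable_field :: "spinor_field \<Rightarrow> bool" where
  "differentiable_field \<Psi> \<longleftrightarrow> (\<forall>t. \<forall>\<rho>\<in>rho_interval.
    (\<lambda>u. \<Psi> u \<rho>) differentiable (at t) \<and> (\<lambda>r. \<Psi> t r) differentiable (at \<rho>))"

lemma has_vector_derivative_vec_scale:
  fixes f :: "real \<Rightarrow> complex^2"
  assumes "(f has_vector_derivative D) (at x)"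
  shows "((\<lambda>u. c *s f u) has_vector_derivative c *s D) (at x)"
  using assms by (simp add: has_vector_derivative_vec2_iff has_vector_derivative_mult_right)

lemma Sigma01_mult: "Sigma01 *v v = vector [\<i> / 2 * v $ 2, - \<i> / 2 * v $ 1]"
  by (simp add: vec_eq_iff forall_2 matrix_vector_mult_def sum_2 Sigma01_def)

lemma lincomb_derivs:
  assumes "differentiable_field \<Psi>\<^sub>1" "differentiable_field \<Psi>\<^sub>2" "\<rho> \<in> rho_interval"
  shows "((\<lambda>u. (a *\<^sub>\<Psi> \<Psi>\<^sub>1 + b *\<^sub>\<Psi> \<Psi>\<^sub>2) u \<rho>) has_vector_derivative
      a *s d_t \<Psi>\<^sub>1 t \<rho> + b *s d_t \<Psi>\<^sub>2 t \<rho>) (at t)"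
    "((\<lambda>r. (a *\<^sub>\<Psi> \<Psi>\<^sub>1 + b *\<^sub>\<Psi> \<Psi>\<^sub>2) t r) has_vector_derivative
      a *s d_rho \<Psi>\<^sub>1 t \<rho> + b *s d_rho \<Psi>\<^sub>2 t \<rho>) (at \<rho>)"
  using assms unfolding differentiable_field_def vector_derivative_works d_t_def d_rho_def spinor_scale_def plus_fun_def
  by (auto intro!: has_vector_derivative_add has_vector_derivative_vec_scale)

lemma differentiable_field_lincomb:
  assumes "differentiable_field \<Psi>\<^sub>1" "differentiable_field \<Psi>\<^sub>2"
  shows "differentiable_field (a *\<^sub>\<Psi> \<Psi>\<^sub>1 + b *\<^sub>\<Psi> \<Psi>\<^sub>2)"
  unfolding differentiable_field_def using lincomb_derivs[OF assms] differentiableI_vector by blast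

lemma L0_lincomb:
  assumes "differentiable_field \<Psi>\<^sub>1" "differentiable_field \<Psi>\<^sub>2"
  shows "L0 (a *\<^sub>\<Psi> \<Psi>\<^sub>1 + b *\<^sub>\<Psi> \<Psi>\<^sub>2) = a *\<^sub>\<Psi> L0 \<Psi>\<^sub>1 + b *\<^sub>\<Psi> L0 \<Psi>\<^sub>2"
proof -
  have "d_t (a *\<^sub>\<Psi> \<Psi>\<^sub>1 + b *\<^sub>\<Psi> \<Psi>\<^sub>2) t \<rho> = a *s d_t \<Psi>\<^sub>1 t \<rho> + b *s d_t \<Psi>\<^sub>2 t \<rho>" if "\<rho> \<in> rho_interval" for t \<rho>
    unfolding d_t_def[of "a *\<^sub>\<Psi> \<Psi>\<^sub>1 + b *\<^sub>\<Psi> \<Psi>\<^sub>2"] using lincomb_derivs(1)[OF assms that] by (rule vector_derivative_at)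
  then show ?thesis
    by (auto simp: L0_def on_strip_def fun_eq_iff plus_fun_def spinor_scale_def vec_eq_iff algebra_simps)
qed

lemma ladder_lincomb:
  assumes "differentiable_field \<Psi>\<^sub>1" "differentiable_field \<Psi>\<^sub>2"
  shows "ladder s (a *\<^sub>\<Psi> \<Psi>\<^sub>1 + b *\<^sub>\<Psi> \<Psi>\<^sub>2) = a *\<^sub>\<Psi> ladder s \<Psi>\<^sub>1 + b *\<^sub>\<Psi> ladder s \<Psi>\<^sub>2"
proof -
  have t: "d_t (a *\<^sub>\<Psi> \<Psi>\<^sub>1 + b *\<^sub>\<Psi> \<Psi>\<^sub>2) t \<rho> = a *s d_t \<Psi>\<^sub>1 t \<rho> + b *s d_t \<Psi>\<^sub>2 t \<rho>" if "\<rho> \<in> rho_interval" for t \<rho>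
    unfolding d_t_def[of "a *\<^sub>\<Psi> \<Psi>\<^sub>1 + b *\<^sub>\<Psi> \<Psi>\<^sub>2"] using lincomb_derivs(1)[OF assms that] by (rule vector_derivative_at)
  have r: "d_rho (a *\<^sub>\<Psi> \<Psi>\<^sub>1 + b *\<^sub>\<Psi> \<Psi>\<^sub>2) t \<rho> = a *s d_rho \<Psi>\<^sub>1 t \<rho> + b *s d_rho \<Psi>\<^sub>2 t \<rho>" if "\<rho> \<in> rho_interval" for t \<rho>
    unfolding d_rho_def[of "a *\<^sub>\<Psi> \<Psi>\<^sub>1 + b *\<^sub>\<Psi> \<Psi>\<^sub>2"] using lincomb_derivs(2)[OF assms that] by (rule vector_derivative_at)
  show ?thesis
    by (auto simp: ladder_def on_strip_def fun_eq_iff t r Sigma01_mult)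
      (auto simp: plus_fun_def spinor_scale_def vec_eq_iff forall_2 algebra_simps)
qed

lemma stationary_derivs:
  assumes "\<rho> \<in> rho_interval"
  shows "((\<lambda>u. stationary \<omega> \<Phi> u \<rho>) has_vector_derivative (- \<i> * of_real \<omega>) *s stationary \<omega> \<Phi> t \<rho>) (at t)"
    "(\<Phi> has_vector_derivative D) (at \<rho>) \<Longrightarrow>
      ((\<lambda>r. stationary \<omega> \<Phi> t r) has_vector_derivative exp (- \<i> * of_real (\<omega> * t)) *s D) (at \<rho>)"
proof -
  have "((\<lambda>u. exp (- \<i> * of_real (\<omega> * u)) * z) has_vector_derivative
      (- \<i> * of_real \<omega>) * (exp (- \<i> * of_real (\<omega> * t)) * z)) (at t)" for z
  proof -
    have "((\<lambda>u. exp (- \<i> * (of_real \<omega> * u)) * z) has_field_derivative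
      (- \<i> * of_real \<omega>) * (exp (- \<i> * (of_real \<omega> * of_real t)) * z)) (at (of_real t))"
      by (auto intro!: derivative_eq_intros)
    from has_vector_derivative_real_field[OF this] show ?thesis by simp
  qed
  then show "((\<lambda>u. stationary \<omega> \<Phi> u \<rho>) has_vector_derivative (- \<i> * of_real \<omega>) *s stationary \<omega> \<Phi> t \<rho>) (at t)"
    using assms by (simp add: stationary_def on_strip_def has_vector_derivative_vec2_iff mult.assoc del: of_real_mult)
next
  assume "(\<Phi> has_vector_derivative D) (at \<rho>)"
  then have "((\<lambda>r. exp (- \<i> * of_real (\<omega> * t)) *s \<Phi> r) has_vector_derivative exp (- \<i> * of_real (\<omega> * t)) *s D) (at \<rho>)"
    by (rule has_vector_derivative_vec_scale)
  then show "((\<lambda>r. stationary \<omega> \<Phi> t r) has_vector_derivative exp (- \<i> * of_real (\<omega> * t)) *s D) (at \<rho>)"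
    by (rule has_vector_derivative_transform_within_open[where S = rho_interval])
      (use assms in \<open>auto simp: stationary_def on_strip_def\<close>)
qed

lemma L0_stationary: "L0 (stationary \<omega> \<Phi>) = of_real \<omega> *\<^sub>\<Psi> stationary \<omega> \<Phi>"
proof -
  have "d_t (stationary \<omega> \<Phi>) t \<rho> = (- \<i> * of_real \<omega>) *s stationary \<omega> \<Phi> t \<rho>" if "\<rho> \<in> rho_interval" for t \<rho>
    unfolding d_t_def by (rule vector_derivative_at[OF stationary_derivs(1)[OF that]])
  then have "L0 (stationary \<omega> \<Phi>) t \<rho> = (if \<rho> \<in> rho_interval then of_real \<omega> *s stationary \<omega> \<Phi> t \<rho> else 0)" for t \<rho>
    by (simp add: L0_def on_strip_def)
  then show ?thesis
    by (auto simp: fun_eq_iff spinor_scale_def stationary_def on_strip_def)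
qed

lemma differentiable_field_stationary:
  assumes "radial_solution M \<omega>' \<Phi>"
  shows "differentiable_field (stationary \<omega> \<Phi>)"
  unfolding differentiable_field_def
proof (intro allI ballI conjI)
  fix t \<rho> assume \<rho>: "\<rho> \<in> rho_interval"
  show "(\<lambda>u. stationary \<omega> \<Phi> u \<rho>) differentiable (at t)"
    by (rule differentiableI_vector[OF stationary_derivs(1)[OF \<rho>]])
  show "stationary \<omega> \<Phi> t differentiable (at \<rho>)"
    using assms \<rho> by (intro differentiableI_vector[OF stationary_derivs(2)[OF \<rho>]]) (auto simp: radial_solution_iff)
qed

lemma ladder_stationary:
  assumes "radial_solution M \<omega> \<Phi>" "s \<in> {1, - 1}"
  shows "ladder s (stationary \<omega> \<Phi>) = (\<i> * of_real s) *\<^sub>\<Psi> stationary (\<omega> + s) (radial_ladder M s \<omega> \<Phi>)"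
proof (intro ext)
  fix t \<rho>
  show "ladder s (stationary \<omega> \<Phi>) t \<rho> = ((\<i> * of_real s) *\<^sub>\<Psi> stationary (\<omega> + s) (radial_ladder M s \<omega> \<Phi>)) t \<rho>"
  proof (cases "\<rho> \<in> rho_interval")
    case False
    then show ?thesis by (auto simp: ladder_def stationary_def on_strip_def spinor_scale_def)
  next
    case True
    define E where "E = exp (- \<i> * complex_of_real (\<omega> * t))"
    have st: "stationary \<omega> \<Phi> t \<rho> = E *s \<Phi> \<rho>"
      using True by (simp add: stationary_def on_strip_def E_def)
    have t: "d_t (stationary \<omega> \<Phi>) t \<rho> = (- \<i> * of_real \<omega>) *s (E *s \<Phi> \<rho>)"
      unfolding d_t_def using vector_derivative_at[OF stationary_derivs(1)[OF True]] by (simp add: st)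
    have r: "d_rho (stationary \<omega> \<Phi>) t \<rho> = E *s radial_rhs M \<omega> \<Phi> \<rho>"
      unfolding d_rho_def E_def using assms True
      by (intro vector_derivative_at[OF stationary_derivs(2)[OF True]]) (auto simp: radial_solution_iff)
    have E: "exp (- \<i> * complex_of_real (s * t)) * E = exp (- \<i> * complex_of_real ((\<omega> + s) * t))"
      by (simp add: E_def algebra_simps flip: exp_add)
    have c: "cos \<rho> \<noteq> 0" using cos_pos_rho[OF True] by simp
    have rhs: "stationary (\<omega> + s) (radial_ladder M s \<omega> \<Phi>) t \<rho> =
        (exp (- \<i> * complex_of_real (s * t)) * E) *s radial_ladder M s \<omega> \<Phi> \<rho>"
      using True unfolding E by (simp add: stationary_def on_strip_def)
    have inner: "(of_real s * \<i> * of_real (cos \<rho>)) *s radial_rhs M \<omega> \<Phi> \<rho>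
       - (of_real s * \<i> / 2 * of_real (sin \<rho>)) *s \<Phi> \<rho>
       + of_real (sin \<rho>) *s ((- \<i> * of_real \<omega>) *s \<Phi> \<rho>)
       + of_real (cos \<rho>) *s (Sigma01 *v \<Phi> \<rho>) = (\<i> * of_real s) *s radial_ladder M s \<omega> \<Phi> \<rho>"
      using assms(2) c
      by (auto simp: vec_eq_iff forall_2 radial_rhs_def radial_ladder_def Sigma01_mult field_simps)
    have "ladder s (stationary \<omega> \<Phi>) t \<rho> = (exp (- \<i> * complex_of_real (s * t)) * E) *s
       ((of_real s * \<i> * of_real (cos \<rho>)) *s radial_rhs M \<omega> \<Phi> \<rho>
       - (of_real s * \<i> / 2 * of_real (sin \<rho>)) *s \<Phi> \<rho>
       + of_real (sin \<rho>) *s ((- \<i> * of_real \<omega>) *s \<Phi> \<rho>)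
       + of_real (cos \<rho>) *s (Sigma01 *v \<Phi> \<rho>))"
      using True
      by (simp add: ladder_def on_strip_def t r st vec_eq_iff forall_2 Sigma01_mult algebra_simps)
    then show ?thesis
      unfolding inner by (simp add: spinor_scale_def rhs vec_eq_iff)
  qed
qed

section \<open>Inner products of tame fields\<close>

definition tame_field :: "real \<Rightarrow> spinor_field \<Rightarrow> bool" where
  "tame_field m \<Psi> \<longleftrightarrow> 0 \<le> m \<and> m < 1/2 \<and> (\<forall>t j. tame m (\<lambda>\<rho>. \<Psi> t \<rho> $ j))"

lemma tame_field_lincomb:
  "tame_field m \<Psi>\<^sub>1 \<Longrightarrow> tame_field m \<Psi>\<^sub>2 \<Longrightarrow> tame_field m (a *\<^sub>\<Psi> \<Psi>\<^sub>1 + b *\<^sub>\<Psi> \<Psi>\<^sub>2)"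
  by (simp add: tame_field_def spinor_scale_def tame_lincomb)

lemma square_integrable_tame_field:
  assumes "tame_field m \<Psi>"
  shows "square_integrable \<Psi>"
  unfolding square_integrable_def
proof (intro allI conjI)
  fix t and j :: 2
  have t: "0 \<le> m" "m < 1/2" "tame m (\<lambda>\<rho>. \<Psi> t \<rho> $ j)" using assms by (auto simp: tame_field_def)
  then show "set_borel_measurable lborel rho_interval (\<lambda>\<rho>. \<Psi> t \<rho> $ j)"
    using borel_measurable_continuous_on_indicator[of rho_interval "\<lambda>\<rho>. \<Psi> t \<rho> $ j"]
    by (simp add: tame_def set_borel_measurable_def)
  show "set_integrable lborel rho_interval (\<lambda>\<rho>. (cmod (\<Psi> t \<rho> $ j))\<^sup>2)"
    using set_integrable_norm[OF tame_product[OF t t(3)]] by (simp add: norm_mult power2_eq_square)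
qed

text \<open>Splitting the integral of a sum requires both products to be integrable, which tameness
  with a common \<open>m\<close> guarantees.\<close>

lemma spinor_inner_lincomb:
  assumes "tame_field m \<Psi>\<^sub>1" "tame_field m \<Psi>\<^sub>2" "tame_field m \<Psi>\<^sub>3"
  shows "spinor_inner t \<Psi>\<^sub>3 (a *\<^sub>\<Psi> \<Psi>\<^sub>1 + b *\<^sub>\<Psi> \<Psi>\<^sub>2) = a * spinor_inner t \<Psi>\<^sub>3 \<Psi>\<^sub>1 + b * spinor_inner t \<Psi>\<^sub>3 \<Psi>\<^sub>2"
    "spinor_inner t (a *\<^sub>\<Psi> \<Psi>\<^sub>1 + b *\<^sub>\<Psi> \<Psi>\<^sub>2) \<Psi>\<^sub>3 = cnj a * spinor_inner t \<Psi>\<^sub>1 \<Psi>\<^sub>3 + cnj b * spinor_inner t \<Psi>\<^sub>2 \<Psi>\<^sub>3"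
proof -
  have i: "set_integrable lborel rho_interval (\<lambda>\<rho>. \<Sum>j\<in>UNIV. cnj (X t \<rho> $ j) * Y t \<rho> $ j)"
    if "tame_field m X" "tame_field m Y" for X Y
    unfolding sum_2 using that by (intro set_integral_add(1) tame_product[of m]) (auto simp: tame_field_def)
  have e1: "(\<Sum>j\<in>UNIV. cnj (\<Psi>\<^sub>3 t \<rho> $ j) * (a *\<^sub>\<Psi> \<Psi>\<^sub>1 + b *\<^sub>\<Psi> \<Psi>\<^sub>2) t \<rho> $ j) =
      a * (\<Sum>j\<in>UNIV. cnj (\<Psi>\<^sub>3 t \<rho> $ j) * \<Psi>\<^sub>1 t \<rho> $ j) + b * (\<Sum>j\<in>UNIV. cnj (\<Psi>\<^sub>3 t \<rho> $ j) * \<Psi>\<^sub>2 t \<rho> $ j)" for \<rho>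
    by (simp add: plus_fun_def spinor_scale_def sum_2 algebra_simps)
  have e2: "(\<Sum>j\<in>UNIV. cnj ((a *\<^sub>\<Psi> \<Psi>\<^sub>1 + b *\<^sub>\<Psi> \<Psi>\<^sub>2) t \<rho> $ j) * \<Psi>\<^sub>3 t \<rho> $ j) =
      cnj a * (\<Sum>j\<in>UNIV. cnj (\<Psi>\<^sub>1 t \<rho> $ j) * \<Psi>\<^sub>3 t \<rho> $ j) + cnj b * (\<Sum>j\<in>UNIV. cnj (\<Psi>\<^sub>2 t \<rho> $ j) * \<Psi>\<^sub>3 t \<rho> $ j)" for \<rho>
    by (simp add: plus_fun_def spinor_scale_def sum_2 algebra_simps)
  show "spinor_inner t \<Psi>\<^sub>3 (a *\<^sub>\<Psi> \<Psi>\<^sub>1 + b *\<^sub>\<Psi> \<Psi>\<^sub>2) = a * spinor_inner t \<Psi>\<^sub>3 \<Psi>\<^sub>1 + b * spinor_inner t \<Psi>\<^sub>3 \<Psi>\<^sub>2"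
    unfolding spinor_inner_def e1
    by (subst set_integral_add(2)[OF set_integrable_mult_right[OF i] set_integrable_mult_right[OF i]]) (use assms in auto)
  show "spinor_inner t (a *\<^sub>\<Psi> \<Psi>\<^sub>1 + b *\<^sub>\<Psi> \<Psi>\<^sub>2) \<Psi>\<^sub>3 = cnj a * spinor_inner t \<Psi>\<^sub>1 \<Psi>\<^sub>3 + cnj b * spinor_inner t \<Psi>\<^sub>2 \<Psi>\<^sub>3"
    unfolding spinor_inner_def e2
    by (subst set_integral_add(2)[OF set_integrable_mult_right[OF i] set_integrable_mult_right[OF i]]) (use assms in auto)
qed

lemma spinor_inner_scale:
  "spinor_inner t \<Psi>\<^sub>1 (a *\<^sub>\<Psi> \<Psi>\<^sub>2) = a * spinor_inner t \<Psi>\<^sub>1 \<Psi>\<^sub>2"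
  "spinor_inner t (a *\<^sub>\<Psi> \<Psi>\<^sub>1) \<Psi>\<^sub>2 = cnj a * spinor_inner t \<Psi>\<^sub>1 \<Psi>\<^sub>2"
  by (simp_all add: spinor_inner_def spinor_scale_def sum_2 mult.assoc mult.left_commute flip: distrib_left)

lemma spinor_inner_stationary:
  "spinor_inner t (stationary \<omega> \<Phi>) (stationary \<omega>' \<Psi>) = exp (\<i> * of_real ((\<omega> - \<omega>') * t)) * radial_inner \<Phi> \<Psi>"
proof -
  have "(\<Sum>j\<in>UNIV. cnj (stationary \<omega> \<Phi> t \<rho> $ j) * stationary \<omega>' \<Psi> t \<rho> $ j) =
      exp (\<i> * of_real ((\<omega> - \<omega>') * t)) * spinor_density \<Phi> \<Psi> \<rho>" if "\<rho> \<in> rho_interval" for \<rho>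
  proof -
    have "exp (\<i> * of_real ((\<omega> - \<omega>') * t)) = cnj (exp (- \<i> * of_real (\<omega> * t))) * exp (- \<i> * of_real (\<omega>' * t))"
      by (simp add: exp_cnj algebra_simps flip: exp_add)
    then show ?thesis
      using that by (simp add: stationary_def on_strip_def spinor_density_def sum_2 algebra_simps)
  qed
  then have "spinor_inner t (stationary \<omega> \<Phi>) (stationary \<omega>' \<Psi>) =
      (LINT \<rho>:rho_interval|lborel. exp (\<i> * of_real ((\<omega> - \<omega>') * t)) * spinor_density \<Phi> \<Psi> \<rho>)"
    unfolding spinor_inner_def by (intro set_lebesgue_integral_cong) auto
  then show ?thesis by (simp add: radial_inner_def)
qed

lemma tame_field_stationary:
  assumes "radial_solution M \<omega>' \<Phi>" "\<bar>M\<bar> < 1/2"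
  shows "tame_field \<bar>M\<bar> (stationary \<omega> \<Phi>)"
proof -
  have "tame \<bar>M\<bar> (\<lambda>\<rho>. stationary \<omega> \<Phi> t \<rho> $ j)" for t j
  proof -
    let ?e = "exp (- \<i> * of_real (\<omega> * t))"
    have "tame \<bar>M\<bar> (\<lambda>\<rho>. ?e * \<Phi> \<rho> $ j + 0 * \<Phi> \<rho> $ j)"
      by (intro tame_lincomb tame_radial_solution[OF assms])
    moreover have "stationary \<omega> \<Phi> t \<rho> $ j = ?e * \<Phi> \<rho> $ j + 0 * \<Phi> \<rho> $ j" if "\<rho> \<in> rho_interval" for \<rho>
      using that by (simp add: stationary_def on_strip_def)
    ultimately show ?thesis by (simp add: tame_def cong: continuous_on_cong_simp)
  qed
  then show ?thesis using assms(2) by (simp add: tame_field_def)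
qed

text \<open>Induction on \<open>S\<close>: subtracting \<open>c + m\<close> from \<open>L0\<close>
  kills the term \<open>m\<close> and multiplies the others by \<open>k - m\<close>, which is not
  zero. The induction hypothesis puts those into \<open>W\<close>, and the term \<open>m\<close>
  follows by subtraction. The action on finite sums is a hypothesis because \<open>L0\<close> is not
  linear on all fields.\<close>

lemma L0_eigen_projection:
  fixes \<psi> :: "int \<Rightarrow> spinor_field"
  assumes W: "spinor.subspace W" and L0W: "\<And>x. x \<in> W \<Longrightarrow> L0 x \<in> W"
    and L0sum: "\<And>S a. finite S \<Longrightarrow> S \<subseteq> K \<Longrightarrow>
      L0 (\<Sum>k\<in>S. a k *\<^sub>\<Psi> \<psi> k) = (\<Sum>k\<in>S. (a k * of_real (c + of_int k)) *\<^sub>\<Psi> \<psi> k)"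
    and S: "finite S" "S \<subseteq> K" "(\<Sum>k\<in>S. a k *\<^sub>\<Psi> \<psi> k) \<in> W" "k \<in> S"
  shows "a k *\<^sub>\<Psi> \<psi> k \<in> W"
  using S
proof (induction S arbitrary: a k rule: finite_induct)
  case (insert m S)
  let ?x = "\<Sum>k\<in>insert m S. a k *\<^sub>\<Psi> \<psi> k"
  let ?b = "\<lambda>k. a k * of_real (of_int k - of_int m)"
  have "L0 ?x - of_real (c + of_int m) *\<^sub>\<Psi> ?x \<in> W"
    using insert.prems L0W W by (intro spinor.subspace_diff spinor.subspace_scale) auto
  also have "L0 ?x - of_real (c + of_int m) *\<^sub>\<Psi> ?x = (\<Sum>k\<in>insert m S. ?b k *\<^sub>\<Psi> \<psi> k)"
    unfolding L0sum[OF finite.insertI[OF insert.hyps(1)] insert.prems(1)] spinor.scale_sum_right sum_subtractf[symmetric]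
    by (intro sum.cong refl) (simp add: algebra_simps flip: spinor.scale_left_diff_distrib)
  also have "\<dots> = (\<Sum>k\<in>S. ?b k *\<^sub>\<Psi> \<psi> k)"
    using insert.hyps by simp
  finally have bW: "(\<Sum>k\<in>S. ?b k *\<^sub>\<Psi> \<psi> k) \<in> W" .
  have on_S: "a j *\<^sub>\<Psi> \<psi> j \<in> W" if j: "j \<in> S" for j
  proof -
    have "?b j *\<^sub>\<Psi> \<psi> j \<in> W" using insert.IH[OF _ bW j] insert.prems by auto
    then have "(1 / of_real (of_int j - of_int m)) *\<^sub>\<Psi> (?b j *\<^sub>\<Psi> \<psi> j) \<in> W"
      by (rule spinor.subspace_scale[OF W])
    moreover have "j \<noteq> m" using insert.hyps j by auto
    ultimately show ?thesis by simp
  qed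
  have "?x - (\<Sum>k\<in>S. a k *\<^sub>\<Psi> \<psi> k) \<in> W"
    by (rule spinor.subspace_diff[OF W insert.prems(2) spinor.subspace_sum[OF W on_S]])
  moreover have "?x - (\<Sum>k\<in>S. a k *\<^sub>\<Psi> \<psi> k) = a m *\<^sub>\<Psi> \<psi> m" using insert.hyps by simp
  ultimately have "a m *\<^sub>\<Psi> \<psi> m \<in> W" by simp
  then show ?case using on_S insert.prems by auto
qed simp

section \<open>The representation carried by a family of modes\<close>

text \<open>The ladder stops exactly where its coefficient vanishes; \<open>l\<close> and \<open>r\<close> are the components whose rescaling vanishes at the left and right end.\<close>

locale mode_family =
  fixes M c :: real and l r :: 2 and K :: "int set" and \<Phi> :: "int \<Rightarrow> real \<Rightarrow> complex^2"
  assumes M_lt: "\<bar>M\<bar> < 1/2"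
    and sol: "k \<in> K \<Longrightarrow> bvp_solution M (bc_gen l r) (c + of_int k) (\<Phi> k)"
    and norm_1: "k \<in> K \<Longrightarrow> radial_inner (\<Phi> k) (\<Phi> k) = 1"
    and K_nonempty: "K \<noteq> {}"
    and K_interval: "i \<in> K \<Longrightarrow> j \<in> K \<Longrightarrow> i \<le> k \<Longrightarrow> k \<le> j \<Longrightarrow> k \<in> K"
    and K_step: "k \<in> K \<Longrightarrow> k + 1 \<in> K \<Longrightarrow> (c + of_int k + 1/2)\<^sup>2 \<noteq> M\<^sup>2"
    and K_top: "k \<in> K \<Longrightarrow> k + 1 \<notin> K \<Longrightarrow> (c + of_int k + 1/2)\<^sup>2 = M\<^sup>2"
    and K_bot: "k \<in> K \<Longrightarrow> k - 1 \<notin> K \<Longrightarrow> (c + of_int k - 1/2)\<^sup>2 = M\<^sup>2"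
begin

definition mode :: "int \<Rightarrow> spinor_field" where
  "mode k = stationary (c + of_int k) (\<Phi> k)"

definition V :: "spinor_field set" where
  "V = spinor.span (mode ` K)"

lemma rsol: "k \<in> K \<Longrightarrow> radial_solution M (c + of_int k) (\<Phi> k)"
  using sol by (simp add: bvp_solution_def)

lemma mode_in_V: "k \<in> K \<Longrightarrow> mode k \<in> V"
  unfolding V_def by (rule spinor.span_base) simp

lemma subspace_V: "spinor.subspace V"
  unfolding V_def by (rule spinor.subspace_span)

lemma inner_mode:
  assumes "j \<in> K" "k \<in> K"
  shows "spinor_inner t (mode j) (mode k) = (if j = k then 1 else 0)"
  using norm_1[OF assms(1)] radial_orthogonal[OF M_lt sol[OF assms(1)] sol[OF assms(2)]]
  by (auto simp: mode_def spinor_inner_stationary)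

lemma mode_nonzero: "k \<in> K \<Longrightarrow> mode k \<noteq> 0"
  using inner_mode[of k k 0] by (auto simp: spinor_inner_def)

lemma nonzero_spinor_radial: "k \<in> K \<Longrightarrow> nonzero_spinor (\<Phi> k)"
  using mode_nonzero[of k]
  by (rule contrapos_np) (auto simp: nonzero_spinor_def mode_def stationary_def on_strip_def fun_eq_iff)

text \<open>The step carries an explicit coefficient 1, so that it is an instance of the lemmas
  about combinations of two fields.\<close>

lemma V_induct [consumes 1, case_names zero step]:
  assumes "x \<in> V" and "P 0" and "\<And>a k x. k \<in> K \<Longrightarrow> x \<in> V \<Longrightarrow> P x \<Longrightarrow> P (a *\<^sub>\<Psi> mode k + 1 *\<^sub>\<Psi> x)"
  shows "P x"
proof -
  have "x \<in> spinor.span (mode ` K)" using assms(1) by (simp only: V_def)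
  then have "x \<in> V \<and> P x"
  proof (rule spinor.span_induct_alt[where h = "\<lambda>x. x \<in> V \<and> P x"])
    show "0 \<in> V \<and> P 0" using assms(2) subspace_V spinor.subspace_0 by blast
  next
    fix a y x assume y: "y \<in> mode ` K" and x: "x \<in> V \<and> P x"
    then obtain k where k: "k \<in> K" "y = mode k" by auto
    have "a *\<^sub>\<Psi> y \<in> V" using k mode_in_V subspace_V spinor.subspace_scale by blast
    then have "a *\<^sub>\<Psi> y + x \<in> V" using x subspace_V spinor.subspace_add by blast
    moreover have "P (a *\<^sub>\<Psi> mode k + 1 *\<^sub>\<Psi> x)" using x k assms(3) by blast
    ultimately show "a *\<^sub>\<Psi> y + x \<in> V \<and> P (a *\<^sub>\<Psi> y + x)" by (simp only: k spinor.scale_one)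
  qed
  then show ?thesis ..
qed

lemma differentiable_field_V: "x \<in> V \<Longrightarrow> differentiable_field x"
proof (erule V_induct[where P = differentiable_field])
  have m: "differentiable_field (mode k)" if "k \<in> K" for k
    unfolding mode_def by (rule differentiable_field_stationary[OF rsol[OF that]])
  obtain k where "k \<in> K" using K_nonempty by blast
  from differentiable_field_lincomb[OF m[OF this] m[OF this], of 0 0] show "differentiable_field 0" by simp
  show "differentiable_field (a *\<^sub>\<Psi> mode k + 1 *\<^sub>\<Psi> x)" if "k \<in> K" "differentiable_field x" for a k x
    using that m by (intro differentiable_field_lincomb)
qed

lemma tame_field_V: "x \<in> V \<Longrightarrow> tame_field \<bar>M\<bar> x"
proof (erule V_induct[where P = "tame_field \<bar>M\<bar>"])
  have m: "tame_field \<bar>M\<bar> (mode k)" if "k \<in> K" for k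
    unfolding mode_def by (rule tame_field_stationary[OF rsol[OF that] M_lt])
  obtain k where "k \<in> K" using K_nonempty by blast
  from tame_field_lincomb[OF m[OF this] m[OF this], of 0 0] show "tame_field \<bar>M\<bar> 0" by simp
  show "tame_field \<bar>M\<bar> (a *\<^sub>\<Psi> mode k + 1 *\<^sub>\<Psi> x)" if "k \<in> K" "tame_field \<bar>M\<bar> x" for a k x
    using that m by (intro tame_field_lincomb)
qed

text \<open>Linearity relative to \<open>V\<close>, where all fields are differentiable. It reduces
  identities between operators to the modes via \<open>linear_on_V_eqI\<close>.\<close>

definition linear_on_V :: "(spinor_field \<Rightarrow> spinor_field) \<Rightarrow> bool" where
  "linear_on_V A \<longleftrightarrow> (\<forall>x\<in>V. A x \<in> V) \<and>
    (\<forall>x\<in>V. \<forall>y\<in>V. \<forall>a b. A (a *\<^sub>\<Psi> x + b *\<^sub>\<Psi> y) = a *\<^sub>\<Psi> A x + b *\<^sub>\<Psi> A y)"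

lemma lincomb_in_V: "x \<in> V \<Longrightarrow> y \<in> V \<Longrightarrow> a *\<^sub>\<Psi> x + b *\<^sub>\<Psi> y \<in> V"
  using subspace_V by (intro spinor.subspace_add spinor.subspace_scale) auto

lemma linear_on_V_zero: "linear_on_V A \<Longrightarrow> A 0 = 0"
  using subspace_V spinor.subspace_0[OF subspace_V] unfolding linear_on_V_def
  by (metis add.right_neutral spinor.scale_zero_left)

lemma linear_on_V_comp: "linear_on_V A \<Longrightarrow> linear_on_V B \<Longrightarrow> linear_on_V (\<lambda>x. A (B x))"
  by (simp add: linear_on_V_def)

lemma linear_on_V_lincomb:
  "linear_on_V A \<Longrightarrow> linear_on_V B \<Longrightarrow> linear_on_V (\<lambda>x. a *\<^sub>\<Psi> A x + b *\<^sub>\<Psi> B x)"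
  by (auto simp: linear_on_V_def lincomb_in_V spinor.scale_right_distrib mult.commute add_ac)

lemma linear_on_V_scale: "linear_on_V (\<lambda>x. a *\<^sub>\<Psi> x)"
  using subspace_V by (auto simp: linear_on_V_def spinor.scale_right_distrib mult.commute intro: spinor.subspace_scale)

lemma linear_on_V_eqI:
  assumes "linear_on_V A" "linear_on_V B" "\<And>k. k \<in> K \<Longrightarrow> A (mode k) = B (mode k)" "x \<in> V"
  shows "A x = B x"
proof (rule V_induct[OF assms(4), where P = "\<lambda>x. A x = B x"])
  show "A 0 = B 0" by (simp only: linear_on_V_zero[OF assms(1)] linear_on_V_zero[OF assms(2)])
next
  fix a k x assume step: "k \<in> K" "x \<in> V" "A x = B x"
  have "A (a *\<^sub>\<Psi> mode k + 1 *\<^sub>\<Psi> x) = a *\<^sub>\<Psi> A (mode k) + 1 *\<^sub>\<Psi> A x"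
    "B (a *\<^sub>\<Psi> mode k + 1 *\<^sub>\<Psi> x) = a *\<^sub>\<Psi> B (mode k) + 1 *\<^sub>\<Psi> B x"
    using assms(1,2) mode_in_V step unfolding linear_on_V_def by blast+
  then show "A (a *\<^sub>\<Psi> mode k + 1 *\<^sub>\<Psi> x) = B (a *\<^sub>\<Psi> mode k + 1 *\<^sub>\<Psi> x)"
    by (simp only: step assms(3))
qed

lemma linear_on_V_I:
  assumes "\<And>\<Psi>\<^sub>1 \<Psi>\<^sub>2 a b. differentiable_field \<Psi>\<^sub>1 \<Longrightarrow> differentiable_field \<Psi>\<^sub>2 \<Longrightarrow>
      A (a *\<^sub>\<Psi> \<Psi>\<^sub>1 + b *\<^sub>\<Psi> \<Psi>\<^sub>2) = a *\<^sub>\<Psi> A \<Psi>\<^sub>1 + b *\<^sub>\<Psi> A \<Psi>\<^sub>2"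
    and "\<And>k. k \<in> K \<Longrightarrow> A (mode k) \<in> V"
  shows "linear_on_V A"
proof -
  have "A x \<in> V" if "x \<in> V" for x
  proof (rule V_induct[OF that, where P = "\<lambda>x. A x \<in> V"])
    obtain k where k: "k \<in> K" using K_nonempty by blast
    then have "A (0 *\<^sub>\<Psi> mode k + 0 *\<^sub>\<Psi> mode k) = 0 *\<^sub>\<Psi> A (mode k) + 0 *\<^sub>\<Psi> A (mode k)"
      using differentiable_field_V mode_in_V by (intro assms(1)) auto
    then have "A 0 = 0" by simp
    then show "A 0 \<in> V" using subspace_V spinor.subspace_0 by simp
  next
    fix a k x assume step: "k \<in> K" "x \<in> V" "A x \<in> V"
    have "A (a *\<^sub>\<Psi> mode k + 1 *\<^sub>\<Psi> x) = a *\<^sub>\<Psi> A (mode k) + 1 *\<^sub>\<Psi> A x"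
      using differentiable_field_V mode_in_V step by (intro assms(1)) auto
    also have "\<dots> \<in> V" using step assms(2) lincomb_in_V by blast
    finally show "A (a *\<^sub>\<Psi> mode k + 1 *\<^sub>\<Psi> x) \<in> V" .
  qed
  then show ?thesis
    unfolding linear_on_V_def using assms(1) differentiable_field_V by blast
qed

definition sesquilinear_on_V :: "(spinor_field \<Rightarrow> spinor_field \<Rightarrow> complex) \<Rightarrow> bool" where
  "sesquilinear_on_V f \<longleftrightarrow> (\<forall>x\<in>V. \<forall>y\<in>V. \<forall>z\<in>V. \<forall>a b.
    f z (a *\<^sub>\<Psi> x + b *\<^sub>\<Psi> y) = a * f z x + b * f z y \<and>
    f (a *\<^sub>\<Psi> x + b *\<^sub>\<Psi> y) z = cnj a * f x z + cnj b * f y z)"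

lemma sesquilinear_on_V_eqI:
  assumes "sesquilinear_on_V f" "sesquilinear_on_V g"
    and modes: "\<And>j k. j \<in> K \<Longrightarrow> k \<in> K \<Longrightarrow> f (mode j) (mode k) = g (mode j) (mode k)"
    and "x \<in> V" "y \<in> V"
  shows "f x y = g x y"
proof -
  have z: "0 \<in> V" using subspace_V spinor.subspace_0 by blast
  have zero: "h 0 u = 0" "h u 0 = 0" if h: "sesquilinear_on_V h" and u: "u \<in> V" for h u
  proof -
    have "h (0 *\<^sub>\<Psi> 0 + 0 *\<^sub>\<Psi> 0) u = cnj 0 * h 0 u + cnj 0 * h 0 u" "h u (0 *\<^sub>\<Psi> 0 + 0 *\<^sub>\<Psi> 0) = 0 * h u 0 + 0 * h u 0"
      using h u z unfolding sesquilinear_on_V_def by blast+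
    then show "h 0 u = 0" "h u 0 = 0" by simp_all
  qed
  have lin: "h u (a *\<^sub>\<Psi> mode k + 1 *\<^sub>\<Psi> v) = a * h u (mode k) + 1 * h u v"
    "h (a *\<^sub>\<Psi> mode k + 1 *\<^sub>\<Psi> v) u = cnj a * h (mode k) u + cnj 1 * h v u"
    if "sesquilinear_on_V h" "u \<in> V" "v \<in> V" "k \<in> K" for h u v k a
    using that mode_in_V unfolding sesquilinear_on_V_def by blast+
  have left: "f (mode j) y = g (mode j) y" if j: "j \<in> K" for j
  proof (rule V_induct[OF assms(5), where P = "\<lambda>y. f (mode j) y = g (mode j) y"])
    show "f (mode j) 0 = g (mode j) 0"
      by (simp only: zero[OF assms(1) mode_in_V[OF j]] zero[OF assms(2) mode_in_V[OF j]])
  next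
    fix a k v assume step: "k \<in> K" "v \<in> V" "f (mode j) v = g (mode j) v"
    show "f (mode j) (a *\<^sub>\<Psi> mode k + 1 *\<^sub>\<Psi> v) = g (mode j) (a *\<^sub>\<Psi> mode k + 1 *\<^sub>\<Psi> v)"
      by (simp only: lin(1)[OF assms(1) mode_in_V[OF j] step(2,1)] lin(1)[OF assms(2) mode_in_V[OF j] step(2,1)]
          modes[OF j step(1)] step(3))
  qed
  show ?thesis
  proof (rule V_induct[OF assms(4), where P = "\<lambda>x. f x y = g x y"])
    show "f 0 y = g 0 y" by (simp only: zero[OF assms(1,5)] zero[OF assms(2,5)])
  next
    fix a k v assume step: "k \<in> K" "v \<in> V" "f v y = g v y"
    show "f (a *\<^sub>\<Psi> mode k + 1 *\<^sub>\<Psi> v) y = g (a *\<^sub>\<Psi> mode k + 1 *\<^sub>\<Psi> v) y"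
      by (simp only: lin(2)[OF assms(1,5) step(2,1)] lin(2)[OF assms(2,5) step(2,1)] left[OF step(1)] step(3))
  qed
qed

lemma sesquilinear_inner:
  assumes "linear_on_V A" "linear_on_V B"
  shows "sesquilinear_on_V (\<lambda>x y. spinor_inner t (A x) (B y))"
  using assms tame_field_V unfolding sesquilinear_on_V_def linear_on_V_def
  by (simp add: spinor_inner_lincomb[where m = "\<bar>M\<bar>"])

lemma sesquilinear_uminus: "sesquilinear_on_V f \<Longrightarrow> sesquilinear_on_V (\<lambda>x y. - f x y)"
  by (simp add: sesquilinear_on_V_def algebra_simps)

lemma linear_on_V_id: "linear_on_V (\<lambda>x. x)"
  using linear_on_V_scale[of 1] by simp

subsection \<open>Action on the modes\<close>

lemma L0_mode: "L0 (mode k) = of_real (c + of_int k) *\<^sub>\<Psi> mode k"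
  unfolding mode_def by (rule L0_stationary)

lemma ladder_mode:
  assumes "k \<in> K" "s \<in> {1, - 1 :: int}"
  shows "ladder (of_int s) (mode k) =
    (\<i> * of_int s) *\<^sub>\<Psi> stationary (c + of_int (k + s)) (radial_ladder M (of_int s) (c + of_int k) (\<Phi> k))"
proof -
  have "real_of_int s \<in> {1, - 1}" using assms(2) by auto
  from ladder_stationary[OF rsol[OF assms(1)] this] show ?thesis
    unfolding mode_def by (simp add: add.assoc)
qed

lemma ladder_mode_comp:
  assumes "k \<in> K" "s \<in> {1, - 1 :: int}"
  shows "ladder (- of_int s) (ladder (of_int s) (mode k)) =
    of_real (M\<^sup>2 - (1/2 + of_int s * (c + of_int k))\<^sup>2) *\<^sub>\<Psi> mode k"
proof -
  let ?T = "radial_ladder M (of_int s) (c + of_int k) (\<Phi> k)"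
  have s: "real_of_int s \<in> {1, - 1}" "- real_of_int s \<in> {1, - 1}" using assms(2) by auto
  have T: "radial_solution M (c + of_int k + of_int s) ?T"
    by (rule radial_ladder_solution[OF rsol[OF assms(1)] s(1)])
  let ?S = "stationary (c + of_int k + of_int s) ?T"
  have df: "differentiable_field ?S" by (rule differentiable_field_stationary[OF T])
  \<comment> \<open>The zero summand gives the multiple of \<open>?S\<close> the form of
    \<open>ladder_lincomb\<close>; \<open>?S\<close> is differentiable but not known to lie in
    \<open>V\<close> at this point.\<close>
  have "ladder (- of_int s) (ladder (of_int s) (mode k)) = ladder (- of_int s) ((\<i> * of_int s) *\<^sub>\<Psi> ?S + 0 *\<^sub>\<Psi> ?S)"
    by (simp add: ladder_mode[OF assms] add.assoc)
  also have "\<dots> = (\<i> * of_int s) *\<^sub>\<Psi> ladder (- of_int s) ?S"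
    unfolding ladder_lincomb[OF df df] by simp
  also have "\<dots> = (\<i> * of_int s) *\<^sub>\<Psi> ((\<i> * of_real (- of_int s)) *\<^sub>\<Psi>
      stationary (c + of_int k + of_int s + - of_int s) (radial_ladder M (- of_int s) (c + of_int k + of_int s) ?T))"
    by (simp only: ladder_stationary[OF T s(2)])
  also have "\<dots> = of_real (M\<^sup>2 - (1/2 + of_int s * (c + of_int k))\<^sup>2) *\<^sub>\<Psi> mode k"
    unfolding radial_ladder_comp[OF s(1), abs_def] using assms(2)
    by (auto simp: mode_def stationary_def on_strip_def spinor_scale_def fun_eq_iff vec_eq_iff)
  finally show ?thesis .
qed

lemma ladder_mode_multiple:
  assumes "k \<in> K" "s \<in> {1, - 1 :: int}" "k + s \<in> K"
  shows "\<exists>a. ladder (of_int s) (mode k) = a *\<^sub>\<Psi> mode (k + s)"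
proof -
  let ?T = "radial_ladder M (of_int s) (c + of_int k) (\<Phi> k)"
  have "bvp_solution M (bc_gen l r) (c + of_int (k + s)) ?T"
    using bvp_radial_ladder[OF M_lt sol[OF assms(1)], of "of_int s"] assms(2) by (auto simp: add.assoc)
  then obtain b where "\<forall>\<rho>\<in>rho_interval. ?T \<rho> = b *s \<Phi> (k + s) \<rho>"
    using unique_up_to_scalars_bc_gen[OF M_lt, of l r "c + of_int (k + s)"] sol[OF assms(3)] nonzero_spinor_radial[OF assms(3)]
    unfolding unique_up_to_scalars_def by blast
  then have "stationary (c + of_int (k + s)) ?T = b *\<^sub>\<Psi> mode (k + s)"
    by (auto simp: mode_def stationary_def on_strip_def spinor_scale_def fun_eq_iff vec_eq_iff)
  then show ?thesis by (auto simp: ladder_mode[OF assms(1,2)])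
qed

text \<open>Beyond the end of \<open>K\<close> there is no mode to compare with. Instead the image
  has norm 0, by \<open>radial_ladder_norm\<close> and \<open>K_top\<close> or \<open>K_bot\<close>,
  and a solution of norm 0 vanishes.\<close>

lemma ladder_mode_zero:
  assumes "k \<in> K" "s \<in> {1, - 1 :: int}" "k + s \<notin> K"
  shows "ladder (of_int s) (mode k) = 0"
proof -
  let ?T = "radial_ladder M (of_int s) (c + of_int k) (\<Phi> k)"
  have s: "real_of_int s \<in> {1, - 1}" using assms(2) by auto
  have "(1/2 + of_int s * (c + of_int k))\<^sup>2 = M\<^sup>2"
    using assms K_top[of k] K_bot[of k] by (auto simp: power2_eq_square algebra_simps)
  then have "radial_inner ?T ?T = 0"
    unfolding radial_ladder_norm[OF M_lt s sol[OF assms(1)]] by simp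
  then have "\<forall>\<rho>\<in>rho_interval. ?T \<rho> = 0"
    using radial_inner_self_eq_0[OF M_lt radial_ladder_solution[OF rsol[OF assms(1)] s]] by blast
  then show ?thesis
    by (auto simp: ladder_mode[OF assms(1,2)] stationary_def on_strip_def spinor_scale_def fun_eq_iff)
qed

lemma ladder_mode_in_V:
  assumes "k \<in> K" "s \<in> {1, - 1 :: int}"
  shows "ladder (of_int s) (mode k) \<in> V"
  using ladder_mode_multiple[OF assms] ladder_mode_zero[OF assms] mode_in_V[of "k + s"] subspace_V
  by (cases "k + s \<in> K") (auto simp: spinor.subspace_0 intro: spinor.subspace_scale)

lemma linear_L0: "linear_on_V L0"
  using mode_in_V subspace_V by (intro linear_on_V_I L0_lincomb) (auto simp: L0_mode intro: spinor.subspace_scale)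

lemma linear_ladder:
  assumes "s = 1 \<or> s = - 1"
  shows "linear_on_V (ladder s)"
  using assms ladder_mode_in_V[of _ 1] ladder_mode_in_V[of _ "-1"]
  by (intro linear_on_V_I ladder_lincomb) auto

text \<open>Stepping back would multiply the mode by a scalar that \<open>K_step\<close> keeps away
  from 0.\<close>

lemma ladder_mode_nonzero:
  assumes "k \<in> K" "s \<in> {1, - 1 :: int}" "k + s \<in> K"
  shows "ladder (of_int s) (mode k) \<noteq> 0"
proof
  assume z: "ladder (of_int s) (mode k) = 0"
  have "linear_on_V (ladder (- of_int s))" using assms(2) by (intro linear_ladder) auto
  then have "of_real (M\<^sup>2 - (1/2 + of_int s * (c + of_int k))\<^sup>2) *\<^sub>\<Psi> mode k = 0"
    unfolding ladder_mode_comp[OF assms(1,2), symmetric] z by (rule linear_on_V_zero)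
  then have "M\<^sup>2 - (1/2 + of_int s * (c + of_int k))\<^sup>2 = 0"
    using mode_nonzero[OF assms(1)] by (simp only: spinor.scale_eq_0_iff of_real_eq_0_iff simp_thms)
  then show False
    using assms K_step[of k] K_step[of "k - 1"] by (auto simp: power2_eq_square algebra_simps)
qed

lemma ladder_adjoint_mode:
  assumes "j \<in> K" "k \<in> K" "s \<in> {1, - 1 :: int}"
  shows "spinor_inner t (ladder (of_int s) (mode j)) (mode k) = - spinor_inner t (mode j) (ladder (- of_int s) (mode k))"
proof (cases "k = j + s")
  case True
  let ?s = "real_of_int s"
  have s: "?s \<in> {1, - 1}" using assms(3) by auto
  have k: "bvp_solution M (bc_gen l r) (c + of_int j + ?s) (\<Phi> k)" using sol[OF assms(2)] True by (simp add: add.assoc)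
  have L1: "ladder ?s (mode j) = (\<i> * of_int s) *\<^sub>\<Psi> stationary (c + of_int k) (radial_ladder M ?s (c + of_int j) (\<Phi> j))"
    using ladder_mode[OF assms(1,3)] True by simp
  have L2: "ladder (- ?s) (mode k) = (- \<i> * of_int s) *\<^sub>\<Psi> stationary (c + of_int j) (radial_ladder M (- ?s) (c + of_int j + ?s) (\<Phi> k))"
    using ladder_mode[OF assms(2), of "- s"] assms(3) True by (auto simp: add.assoc)
  show ?thesis
    unfolding L1 L2 spinor_inner_scale unfolding mode_def spinor_inner_stationary
      radial_ladder_adjoint[OF M_lt s sol[OF assms(1)] k]
    by simp
next
  case False
  \<comment> \<open>Off the diagonal both sides vanish: each image is zero or a multiple of a mode
    orthogonal to the other argument.\<close>
  have 1: "spinor_inner t (ladder (of_int s) (mode j)) (mode k) = 0"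
  proof (cases "j + s \<in> K")
    case True
    obtain a where "ladder (of_int s) (mode j) = a *\<^sub>\<Psi> mode (j + s)"
      using ladder_mode_multiple[OF assms(1,3) True] by blast
    then show ?thesis using False inner_mode[OF True assms(2)] by (auto simp: spinor_inner_scale)
  next
    case False
    then show ?thesis by (simp add: ladder_mode_zero[OF assms(1,3)] spinor_inner_def)
  qed
  have s': "- s \<in> {1, - 1}" using assms(3) by auto
  have "spinor_inner t (mode j) (ladder (of_int (- s)) (mode k)) = 0"
  proof (cases "k + - s \<in> K")
    case True
    obtain a where "ladder (of_int (- s)) (mode k) = a *\<^sub>\<Psi> mode (k + - s)"
      using ladder_mode_multiple[OF assms(2) s' True] by blast
    then show ?thesis using False inner_mode[OF assms(1) True] by (auto simp: spinor_inner_scale)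
  next
    case False
    then show ?thesis by (simp add: ladder_mode_zero[OF assms(2) s'] spinor_inner_def del: of_int_minus)
  qed
  with 1 show ?thesis by simp
qed

subsection \<open>Invariance, irreducibility and unitarity\<close>

lemma invariant_V: "invariant V"
  using linear_L0 linear_ladder[of 1] linear_ladder[of "- 1"] subspace_V
  unfolding invariant_def linear_on_V_def by blast

lemma V_explicit:
  assumes "x \<in> V"
  shows "\<exists>S a. finite S \<and> S \<subseteq> K \<and> x = (\<Sum>k\<in>S. a k *\<^sub>\<Psi> mode k)"
proof -
  obtain T b where T: "finite T" "T \<subseteq> mode ` K" "x = (\<Sum>v\<in>T. b v *\<^sub>\<Psi> v)"
    using assms unfolding V_def spinor.span_explicit by blast
  then obtain S where S: "S \<subseteq> K" "inj_on mode S" "T = mode ` S"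
    by (auto simp: subset_image_inj)
  have "finite S" using T(1) S by (simp add: finite_image_iff)
  moreover have "x = (\<Sum>k\<in>S. b (mode k) *\<^sub>\<Psi> mode k)"
    unfolding T(3) S(3) by (simp add: sum.reindex[OF S(2)] o_def)
  ultimately show ?thesis using S(1) by (intro exI[of _ S] exI[of _ "\<lambda>k. b (mode k)"] conjI)
qed

lemma sum_in_V: "S \<subseteq> K \<Longrightarrow> (\<Sum>k\<in>S. a k *\<^sub>\<Psi> mode k) \<in> V"
  using subspace_V mode_in_V by (intro spinor.subspace_sum spinor.subspace_scale) auto

lemma L0_sum:
  assumes "finite S" "S \<subseteq> K"
  shows "L0 (\<Sum>k\<in>S. a k *\<^sub>\<Psi> mode k) = (\<Sum>k\<in>S. (a k * of_real (c + of_int k)) *\<^sub>\<Psi> mode k)"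
  using assms
proof (induction S rule: finite_induct)
  case empty
  then show ?case using linear_on_V_zero[OF linear_L0] by (simp only: sum.empty)
next
  case (insert m S)
  have "L0 (a m *\<^sub>\<Psi> mode m + 1 *\<^sub>\<Psi> (\<Sum>k\<in>S. a k *\<^sub>\<Psi> mode k)) =
      a m *\<^sub>\<Psi> L0 (mode m) + 1 *\<^sub>\<Psi> L0 (\<Sum>k\<in>S. a k *\<^sub>\<Psi> mode k)"
    using linear_L0 mode_in_V[of m] sum_in_V[of S a] insert.prems unfolding linear_on_V_def by blast
  moreover have "L0 (\<Sum>k\<in>S. a k *\<^sub>\<Psi> mode k) = (\<Sum>k\<in>S. (a k * of_real (c + of_int k)) *\<^sub>\<Psi> mode k)"
    using insert by blast
  ultimately show ?case
    by (simp only: sum.insert[OF insert.hyps] spinor.scale_one L0_mode spinor.scale_scale)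
qed

lemma mode_projection:
  assumes "spinor.subspace W" "\<And>x. x \<in> W \<Longrightarrow> L0 x \<in> W"
    and "finite S" "S \<subseteq> K" "(\<Sum>k\<in>S. a k *\<^sub>\<Psi> mode k) \<in> W" "k \<in> S"
  shows "a k *\<^sub>\<Psi> mode k \<in> W"
proof (rule L0_eigen_projection[OF assms(1,2) _ assms(3-6)])
  show "L0 (\<Sum>k\<in>S. a k *\<^sub>\<Psi> mode k) = (\<Sum>k\<in>S. (a k * of_real (c + of_int k)) *\<^sub>\<Psi> mode k)"
    if "finite S" "S \<subseteq> K" for S a
    by (rule L0_sum[OF that])
qed

text \<open>The eigenvalue projection applied to the invariant subspace \<open>{0}\<close>.\<close>

lemma mode_independent:
  assumes "finite S" "S \<subseteq> K" "(\<Sum>k\<in>S. a k *\<^sub>\<Psi> mode k) = 0" "k \<in> S"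
  shows "a k = 0"
proof -
  have "a k *\<^sub>\<Psi> mode k \<in> {0}"
    by (rule mode_projection[OF _ _ assms(1,2) _ assms(4)])
      (use assms(3) linear_on_V_zero[OF linear_L0] spinor.subspace_single_0 in auto)
  then show ?thesis using mode_nonzero[of k] assms(2,4) spinor.scale_eq_0_iff by blast
qed

lemma mode_ladder_closed:
  assumes W: "invariant W" and k: "k \<in> K" "mode k \<in> W" and s: "s \<in> {1, - 1 :: int}" "k + s \<in> K"
  shows "mode (k + s) \<in> W"
proof -
  obtain a where a: "ladder (of_int s) (mode k) = a *\<^sub>\<Psi> mode (k + s)"
    using ladder_mode_multiple[OF k(1) s] by blast
  have "a \<noteq> 0" using a ladder_mode_nonzero[OF k(1) s] by (metis spinor.scale_zero_left)
  have "ladder (of_int s) (mode k) \<in> W" using W k(2) s(1) by (auto simp: invariant_def)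
  then have "(1 / a) *\<^sub>\<Psi> (a *\<^sub>\<Psi> mode (k + s)) \<in> W"
    unfolding a using W spinor.subspace_scale unfolding invariant_def by blast
  then show ?thesis using \<open>a \<noteq> 0\<close> by simp
qed

text \<open>\<open>K_interval\<close> keeps all indices between \<open>k\<close> and
  \<open>j\<close> in \<open>K\<close>, so unit steps lead from one mode to the other without
  hitting a zero of the ladder.\<close>

lemma mode_reach_all:
  assumes W: "invariant W" and k: "k \<in> K" "mode k \<in> W" and j: "j \<in> K"
  shows "mode j \<in> W"
proof (cases "k \<le> j")
  case True
  have "i \<le> j \<longrightarrow> mode i \<in> W" if "k \<le> i" for i
    using that
  proof (induction i rule: int_ge_induct)
    case (step i)
    show ?case
      using step K_interval[OF k(1) j, of i] K_interval[OF k(1) j, of "i + 1"] mode_ladder_closed[OF W, of i 1] by auto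
  qed (use k in simp)
  then show ?thesis using True by simp
next
  case False
  have "j \<le> i \<longrightarrow> mode i \<in> W" if "i \<le> k" for i
    using that
  proof (induction i rule: int_le_induct)
    case (step i)
    show ?case
      using step K_interval[OF j k(1), of i] K_interval[OF j k(1), of "i - 1"] mode_ladder_closed[OF W, of i "-1"] by auto
  qed (use k in simp)
  then show ?thesis using False by simp
qed

lemma V_nonzero: "V \<noteq> {0}"
  using K_nonempty mode_in_V mode_nonzero by blast

text \<open>A non-zero vector of \<open>W\<close> has a non-zero component along some mode;
  projection puts this mode into \<open>W\<close>, and from one mode all others are reached.\<close>

lemma irreducible_V: "irreducible_rep V"
  unfolding irreducible_rep_def
proof (intro conjI allI impI, rule invariant_V, rule V_nonzero, elim conjE)
  fix W assume WV: "W \<subseteq> V" and W: "invariant W"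
  have sub: "spinor.subspace W" and L0W: "\<And>x. x \<in> W \<Longrightarrow> L0 x \<in> W" using W by (auto simp: invariant_def)
  show "W = {0} \<or> W = V"
  proof (cases "W = {0}")
    case False
    then obtain x where x: "x \<in> W" "x \<noteq> 0" using spinor.subspace_0[OF sub] by blast
    obtain S a where S: "finite S" "S \<subseteq> K" "x = (\<Sum>k\<in>S. a k *\<^sub>\<Psi> mode k)"
      using V_explicit[of x] x(1) WV by blast
    have "\<exists>k\<in>S. a k \<noteq> 0"
    proof (rule ccontr)
      assume "\<not> ?thesis"
      then have "x = (\<Sum>k\<in>S. 0)" unfolding S(3) by (intro sum.cong) auto
      then show False using x(2) by simp
    qed
    then obtain k where k: "k \<in> S" "a k \<noteq> 0" by blast
    have "a k *\<^sub>\<Psi> mode k \<in> W"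
      by (rule mode_projection[OF sub L0W S(1,2) _ k(1)]) (use x(1) S(3) in simp_all)
    then have "(1 / a k) *\<^sub>\<Psi> (a k *\<^sub>\<Psi> mode k) \<in> W" by (rule spinor.subspace_scale[OF sub])
    then have "mode k \<in> W" using k(2) by simp
    then have "mode ` K \<subseteq> W" using mode_reach_all[OF W, of k] k(1) S(2) by blast
    then have "V \<subseteq> W" unfolding V_def by (rule spinor.span_minimal[OF _ sub])
    then show ?thesis using WV by blast
  qed simp
qed

lemma ladder_mode_comp_signed:
  assumes "k \<in> K"
  shows "ladder (- 1) (ladder 1 (mode k)) = of_real (M\<^sup>2 - (c + of_int k + 1/2)\<^sup>2) *\<^sub>\<Psi> mode k"
    "ladder 1 (ladder (- 1) (mode k)) = of_real (M\<^sup>2 - (c + of_int k - 1/2)\<^sup>2) *\<^sub>\<Psi> mode k"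
proof -
  have "ladder (- of_int 1) (ladder (of_int 1) (mode k)) = of_real (M\<^sup>2 - (1/2 + of_int 1 * (c + of_int k))\<^sup>2) *\<^sub>\<Psi> mode k"
    "ladder (- of_int (- 1)) (ladder (of_int (- 1)) (mode k)) = of_real (M\<^sup>2 - (1/2 + of_int (- 1) * (c + of_int k))\<^sup>2) *\<^sub>\<Psi> mode k"
    by (rule ladder_mode_comp[OF assms]; simp)+
  moreover have "(1/2 + of_int 1 * (c + of_int k))\<^sup>2 = (c + of_int k + 1/2)\<^sup>2"
    "(1/2 + of_int (- 1) * (c + of_int k))\<^sup>2 = (c + of_int k - 1/2)\<^sup>2"
    by (simp_all add: power2_eq_square algebra_simps)
  ultimately show "ladder (- 1) (ladder 1 (mode k)) = of_real (M\<^sup>2 - (c + of_int k + 1/2)\<^sup>2) *\<^sub>\<Psi> mode k"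
    "ladder 1 (ladder (- 1) (mode k)) = of_real (M\<^sup>2 - (c + of_int k - 1/2)\<^sup>2) *\<^sub>\<Psi> mode k"
    by (simp_all only: of_int_1 of_int_minus minus_minus)
qed

lemma casimir_V:
  assumes "x \<in> V"
  shows "Casimir x = of_real (M\<^sup>2 - 1/4) *\<^sub>\<Psi> x"
proof (rule linear_on_V_eqI[OF _ linear_on_V_scale _ assms])
  note L = linear_ladder[of 1, simplified] linear_ladder[of "- 1", simplified]
  have "linear_on_V (\<lambda>x. 1 *\<^sub>\<Psi> L0 (L0 x) + (1/2) *\<^sub>\<Psi> (1 *\<^sub>\<Psi> L_plus (L_minus x) + 1 *\<^sub>\<Psi> L_minus (L_plus x)))"
    by (rule linear_on_V_lincomb[OF linear_on_V_comp[OF linear_L0 linear_L0]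
          linear_on_V_lincomb[OF linear_on_V_comp[OF L] linear_on_V_comp[OF L(2,1)]]])
  then show "linear_on_V Casimir"
    by (simp only: Casimir_def[abs_def] spinor.scale_one)
next
  fix k assume k: "k \<in> K"
  have "L0 (L0 (mode k)) = (of_real (c + of_int k) * of_real (c + of_int k)) *\<^sub>\<Psi> mode k"
  proof -
    have "L0 (of_real (c + of_int k) *\<^sub>\<Psi> mode k + 0 *\<^sub>\<Psi> mode k) = of_real (c + of_int k) *\<^sub>\<Psi> L0 (mode k) + 0 *\<^sub>\<Psi> L0 (mode k)"
      using linear_L0 mode_in_V[OF k] unfolding linear_on_V_def by blast
    then show ?thesis by (simp only: L0_mode mult_zero_left spinor.scale_zero_left add_0_right spinor.scale_scale)
  qed
  \<comment> \<open>The squares of \<omega> + 1/2 and \<omega> - 1/2 add up to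
    \<open>2 * \<omega>\<^sup>2 + 1/2\<close>, so the frequency \<omega> =
    \<open>c + of_int k\<close> drops out.\<close>
  moreover have "complex_of_real (c + of_int k) * of_real (c + of_int k) +
      1/2 * (of_real (M\<^sup>2 - (c + of_int k - 1/2)\<^sup>2) + of_real (M\<^sup>2 - (c + of_int k + 1/2)\<^sup>2)) = of_real (M\<^sup>2 - 1/4)"
    by (simp add: power2_eq_square field_simps)
  ultimately show "Casimir (mode k) = of_real (M\<^sup>2 - 1/4) *\<^sub>\<Psi> mode k"
    by (simp only: Casimir_def ladder_mode_comp_signed[OF k] spinor.scale_scale spinor.scale_left_distrib[symmetric])
qed

lemma commutation_V: "commutation_relations_on V"
  unfolding commutation_relations_on_def
proof (intro ballI conjI)
  note L = linear_ladder[of 1, simplified] linear_ladder[of "- 1", simplified]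
  \<comment> \<open>Differences of operators are treated as linear combinations, the form in which
    \<open>linear_on_V_eqI\<close> can be applied.\<close>
  have minus: "1 *\<^sub>\<Psi> y + (- 1) *\<^sub>\<Psi> z = y - z" for y z by simp
  have L0_ladder: "L0 (ladder (of_int s) (mode k)) = of_real (c + of_int (k + s)) *\<^sub>\<Psi> ladder (of_int s) (mode k)"
    if k: "k \<in> K" and s: "s \<in> {1, - 1}" for k s
  proof -
    let ?S = "stationary (c + of_int (k + s)) (radial_ladder M (of_int s) (c + of_int k) (\<Phi> k))"
    have "real_of_int s \<in> {1, - 1}" using s by auto
    from differentiable_field_stationary[OF radial_ladder_solution[OF rsol[OF k] this]]
    have "differentiable_field ?S" .
    from L0_lincomb[OF this this, of "\<i> * of_int s" 0] show ?thesis
      by (simp add: ladder_mode[OF k s] L0_stationary mult.commute)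
  qed
  have ladder_L0: "ladder t (L0 (mode k)) = of_real (c + of_int k) *\<^sub>\<Psi> ladder t (mode k)" if k: "k \<in> K" for k t
    using ladder_lincomb[OF differentiable_field_V differentiable_field_V, OF mode_in_V[OF k] mode_in_V[OF k], of t "of_real (c + of_int k)" 0]
    by (simp add: L0_mode)
  fix x assume x: "x \<in> V"
  have rel: "L0 (ladder t x) - ladder t (L0 x) = of_real t *\<^sub>\<Psi> ladder t x" if t: "t = 1 \<or> t = - 1" for t
  proof -
    have "1 *\<^sub>\<Psi> L0 (ladder t x) + (- 1) *\<^sub>\<Psi> ladder t (L0 x) = of_real t *\<^sub>\<Psi> ladder t x + 0 *\<^sub>\<Psi> ladder t x"
    proof (rule linear_on_V_eqI[OF _ _ _ x])
      note lt = linear_ladder[OF t]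
      show "linear_on_V (\<lambda>x. 1 *\<^sub>\<Psi> L0 (ladder t x) + (- 1) *\<^sub>\<Psi> ladder t (L0 x))"
        by (rule linear_on_V_lincomb[OF linear_on_V_comp[OF linear_L0 lt] linear_on_V_comp[OF lt linear_L0]])
      show "linear_on_V (\<lambda>x. of_real t *\<^sub>\<Psi> ladder t x + 0 *\<^sub>\<Psi> ladder t x)"
        by (rule linear_on_V_lincomb[OF lt lt])
      fix k assume k: "k \<in> K"
      obtain s :: int where s: "s \<in> {1, - 1}" "t = of_int s" using t by (metis insertCI of_int_1 of_int_minus)
      have "of_real (c + of_int (k + s)) + (- 1) * of_real (c + of_int k) = complex_of_real t" by (simp add: s)
      then show "1 *\<^sub>\<Psi> L0 (ladder t (mode k)) + (- 1) *\<^sub>\<Psi> ladder t (L0 (mode k)) =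
          of_real t *\<^sub>\<Psi> ladder t (mode k) + 0 *\<^sub>\<Psi> ladder t (mode k)"
        unfolding ladder_L0[OF k] unfolding s(2) L0_ladder[OF k s(1)]
        by (simp only: spinor.scale_scale spinor.scale_left_distrib[symmetric] mult_1_left add_0_right)
    qed
    then show ?thesis by (simp only: minus spinor.scale_zero_left add_0_right)
  qed
  from rel[of 1] show "L0 (L_plus x) - L_plus (L0 x) = L_plus x" by simp
  from rel[of "- 1"] show "L0 (L_minus x) - L_minus (L0 x) = - L_minus x" by simp
  have "1 *\<^sub>\<Psi> L_plus (L_minus x) + (- 1) *\<^sub>\<Psi> L_minus (L_plus x) = 2 *\<^sub>\<Psi> L0 x + 0 *\<^sub>\<Psi> L0 x"
  proof (rule linear_on_V_eqI[OF _ _ _ x])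
    show "linear_on_V (\<lambda>x. 1 *\<^sub>\<Psi> L_plus (L_minus x) + (- 1) *\<^sub>\<Psi> L_minus (L_plus x))"
      by (rule linear_on_V_lincomb[OF linear_on_V_comp[OF L] linear_on_V_comp[OF L(2,1)]])
    show "linear_on_V (\<lambda>x. 2 *\<^sub>\<Psi> L0 x + 0 *\<^sub>\<Psi> L0 x)"
      by (rule linear_on_V_lincomb[OF linear_L0 linear_L0])
    fix k assume k: "k \<in> K"
    have "1 * of_real (M\<^sup>2 - (c + of_int k - 1/2)\<^sup>2) + (- 1) * of_real (M\<^sup>2 - (c + of_int k + 1/2)\<^sup>2) =
        2 * complex_of_real (c + of_int k) + 0 * of_real (c + of_int k)"
      by (simp add: power2_eq_square field_simps)
    then show "1 *\<^sub>\<Psi> L_plus (L_minus (mode k)) + (- 1) *\<^sub>\<Psi> L_minus (L_plus (mode k)) = 2 *\<^sub>\<Psi> L0 (mode k) + 0 *\<^sub>\<Psi> L0 (mode k)"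
      by (simp only: ladder_mode_comp_signed[OF k] L0_mode spinor.scale_scale spinor.scale_left_distrib[symmetric])
  qed
  then show "L_plus (L_minus x) - L_minus (L_plus x) = 2 *\<^sub>\<Psi> L0 x"
    by (simp only: minus spinor.scale_zero_left add_0_right)
qed

lemma ladder_adjoint_V:
  assumes "x \<in> V" "y \<in> V" "s = 1 \<or> s = - 1"
  shows "spinor_inner t (ladder s x) y = - spinor_inner t x (ladder (- s) y)"
proof (rule sesquilinear_on_V_eqI[OF _ _ _ assms(1,2)])
  have s: "- s = 1 \<or> - s = - 1" using assms(3) by auto
  show "sesquilinear_on_V (\<lambda>x y. spinor_inner t (ladder s x) y)"
    by (rule sesquilinear_inner[OF linear_ladder[OF assms(3)] linear_on_V_id])
  show "sesquilinear_on_V (\<lambda>x y. - spinor_inner t x (ladder (- s) y))"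
    by (rule sesquilinear_uminus[OF sesquilinear_inner[OF linear_on_V_id linear_ladder[OF s]]])
  fix j k assume "j \<in> K" "k \<in> K"
  then show "spinor_inner t (ladder s (mode j)) (mode k) = - spinor_inner t (mode j) (ladder (- s) (mode k))"
    using ladder_adjoint_mode[of j k 1] ladder_adjoint_mode[of j k "- 1"] assms(3) by auto
qed

lemma unitary_V: "unitary_rep V"
  unfolding unitary_rep_def
proof (intro conjI ballI allI exI[of _ "mode ` K"])
  show "invariant V" "commutation_relations_on V" by (rule invariant_V commutation_V)+
  show "spinor.span (mode ` K) = V" by (simp add: V_def)
next
  fix x y t t' assume xy: "x \<in> V" "y \<in> V"
  show "spinor_inner t x y = spinor_inner t' x y"
    by (rule sesquilinear_on_V_eqI[OF sesquilinear_inner[OF linear_on_V_id linear_on_V_id]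
          sesquilinear_inner[OF linear_on_V_id linear_on_V_id] _ xy]) (simp add: inner_mode)
  show "spinor_inner t (L_plus x) y = - spinor_inner t x (L_minus y)"
    using ladder_adjoint_V[OF xy, of 1] by simp
  show "spinor_inner t (L_minus x) y = - spinor_inner t x (L_plus y)"
    using ladder_adjoint_V[OF xy, of "- 1"] by simp
next
  fix b b' t assume "b \<in> mode ` K" "b' \<in> mode ` K"
  then obtain j k where jk: "j \<in> K" "k \<in> K" "b = mode j" "b' = mode k" by auto
  have "b = b' \<longleftrightarrow> j = k"
    using inner_mode[OF jk(1,2), of 0] inner_mode[OF jk(1,1), of 0] jk by (auto split: if_splits)
  then show "spinor_inner t b b' = (if b = b' then 1 else 0)"
    using jk inner_mode by simp
qed (auto intro: square_integrable_tame_field tame_field_V L0_mode)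

lemma L0_eigenspace_V:
  assumes "x \<in> L0_eigenspace V \<mu>" "x \<noteq> 0"
  shows "\<exists>k\<in>K. \<mu> = of_real (c + of_int k) \<and> (\<exists>a. x = a *\<^sub>\<Psi> mode k)"
proof -
  have x: "x \<in> V" "L0 x = \<mu> *\<^sub>\<Psi> x" using assms(1) by (auto simp: L0_eigenspace_def)
  obtain S a where S: "finite S" "S \<subseteq> K" "x = (\<Sum>k\<in>S. a k *\<^sub>\<Psi> mode k)"
    using V_explicit[OF x(1)] by blast
  have "(\<Sum>k\<in>S. (a k * of_real (c + of_int k) - \<mu> * a k) *\<^sub>\<Psi> mode k) = L0 x - \<mu> *\<^sub>\<Psi> x"
    unfolding S(3) L0_sum[OF S(1,2)] spinor.scale_sum_right sum_subtractf[symmetric]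
    by (intro sum.cong refl) (simp only: spinor.scale_scale spinor.scale_left_diff_distrib)
  also have "\<dots> = 0" using x(2) by (simp only: diff_self)
  finally have sum0: "(\<Sum>k\<in>S. (a k * of_real (c + of_int k) - \<mu> * a k) *\<^sub>\<Psi> mode k) = 0" .
  have ev: "a k * (of_real (c + of_int k) - \<mu>) = 0" if "k \<in> S" for k
    using mode_independent[OF S(1,2) sum0 that] by (simp add: algebra_simps)
  have "\<exists>k\<in>S. a k \<noteq> 0"
  proof (rule ccontr)
    assume "\<not> ?thesis"
    then have "x = (\<Sum>k\<in>S. 0)" unfolding S(3) by (intro sum.cong) auto
    then show False using assms(2) by simp
  qed
  then obtain k where k: "k \<in> S" "a k \<noteq> 0" by blast
  then have \<mu>: "\<mu> = of_real (c + of_int k)" using ev[OF k(1)] by simp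
  have "a j = 0" if "j \<in> S" "j \<noteq> k" for j
    using ev[OF that(1)] that(2) by (auto simp only: \<mu> mult_eq_0_iff right_minus_eq of_real_eq_iff add_left_cancel of_int_eq_iff)
  then have "x = (\<Sum>j\<in>S. if j = k then a k *\<^sub>\<Psi> mode k else 0)"
    unfolding S(3) by (intro sum.cong) auto
  also have "\<dots> = a k *\<^sub>\<Psi> mode k" using S(1) k(1) by simp
  finally show ?thesis using k(1) S(2) \<mu> by blast
qed

lemma spectrum_V: "simple_L0_spectrum V ((\<lambda>k. of_real (c + of_int k)) ` K)"
  unfolding simple_L0_spectrum_def
proof
  have mem: "mode k \<in> L0_eigenspace V (of_real (c + of_int k))" if "k \<in> K" for k
    using mode_in_V[OF that] by (simp add: L0_eigenspace_def L0_mode)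
  have zero: "0 \<in> L0_eigenspace V \<mu>" for \<mu>
    using spinor.subspace_0[OF subspace_V] linear_on_V_zero[OF linear_L0]
    by (simp only: L0_eigenspace_def mem_Collect_eq spinor.scale_zero_right)
  show "{\<mu>. L0_eigenspace V \<mu> \<noteq> {0}} = (\<lambda>k. of_real (c + of_int k)) ` K"
  proof (intro equalityI subsetI)
    fix \<mu> assume "\<mu> \<in> {\<mu>. L0_eigenspace V \<mu> \<noteq> {0}}"
    then obtain x where "x \<in> L0_eigenspace V \<mu>" "x \<noteq> 0" using zero by blast
    then show "\<mu> \<in> (\<lambda>k. of_real (c + of_int k)) ` K" using L0_eigenspace_V by blast
  next
    fix \<mu> :: complex assume "\<mu> \<in> (\<lambda>k. of_real (c + of_int k)) ` K"
    then show "\<mu> \<in> {\<mu>. L0_eigenspace V \<mu> \<noteq> {0}}" using mem mode_nonzero by blast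
  qed
  show "\<forall>\<mu>\<in>(\<lambda>k. of_real (c + of_int k)) ` K. spinor.dim (L0_eigenspace V \<mu>) = 1"
  proof
    fix \<mu> :: complex assume "\<mu> \<in> (\<lambda>k. of_real (c + of_int k)) ` K"
    then obtain k where k: "k \<in> K" "\<mu> = of_real (c + of_int k)" by auto
    have "L0_eigenspace V \<mu> \<subseteq> spinor.span {mode k}"
    proof
      fix x assume x: "x \<in> L0_eigenspace V \<mu>"
      show "x \<in> spinor.span {mode k}"
      proof (cases "x = 0")
        case False
        then obtain j a where "\<mu> = of_real (c + of_int j)" "x = a *\<^sub>\<Psi> mode j"
          using L0_eigenspace_V[OF x False] by (elim bexE exE conjE)
        moreover then have "j = k" using k(2) by (simp only: of_real_eq_iff add_left_cancel of_int_eq_iff)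
        ultimately show ?thesis using spinor.span_base spinor.span_scale by blast
      qed (simp only: spinor.span_zero)
    qed
    moreover have "{mode k} \<subseteq> L0_eigenspace V \<mu>" using mem[OF k(1)] k(2) by simp
    moreover have "spinor.independent {mode k}"
      using mode_nonzero[OF k(1)] by (simp only: spinor.dependent_single not_False_eq_True)
    ultimately show "spinor.dim (L0_eigenspace V \<mu>) = 1"
      using spinor.basis_card_eq_dim[of "{mode k}" "L0_eigenspace V \<mu>"] by simp
  qed
qed

lemma has_frequency_mode: "has_frequency (c + of_int k) (mode k)"
  unfolding has_frequency_def mode_def by blast

lemma has_frequency_V:
  assumes "x \<in> V" "has_frequency \<omega> x" "x \<noteq> 0"
  shows "\<exists>k\<in>K. \<omega> = c + of_int k \<and> (\<exists>a. x = a *\<^sub>\<Psi> mode k)"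
proof -
  obtain \<Psi> where "x = stationary \<omega> \<Psi>" using assms(2) by (auto simp: has_frequency_def)
  then have "x \<in> L0_eigenspace V (of_real \<omega>)" using assms(1) by (simp add: L0_eigenspace_def L0_stationary)
  from L0_eigenspace_V[OF this assms(3)] show ?thesis
    by (simp only: of_real_eq_iff)
qed

text \<open>An invariant space that contains the mode 1 or the mode -1 also contains the mode 0,
  since no step of the ladder vanishes. But the mode 0 lies in neither frequency part, and it cannot
  lie in both summands of a direct sum.\<close>

lemma no_frequency_splitting:
  assumes c: "c = 0" and K: "K = UNIV"
  shows "\<not> invariant (positive_frequency_part V)" "\<not> invariant (negative_frequency_part V)"
    "\<not> splits_by_frequency V"
proof -
  have part: "spinor.span {x \<in> V. \<exists>\<omega>. P \<omega> \<and> has_frequency \<omega> x} \<subseteq> V"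
    "mode k \<in> spinor.span {x \<in> V. \<exists>\<omega>. P \<omega> \<and> has_frequency \<omega> x} \<longleftrightarrow> P (of_int k)" for P k
  proof -
    let ?G = "{x \<in> V. \<exists>\<omega>. P \<omega> \<and> has_frequency \<omega> x}"
    show "spinor.span ?G \<subseteq> V" by (rule spinor.span_minimal[OF _ subspace_V]) auto
    show "mode k \<in> spinor.span ?G \<longleftrightarrow> P (of_int k)"
    proof
      assume "P (of_int k)"
      then have "mode k \<in> ?G" using mode_in_V[of k] has_frequency_mode[of k] c K by auto
      then show "mode k \<in> spinor.span ?G" by (rule spinor.span_base)
    next
      assume k: "mode k \<in> spinor.span ?G"
      show "P (of_int k)"
      proof (rule ccontr)
        assume nP: "\<not> P (of_int k)"
        \<comment> \<open>By \<open>has_frequency_V\<close> the non-zero generators are multiples of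
          modes whose index satisfies \<open>P\<close>, hence differs from \<open>k\<close>; so the
          whole span is orthogonal to \<open>mode k\<close>.\<close>
        have orth: "?G \<subseteq> {x \<in> V. spinor_inner 0 (mode k) x = 0}"
        proof
          fix x assume x: "x \<in> ?G"
          show "x \<in> {x \<in> V. spinor_inner 0 (mode k) x = 0}"
          proof (cases "x = 0")
            case True
            then show ?thesis using x by (simp add: spinor_inner_def)
          next
            case False
            obtain \<omega> where "P \<omega>" "has_frequency \<omega> x" "x \<in> V" using x by blast
            moreover then obtain j a where "\<omega> = c + of_int j" "x = a *\<^sub>\<Psi> mode j"
              using has_frequency_V False by blast
            ultimately show ?thesis using nP c K inner_mode[of k j 0] by (auto simp: spinor_inner_scale)
          qed
        qed
        have "spinor.subspace {x \<in> V. spinor_inner 0 (mode k) x = 0}"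
        proof (rule spinor.subspaceI)
          show "0 \<in> {x \<in> V. spinor_inner 0 (mode k) x = 0}"
            using spinor.subspace_0[OF subspace_V] by (simp add: spinor_inner_def)
        next
          fix x y assume xy: "x \<in> {x \<in> V. spinor_inner 0 (mode k) x = 0}" "y \<in> {x \<in> V. spinor_inner 0 (mode k) x = 0}"
          then have "spinor_inner 0 (mode k) (1 *\<^sub>\<Psi> x + 1 *\<^sub>\<Psi> y) = 0"
            using mode_in_V K by (subst spinor_inner_lincomb[where m = "\<bar>M\<bar>"]) (auto intro!: tame_field_V)
          then show "x + y \<in> {x \<in> V. spinor_inner 0 (mode k) x = 0}"
            using xy spinor.subspace_add[OF subspace_V] by (simp only: spinor.scale_one mem_Collect_eq)
        next
          fix a x assume x: "x \<in> {x \<in> V. spinor_inner 0 (mode k) x = 0}"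
          then show "a *\<^sub>\<Psi> x \<in> {x \<in> V. spinor_inner 0 (mode k) x = 0}"
            using spinor.subspace_scale[OF subspace_V] by (simp add: spinor_inner_scale)
        qed
        from spinor.span_minimal[OF orth this] k inner_mode[of k k 0] K show False by auto
      qed
    qed
  qed
  note pos = part[where P = "\<lambda>\<omega>. 0 < \<omega>", folded positive_frequency_part_def]
  note neg = part[where P = "\<lambda>\<omega>. \<omega> < 0", folded negative_frequency_part_def]
  show "\<not> invariant (positive_frequency_part V)"
    using mode_reach_all[of "positive_frequency_part V" 1 0] pos(2)[of 1] pos(2)[of 0] K by auto
  show "\<not> invariant (negative_frequency_part V)"
    using mode_reach_all[of "negative_frequency_part V" "- 1" 0] neg(2)[of "- 1"] neg(2)[of 0] K by auto
  show "\<not> splits_by_frequency V"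
  proof
    assume "splits_by_frequency V"
    then obtain U W where UW: "invariant U" "invariant W" "positive_frequency_part V \<subseteq> U"
      "negative_frequency_part V \<subseteq> W" "U \<inter> W = {0}"
      unfolding splits_by_frequency_def by blast
    have "mode 1 \<in> U" "mode (- 1) \<in> W" using pos(2)[of 1] neg(2)[of "- 1"] UW by auto
    then have "mode 0 \<in> U \<inter> W"
      using mode_reach_all[OF UW(1), of 1 0] mode_reach_all[OF UW(2), of "- 1" 0] K by auto
    then show False using UW(5) mode_nonzero[of 0] K by auto
  qed
qed

end

section \<open>Jacobi polynomials\<close>

definition jacobi_coeff :: "nat \<Rightarrow> real \<Rightarrow> real \<Rightarrow> nat \<Rightarrow> real" where
  "jacobi_coeff n a b k = Gamma (real n + a + 1) / (fact n * Gamma (a + 1)) *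
    (pochhammer (real n + a + b + 1) k * pochhammer (- real n) k / (pochhammer (a + 1) k * fact k))"

text \<open>In the variable \<open>(1 - x) / 2\<close>.\<close>

definition jacobi_poly :: "nat \<Rightarrow> real \<Rightarrow> real \<Rightarrow> real poly" where
  "jacobi_poly n a b = (\<Sum>k\<le>n. monom (jacobi_coeff n a b k) k)"

lemma jacobi_coeff_eq_0: "n < k \<Longrightarrow> jacobi_coeff n a b k = 0"
  by (simp add: jacobi_coeff_def pochhammer_of_nat_eq_0_lemma)

lemma coeff_jacobi_poly: "coeff (jacobi_poly n a b) k = jacobi_coeff n a b k"
  by (simp add: jacobi_poly_def coeff_sum jacobi_coeff_eq_0)

lemma jacobi_P_eq_poly: "jacobi_P n a b x = poly (jacobi_poly n a b) ((1 - x) / 2)"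
proof -
  let ?z = "(1 - x) / 2"
  let ?c = "\<lambda>k. pochhammer (real n + a + b + 1) k * pochhammer (- real n) k / (pochhammer (a + 1) k * fact k)"
  have "hyp2F1 (real n + a + b + 1) (- real n) (a + 1) ?z = (\<Sum>k. ?c k * ?z ^ k)"
    by (simp add: hyp2F1_def eval_fps_def)
  also have "\<dots> = (\<Sum>k\<le>n. ?c k * ?z ^ k)"
    by (rule suminf_finite) (auto simp: pochhammer_of_nat_eq_0_lemma)
  finally show ?thesis
    by (simp add: jacobi_P_def jacobi_poly_def poly_sum poly_monom jacobi_coeff_def sum_distrib_left mult.assoc)
qed

lemma jacobi_P_at_1: "jacobi_P n a b 1 = Gamma (real n + a + 1) / (fact n * Gamma (a + 1))"
  by (simp add: jacobi_P_eq_poly poly_0_coeff_0 coeff_jacobi_poly jacobi_coeff_def)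

lemma Gamma_nonzero: "- 1 < a \<Longrightarrow> Gamma (a + 1) \<noteq> (0 :: real)"
  using Gamma_real_pos[of "a + 1"] by (metis add.commute less_irrefl neg_less_iff_less minus_minus real_0_less_add_iff)

lemma jacobi_P_0: "- 1 < a \<Longrightarrow> jacobi_P 0 a b x = 1"
  by (simp add: jacobi_P_eq_poly jacobi_poly_def jacobi_coeff_def monom_0 Gamma_nonzero)

lemma jacobi_P_deriv:
  "(jacobi_P n a b has_real_derivative - (1/2) * poly (pderiv (jacobi_poly n a b)) ((1 - x) / 2)) (at x)"
proof -
  have "((\<lambda>x. poly (jacobi_poly n a b) ((1 - x) / 2)) has_real_derivative
      poly (pderiv (jacobi_poly n a b)) ((1 - x) / 2) * (- 1/2)) (at x)"
    by (rule DERIV_chain2[OF poly_DERIV]) (auto intro!: derivative_eq_intros)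
  then show ?thesis by (simp add: jacobi_P_eq_poly[abs_def] mult.commute)
qed

section \<open>First-order relations between the polynomials of case (I)\<close>

lemma jacobi_coeff_Suc:
  assumes "- 1 < a"
  shows "jacobi_coeff n a b (Suc k) * ((a + 1 + real k) * (real k + 1)) =
    jacobi_coeff n a b k * ((real n + a + b + 1 + real k) * (real k - real n))"
proof -
  have "pochhammer (a + 1) k \<noteq> 0" "a + 1 + real k \<noteq> 0"
    using assms pochhammer_pos[of "a + 1" k] by auto
  then show ?thesis
    by (simp add: jacobi_coeff_def pochhammer_Suc divide_simps)
qed

text \<open>Both parameter pairs have the same sum, so the numerators of the hypergeometric terms
  agree and only the Gamma quotients and the denominators \<open>pochhammer (c + 1) k\<close> and
  \<open>pochhammer c k\<close> have to be compared.\<close>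

lemma jacobi_coeff_contiguous:
  assumes "0 < c"
  shows "(c + real k) * jacobi_coeff n c (c - 1) k = (real n + c) * jacobi_coeff n (c - 1) c k"
proof -
  have p: "pochhammer c k \<noteq> 0" "pochhammer (c + 1) k \<noteq> 0"
    using assms pochhammer_pos[of c k] pochhammer_pos[of "c + 1" k] by auto
  have "c * pochhammer (c + 1) k = pochhammer c k * (c + real k)"
    using pochhammer_rec[of c k] pochhammer_Suc[of c k] by simp
  then have r: "(c + real k) / pochhammer (c + 1) k = c / pochhammer c k" using p by (simp add: field_simps)
  have G: "Gamma (c + 1) = c * Gamma c" "Gamma (real n + c + 1) = (real n + c) * Gamma (real n + c)"
    using assms by (auto intro!: Gamma_plus1 simp: nonpos_Ints_def)
  have e: "real n + (c - 1) + 1 = real n + c" "real n + (c - 1) + c + 1 = real n + c + (c - 1) + 1" by simp_all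
  have "(c + real k) * jacobi_coeff n c (c - 1) k =
      (real n + c) * (Gamma (real n + c) / (fact n * (c * Gamma c))) *
      (pochhammer (real n + c + (c - 1) + 1) k * pochhammer (- real n) k / fact k) * ((c + real k) / pochhammer (c + 1) k)"
    unfolding jacobi_coeff_def G by (simp add: divide_inverse mult_ac)
  also have "\<dots> = (real n + c) * jacobi_coeff n (c - 1) c k"
    unfolding r jacobi_coeff_def e using assms by simp
  finally show ?thesis .
qed

text \<open>In z = (1 - x)/2 this reads c Q + z Q' = (n + c) P, where P and Q are the polynomials in
  the two components of a mode (I); \<open>pCons 0\<close> is multiplication by z.\<close>

lemma jacobi_poly_relation_right:
  assumes "0 < c"
  shows "smult c (jacobi_poly n c (c - 1)) + pCons 0 (pderiv (jacobi_poly n c (c - 1))) =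
    smult (real n + c) (jacobi_poly n (c - 1) c)"
proof (rule poly_eqI)
  fix k
  show "coeff (smult c (jacobi_poly n c (c - 1)) + pCons 0 (pderiv (jacobi_poly n c (c - 1)))) k =
      coeff (smult (real n + c) (jacobi_poly n (c - 1) c)) k"
    using jacobi_coeff_contiguous[OF assms, of k n]
    by (cases k) (simp_all add: coeff_pCons coeff_pderiv coeff_jacobi_poly algebra_simps)
qed

text \<open>The companion relation c P - (1 - z) P' = (n + c) Q. After multiplication by c + k, the
  hypergeometric recursion turns the left coefficient into \<open>(n + c)\<^sup>2\<close> times that
  of P, because \<open>(c + k)\<^sup>2 - (n + 2 * c + k) * (k - n) = (n +
  c)\<^sup>2\<close>.\<close>

lemma jacobi_poly_relation_left:
  assumes "0 < c"
  shows "smult c (jacobi_poly n (c - 1) c) - pderiv (jacobi_poly n (c - 1) c) + pCons 0 (pderiv (jacobi_poly n (c - 1) c)) =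
    smult (real n + c) (jacobi_poly n c (c - 1))"
proof (rule poly_eqI)
  fix k
  let ?p = "jacobi_coeff n (c - 1) c"
  have ck: "c + real k \<noteq> 0" using assms by simp
  have "(c + real k) * ((c + real k) * ?p k - (real k + 1) * ?p (Suc k)) = (real n + c)\<^sup>2 * ?p k"
    using jacobi_coeff_Suc[of "c - 1" n c k] assms by (simp add: power2_eq_square algebra_simps)
  also have "\<dots> = (c + real k) * ((real n + c) * jacobi_coeff n c (c - 1) k)"
    using jacobi_coeff_contiguous[OF assms, of k n] by (simp add: power2_eq_square)
  finally have "(c + real k) * ?p k - (real k + 1) * ?p (Suc k) = (real n + c) * jacobi_coeff n c (c - 1) k"
    using ck by simp
  then show "coeff (smult c (jacobi_poly n (c - 1) c) - pderiv (jacobi_poly n (c - 1) c) + pCons 0 (pderiv (jacobi_poly n (c - 1) c))) k =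
      coeff (smult (real n + c) (jacobi_poly n c (c - 1))) k"
    by (cases k) (simp_all add: coeff_pCons coeff_pderiv coeff_jacobi_poly algebra_simps)
qed

section \<open>Derivative and differential equation for the polynomials of case (III)\<close>

lemma jacobi_coeff_shift:
  assumes "- 1 < a" "a + b + 1 = 0"
  shows "(real k + 1) * jacobi_coeff (Suc m) a b (Suc k) = - real (Suc m) * jacobi_coeff m (a + 1) (b + 1) k"
proof -
  have p: "pochhammer (a + 2) k \<noteq> 0" using assms pochhammer_pos[of "a + 2" k] by auto
  have G: "Gamma (a + 2) = (a + 1) * Gamma (a + 1)"
    using Gamma_plus1[of "a + 1"] assms by (auto simp: nonpos_Ints_def add.assoc)
  note G0 = Gamma_nonzero[OF assms(1)]
  have e: "real (Suc m) + a + b + 1 = real m + 1" "real m + (a + 1) + (b + 1) + 1 = real m + 2"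
    "real (Suc m) + a + 1 = real m + a + 2" "real m + (a + 1) + 1 = real m + a + 2" "a + 1 + 1 = a + 2"
    using assms(2) by simp_all
  have r: "pochhammer (real m + 1) (Suc k) = (real m + 1) * pochhammer (real m + 2) k"
    "pochhammer (- real (Suc m)) (Suc k) = - (real m + 1) * pochhammer (- real m) k"
    "pochhammer (a + 1) (Suc k) = (a + 1) * pochhammer (a + 2) k"
    by (simp_all add: pochhammer_rec add.assoc)
  show ?thesis
    unfolding jacobi_coeff_def e r G using p G0 assms(1)
    by (simp add: divide_simps) (simp add: algebra_simps)
qed

text \<open>The general factor n + a + b + 1 of the derivative formula reduces to n under the
  assumption on \<open>a\<close> and \<open>b\<close>; the sign comes from differentiating in (1 -
  x)/2.\<close>

lemma jacobi_poly_deriv: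
  assumes "- 1 < a" "a + b + 1 = 0"
  shows "pderiv (jacobi_poly (Suc m) a b) = smult (- real (Suc m)) (jacobi_poly m (a + 1) (b + 1))"
  using jacobi_coeff_shift[OF assms]
  by (intro poly_eqI) (simp add: coeff_pderiv coeff_jacobi_poly add.commute)

text \<open>The second-order Jacobi equation for the polynomial Q on the right, multiplied by a
  constant, with Q' replaced by - n p. In this way it becomes a first-order relation for p, as the
  radial system requires.\<close>

lemma jacobi_poly_ode:
  fixes m :: nat
  assumes a: "- 1 < a" "a + b + 1 = 0"
  defines "p \<equiv> jacobi_poly m (a + 1) (b + 1)"
  shows "smult (- 2 * (a + 1)) p + pCons 0 (smult 2 p) - pCons 0 (smult 2 (pderiv p)) + pCons 0 (pCons 0 (smult 2 (pderiv p))) =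
    smult (- 2 * real (Suc m)) (jacobi_poly (Suc m) a b)"
proof (rule poly_eqI)
  fix k
  let ?q = "jacobi_coeff (Suc m) a b" and ?n = "real (Suc m)"
  have p: "coeff p j = - (real j + 1) * ?q (Suc j) / ?n" for j
    using jacobi_coeff_shift[OF a, of j m] by (simp add: p_def coeff_jacobi_poly field_simps)
  have e: "?n + a + b + 1 + real j = ?n + real j" for j using a(2) by simp
  have rec: "?q (Suc j) * ((a + 1 + real j) * (real j + 1)) = ?q j * ((?n + real j) * (real j - ?n))" for j
    using jacobi_coeff_Suc[OF a(1), of "Suc m" b j] unfolding e .
  have n: "?n \<noteq> 0" by simp
  have main: "- 2 * (a + 1 + real k) * coeff p k - 2 * real k * (real k * ?q k / ?n) = - 2 * ?n * ?q k"
  proof -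
    have pn: "?n * coeff p k = - (real k + 1) * ?q (Suc k)" "?n * (real k * ?q k / ?n) = real k * ?q k"
      unfolding p using n by simp_all
    have "?n * (- 2 * (a + 1 + real k) * coeff p k - 2 * real k * (real k * ?q k / ?n)) =
        - 2 * (a + 1 + real k) * (?n * coeff p k) - 2 * real k * (?n * (real k * ?q k / ?n))"
      unfolding right_diff_distrib by (simp only: mult_ac)
    also have "\<dots> = 2 * (?q (Suc k) * ((a + 1 + real k) * (real k + 1))) - 2 * real k * real k * ?q k"
      unfolding pn by (simp add: algebra_simps)
    also have "\<dots> = ?n * (- 2 * ?n * ?q k)" unfolding rec by (simp add: algebra_simps)
    finally show ?thesis using n by (simp only: mult_cancel_left) blast
  qed
  show "coeff (smult (- 2 * (a + 1)) p + pCons 0 (smult 2 p) - pCons 0 (smult 2 (pderiv p)) + pCons 0 (pCons 0 (smult 2 (pderiv p)))) k =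
      coeff (smult (- 2 * real (Suc m)) (jacobi_poly (Suc m) a b)) k"
  proof (cases k)
    case 0
    then show ?thesis using main by (simp add: coeff_jacobi_poly)
  next
    case (Suc j)
    have "real k * ?q k / ?n = - coeff p j" unfolding p Suc by (simp add: divide_inverse algebra_simps)
    then have main': "- 2 * (a + 1 + real k) * coeff p k + 2 * real k * coeff p j = - 2 * ?n * ?q k" using main by simp
    show ?thesis
    proof (cases j)
      case 0
      then show ?thesis using main' Suc by (simp add: coeff_pCons coeff_pderiv coeff_jacobi_poly algebra_simps)
    next
      case (Suc i)
      then show ?thesis using main' \<open>k = Suc j\<close>
        by (simp add: coeff_pCons coeff_pderiv coeff_jacobi_poly algebra_simps)
    qed
  qed
qed

lemma jacobi_P_relations:
  assumes "0 < c"
  shows "(jacobi_P n c (c - 1) has_real_derivative D) (at x) \<Longrightarrow>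
      c * jacobi_P n c (c - 1) x - (1 - x) * D = (real n + c) * jacobi_P n (c - 1) c x"
    "(jacobi_P n (c - 1) c has_real_derivative D') (at x) \<Longrightarrow>
      c * jacobi_P n (c - 1) c x + (1 + x) * D' = (real n + c) * jacobi_P n c (c - 1) x"
proof -
  assume "(jacobi_P n c (c - 1) has_real_derivative D) (at x)"
  then have D: "D = - (1/2) * poly (pderiv (jacobi_poly n c (c - 1))) ((1 - x) / 2)"
    by (rule DERIV_unique[OF _ jacobi_P_deriv])
  show "c * jacobi_P n c (c - 1) x - (1 - x) * D = (real n + c) * jacobi_P n (c - 1) c x"
    using arg_cong[OF jacobi_poly_relation_right[OF assms, of n], of "\<lambda>p. poly p ((1 - x) / 2)"]
    unfolding jacobi_P_eq_poly D by (simp add: field_simps)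
next
  assume "(jacobi_P n (c - 1) c has_real_derivative D') (at x)"
  then have D: "D' = - (1/2) * poly (pderiv (jacobi_poly n (c - 1) c)) ((1 - x) / 2)"
    by (rule DERIV_unique[OF _ jacobi_P_deriv])
  show "c * jacobi_P n (c - 1) c x + (1 + x) * D' = (real n + c) * jacobi_P n c (c - 1) x"
    using arg_cong[OF jacobi_poly_relation_left[OF assms, of n], of "\<lambda>p. poly p ((1 - x) / 2)"]
    unfolding jacobi_P_eq_poly D by (simp add: field_simps)
qed

lemma jacobi_P_shift:
  assumes "- 1 < a" "a + b + 1 = 0"
  shows "(jacobi_P (Suc m) a b has_real_derivative real (Suc m) / 2 * jacobi_P m (a + 1) (b + 1) x) (at x)"
  using jacobi_P_deriv[of "Suc m" a b x] unfolding jacobi_poly_deriv[OF assms] jacobi_P_eq_poly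
  by (simp add: add_divide_distrib algebra_simps)

lemma jacobi_P_shift_back:
  assumes "- 1 < a" "a + b + 1 = 0" and "(jacobi_P m (a + 1) (b + 1) has_real_derivative D) (at x)"
  shows "(1 - x\<^sup>2) * D - (2 * a + 1 + x) * jacobi_P m (a + 1) (b + 1) x = - 2 * real (Suc m) * jacobi_P (Suc m) a b x"
proof -
  have D: "D = - (1/2) * poly (pderiv (jacobi_poly m (a + 1) (b + 1))) ((1 - x) / 2)"
    using assms(3) by (rule DERIV_unique[OF _ jacobi_P_deriv])
  show ?thesis
    using arg_cong[OF jacobi_poly_ode[OF assms(1,2), of m], of "\<lambda>p. poly p ((1 - x) / 2)"]
    unfolding jacobi_P_eq_poly D by (simp add: field_simps power2_eq_square)
qed


section \<open>Completeness of polynomials in the sine\<close>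

lemma set_integrable_mult_bounded:
  fixes h k :: "real \<Rightarrow> complex"
  assumes "continuous_on rho_interval h" "set_integrable lborel rho_interval h" "continuous_on rho_interval k"
    and "\<And>\<rho>. \<rho> \<in> rho_interval \<Longrightarrow> cmod (k \<rho>) \<le> B"
  shows "set_integrable lborel rho_interval (\<lambda>\<rho>. h \<rho> * k \<rho>)"
proof (rule set_integrable_bound)
  show "set_integrable lborel rho_interval (\<lambda>\<rho>. h \<rho> * of_real B)"
    using assms(2) by (rule set_integrable_mult_left)
  show "set_borel_measurable lborel rho_interval (\<lambda>\<rho>. h \<rho> * k \<rho>)"
    using borel_measurable_continuous_on_indicator[OF _ continuous_on_mult[OF assms(1,3)]]
    by (simp add: set_borel_measurable_def)
  show "AE \<rho> in lborel. \<rho> \<in> rho_interval \<longrightarrow> norm (h \<rho> * k \<rho>) \<le> norm (h \<rho> * complex_of_real B)"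
    using assms(4) by (intro AE_I2 impI) (auto simp: norm_mult intro!: mult_left_mono intro: order_trans[OF _ abs_ge_self])
qed

lemma half_one_minus_sin_mem: "(1 - sin \<rho>) / 2 \<in> {0..1::real}"
  using sin_le_one[of \<rho>] sin_ge_minus_one[of \<rho>] by simp

context
  fixes h :: "real \<Rightarrow> complex"
  assumes h: "continuous_on rho_interval h" "set_integrable lborel rho_interval h"
begin

lemma set_integrable_moment:
  fixes \<phi> :: "real \<Rightarrow> real"
  assumes \<phi>: "continuous_on {0..1} \<phi>"
  shows "set_integrable lborel rho_interval (\<lambda>\<rho>. h \<rho> * of_real (\<phi> ((1 - sin \<rho>) / 2)))"
proof -
  let ?z = "\<lambda>\<rho>::real. (1 - sin \<rho>) / 2"
  have zc: "continuous_on S ?z" for S by (intro continuous_intros) auto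
  have "compact (\<phi> ` {0..1})" using \<phi> by (intro compact_continuous_image) auto
  then obtain B where B: "\<And>x. x \<in> {0..1} \<Longrightarrow> norm (\<phi> x) \<le> B"
    using compact_imp_bounded bounded_iff by (metis image_eqI)
  show ?thesis
  proof (rule set_integrable_mult_bounded[OF h])
    show "continuous_on rho_interval (\<lambda>\<rho>. complex_of_real (\<phi> (?z \<rho>)))"
      by (intro continuous_on_of_real continuous_on_compose2[OF \<phi> zc]) (use half_one_minus_sin_mem in blast)
    show "cmod (complex_of_real (\<phi> (?z \<rho>))) \<le> B" for \<rho>
      using B[OF half_one_minus_sin_mem[of \<rho>]] by simp
  qed
qed

context
  fixes Q :: "nat \<Rightarrow> real poly"
  assumes Q: "\<And>n. degree (Q n) = n" "\<And>n. Q n \<noteq> 0"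
    and int: "\<And>n. (LINT \<rho>:rho_interval|lborel. h \<rho> * of_real (poly (Q n) ((1 - sin \<rho>) / 2))) = 0"
begin

text \<open>One polynomial of every degree suffices: a multiple of \<open>Q n\<close> with n the
  degree of p cancels the leading term.\<close>

lemma polynomial_moment_eq_0: "(LINT \<rho>:rho_interval|lborel. h \<rho> * of_real (poly p ((1 - sin \<rho>) / 2))) = 0"
proof (induction "degree p" arbitrary: p rule: less_induct)
  case less
  let ?z = "\<lambda>\<rho>::real. (1 - sin \<rho>) / 2"
  let ?I = "\<lambda>\<phi>. LINT \<rho>:rho_interval|lborel. h \<rho> * of_real (\<phi> (?z \<rho>))"
  show ?case
  proof (cases "p = 0")
    case False
    define n where "n = degree p"
    define c where "c = coeff p n / coeff (Q n) n"
    define q where "q = p - smult c (Q n)"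
    have lc: "coeff (Q n) n \<noteq> 0" using Q[of n] leading_coeff_0_iff[of "Q n"] by simp
    have "q = 0 \<or> degree q < n"
    proof -
      have "degree q \<le> n" unfolding q_def using Q(1)[of n] by (intro degree_diff_le) (auto simp: n_def)
      moreover have "coeff q n = 0" using lc by (simp add: q_def c_def)
      ultimately show ?thesis using leading_coeff_0_iff[of q] by (metis le_neq_implies_less)
    qed
    then have q0: "?I (poly q) = 0" using less[of q] by (auto simp: n_def)
    have "?I (poly p) = (LINT \<rho>:rho_interval|lborel. h \<rho> * of_real (poly q (?z \<rho>)) +
        of_real c * (h \<rho> * of_real (poly (Q n) (?z \<rho>))))"
      by (intro set_lebesgue_integral_cong) (auto simp: q_def algebra_simps)
    also have "\<dots> = ?I (poly q) + (LINT \<rho>:rho_interval|lborel. of_real c * (h \<rho> * of_real (poly (Q n) (?z \<rho>))))"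
      by (intro set_integral_add(2) set_integrable_mult_right set_integrable_moment continuous_on_poly continuous_on_id)
    also have "\<dots> = 0" using q0 int[of n] by simp
    finally show ?thesis .
  qed simp
qed

lemma continuous_moment_eq_0:
  fixes \<phi> :: "real \<Rightarrow> real"
  assumes \<phi>: "continuous_on {0..1} \<phi>"
  shows "(LINT \<rho>:rho_interval|lborel. h \<rho> * of_real (\<phi> ((1 - sin \<rho>) / 2))) = 0"
proof (rule ccontr)
  let ?z = "\<lambda>\<rho>::real. (1 - sin \<rho>) / 2"
  let ?I = "\<lambda>\<phi>. LINT \<rho>:rho_interval|lborel. h \<rho> * of_real (\<phi> (?z \<rho>))"
  assume nz: "?I \<phi> \<noteq> 0"
  define A where "A = (LINT \<rho>:rho_interval|lborel. norm (h \<rho>))"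
  have A0: "0 \<le> A" unfolding A_def set_lebesgue_integral_def by (intro Bochner_Integration.integral_nonneg) simp
  \<comment> \<open>Chosen so that \<open>e * A\<close> is smaller than the modulus of the moment;
    the summand 1 also covers \<open>A = 0\<close>.\<close>
  define e where "e = cmod (?I \<phi>) / (A + 1)"
  have e: "0 < e" using nz A0 by (simp add: e_def)
  obtain g where g: "real_polynomial_function g" "\<And>x. x \<in> {0..1} \<Longrightarrow> \<bar>\<phi> x - g x\<bar> < e"
    using Stone_Weierstrass_real_polynomial_function[OF compact_Icc \<phi> e] by blast
  then obtain a n where "g = (\<lambda>x. \<Sum>i\<le>n. a i * x ^ i)" unfolding real_polynomial_function_iff_sum by blast
  then have gp: "g = poly (\<Sum>i\<le>n. monom (a i) i)" by (simp add: fun_eq_iff poly_sum poly_monom)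
  have gc: "continuous_on {0..1} g" unfolding gp by (intro continuous_on_poly continuous_on_id)
  have "cmod (?I \<phi>) = cmod (LINT \<rho>:rho_interval|lborel. h \<rho> * of_real (\<phi> (?z \<rho>)) - h \<rho> * of_real (g (?z \<rho>)))"
    using set_integral_diff(2)[OF set_integrable_moment[OF \<phi>] set_integrable_moment[OF gc]] polynomial_moment_eq_0 gp by simp
  also have "\<dots> \<le> (LINT \<rho>:rho_interval|lborel. cmod (h \<rho> * of_real (\<phi> (?z \<rho>)) - h \<rho> * of_real (g (?z \<rho>))))"
    by (rule set_integral_norm_bound[OF set_integral_diff(1)[OF set_integrable_moment[OF \<phi>] set_integrable_moment[OF gc]]])
  also have "\<dots> \<le> (LINT \<rho>:rho_interval|lborel. e * norm (h \<rho>))"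
  proof (rule set_integral_mono)
    show "set_integrable lborel rho_interval (\<lambda>\<rho>. cmod (h \<rho> * of_real (\<phi> (?z \<rho>)) - h \<rho> * of_real (g (?z \<rho>))))"
      by (rule set_integrable_norm[OF set_integral_diff(1)[OF set_integrable_moment[OF \<phi>] set_integrable_moment[OF gc]]])
    show "set_integrable lborel rho_interval (\<lambda>\<rho>. e * norm (h \<rho>))"
      by (intro set_integrable_mult_right set_integrable_norm h(2))
    fix \<rho>
    have "cmod (h \<rho> * of_real (\<phi> (?z \<rho>)) - h \<rho> * of_real (g (?z \<rho>))) = cmod (h \<rho>) * \<bar>\<phi> (?z \<rho>) - g (?z \<rho>)\<bar>"
      by (simp add: norm_mult flip: right_diff_distrib of_real_diff)
    also have "\<dots> \<le> cmod (h \<rho>) * e" using g(2)[OF half_one_minus_sin_mem[of \<rho>]] by (intro mult_left_mono) auto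
    finally show "cmod (h \<rho> * of_real (\<phi> (?z \<rho>)) - h \<rho> * of_real (g (?z \<rho>))) \<le> e * norm (h \<rho>)"
      by (simp add: mult.commute)
  qed
  also have "\<dots> = e * A" by (simp add: A_def)
  finally have "cmod (?I \<phi>) \<le> e * A" .
  moreover have "cmod (?I \<phi>) = e * (A + 1)" using A0 by (simp add: e_def)
  ultimately show False using e by (simp add: algebra_simps)
qed

text \<open>Tested against \<open>cnj h\<close> times a cutoff that vanishes near \<open>\<plusminus>\<pi>/2\<close>, where \<open>h\<close> may be unbounded.\<close>

lemma moment_vanishing_imp_0:
  assumes \<rho>0: "\<rho>0 \<in> rho_interval"
  shows "h \<rho>0 = 0"
proof -
  let ?z = "\<lambda>\<rho>::real. (1 - sin \<rho>) / 2"
  \<comment> \<open>The midpoint of \<open>\<bar>sin \<rho>0\<bar>\<close> and 1: the cutoff is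
    positive at \<open>\<rho>0\<close> and vanishes near both ends.\<close>
  define y where "y = (1 + \<bar>sin \<rho>0\<bar>) / 2"
  have y: "0 < y" "y < 1" "\<bar>sin \<rho>0\<bar> < y"
    using sin_bounds_rho[OF \<rho>0] by (auto simp: y_def)
  \<comment> \<open>Clamping keeps the argument of \<open>h\<close> in a compact part of the
    interval, so the test function is continuous on all of \<open>{0..1}\<close>. Wherever clamping
    changes the argument, the cutoff \<open>b\<close> is zero.\<close>
  define cl where "cl x = max (- y) (min y x)" for x :: real
  have cl: "\<bar>cl x\<bar> \<le> y" for x using y by (auto simp: cl_def)
  define b where "b x = max 0 (y - \<bar>x\<bar>)" for x :: real
  define \<phi> where "\<phi> z = cnj (h (arcsin (cl (1 - 2 * z)))) * of_real (b (1 - 2 * z))" for z :: real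
  have "arcsin x \<in> rho_interval" if "\<bar>x\<bar> \<le> y" for x
    using arcsin_lt_bounded[of x] that y by auto
  moreover have "continuous_on {0..1} (\<lambda>z. arcsin (cl (1 - 2 * z)))"
    unfolding cl_def using y by (intro continuous_on_arcsin continuous_intros) auto
  ultimately have "continuous_on {0..1} (\<lambda>z. h (arcsin (cl (1 - 2 * z))))"
    using cl by (intro continuous_on_compose2[OF h(1)]) blast+
  then have \<phi>c: "continuous_on {0..1} \<phi>"
    unfolding \<phi>_def b_def by (intro continuous_intros)
  have \<phi>z: "\<phi> (?z \<rho>) = cnj (h \<rho>) * of_real (b (sin \<rho>))" if \<rho>: "\<rho> \<in> rho_interval" for \<rho>
  proof -
    have x: "1 - 2 * ?z \<rho> = sin \<rho>" by (simp add: field_simps)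
    show ?thesis
    proof (cases "\<bar>sin \<rho>\<bar> < y")
      case True
      have "cl (sin \<rho>) = sin \<rho>" using True by (auto simp: cl_def)
      moreover have "arcsin (sin \<rho>) = \<rho>" using \<rho> by (intro arcsin_sin) auto
      ultimately show ?thesis unfolding \<phi>_def x by simp
    next
      case False
      then show ?thesis unfolding \<phi>_def x by (simp add: b_def)
    qed
  qed
  have re: "continuous_on {0..1} (\<lambda>z. Re (\<phi> z))" and im: "continuous_on {0..1} (\<lambda>z. Im (\<phi> z))"
    using \<phi>c by (auto intro!: continuous_intros)
  let ?g = "\<lambda>\<rho>. (cmod (h \<rho>))\<^sup>2 * b (sin \<rho>)"
  \<comment> \<open>Moments are known to vanish for real test functions, so the real and imaginary
    parts of \<phi> are used separately.\<close>
  let ?G = "\<lambda>\<rho>. h \<rho> * of_real (Re (\<phi> (?z \<rho>))) + \<i> * (h \<rho> * of_real (Im (\<phi> (?z \<rho>))))"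
  have Gg: "?G \<rho> = of_real (?g \<rho>)" if \<rho>: "\<rho> \<in> rho_interval" for \<rho>
  proof -
    have "?G \<rho> = h \<rho> * \<phi> (?z \<rho>)"
      by (subst (3) complex_eq) (simp add: algebra_simps)
    also have "\<dots> = of_real (?g \<rho>)"
      unfolding \<phi>z[OF \<rho>] by (simp add: complex_norm_square[symmetric] mult.assoc[symmetric] del: of_real_power)
    finally show ?thesis .
  qed
  have iG: "set_integrable lborel rho_interval ?G"
    by (intro set_integral_add(1) set_integrable_mult_right set_integrable_moment re im)
  have "(LINT \<rho>:rho_interval|lborel. ?G \<rho>) = 0"
    using set_integral_add(2)[OF set_integrable_moment[OF re] set_integrable_mult_right[OF set_integrable_moment[OF im], of \<i>]] continuous_moment_eq_0[OF re] continuous_moment_eq_0[OF im] by simp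
  then have "(LINT \<rho>:rho_interval|lborel. complex_of_real (?g \<rho>)) = 0"
    using set_lebesgue_integral_cong[of rho_interval lborel ?G "\<lambda>\<rho>. complex_of_real (?g \<rho>)"] Gg by simp
  then have int0: "(LINT \<rho>:rho_interval|lborel. ?g \<rho>) = 0"
    by (simp only: set_integral_complex_of_real of_real_eq_0_iff)
  have "set_integrable lborel rho_interval (\<lambda>\<rho>. Re (?G \<rho>))"
    using integrable_Re[OF iG[unfolded set_integrable_def]] by (simp add: set_integrable_def)
  also have "?this \<longleftrightarrow> set_integrable lborel rho_interval ?g"
    by (intro set_integrable_cong refl) (simp only: Gg Re_complex_of_real)
  finally have ig: "set_integrable lborel rho_interval ?g" .
  have cg: "continuous_on rho_interval ?g"
    unfolding b_def by (intro continuous_intros h(1))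
  have "?g \<rho>0 = 0"
    by (rule continuous_integral_eq_0[OF cg ig _ int0 \<rho>0]) (simp add: b_def)
  then show ?thesis using y(3) by (simp add: b_def)
qed

end

end

section \<open>Spinors given by their rescaled components\<close>

definition mk_spinor :: "real \<Rightarrow> (real \<Rightarrow> real) \<Rightarrow> (real \<Rightarrow> real) \<Rightarrow> real \<Rightarrow> complex^2" where
  "mk_spinor M f g \<rho> = real_spinor (sigma \<rho> powr M * f \<rho>) (sigma \<rho> powr (- M) * g \<rho>)"

lemma tilde_mk_spinor:
  assumes "\<rho> \<in> rho_interval"
  shows "tilde 1 M (mk_spinor M f g) \<rho> = of_real (f \<rho>)" "tilde 2 M (mk_spinor M f g) \<rho> = of_real (g \<rho>)"
  using sigma_powr_cancel[OF assms, of M]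
  by (simp_all add: tilde_def mk_spinor_def real_spinor_def mult.assoc[symmetric] flip: of_real_mult)

lemma mk_spinor_solution:
  assumes "\<And>\<rho>. \<rho> \<in> rho_interval \<Longrightarrow> (f has_real_derivative \<omega> * sigma \<rho> powr (- 2 * M) * g \<rho>) (at \<rho>)"
    and "\<And>\<rho>. \<rho> \<in> rho_interval \<Longrightarrow> (g has_real_derivative - \<omega> * sigma \<rho> powr (2 * M) * f \<rho>) (at \<rho>)"
  shows "radial_solution M \<omega> (mk_spinor M f g)"
proof (rule radial_solutionI)
  fix \<rho> assume \<rho>: "\<rho> \<in> rho_interval"
  have p: "sigma \<rho> powr (- 2 * M) * sigma \<rho> powr M = sigma \<rho> powr (- M)"
    "sigma \<rho> powr (2 * M) * sigma \<rho> powr (- M) = sigma \<rho> powr M"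
    by (simp_all flip: powr_add)
  have "((\<lambda>r. sigma r powr M * f r) has_real_derivative
      - M / cos \<rho> * sigma \<rho> powr M * f \<rho> + \<omega> * (sigma \<rho> powr (- 2 * M) * sigma \<rho> powr M) * g \<rho>) (at \<rho>)"
    using DERIV_mult[OF has_real_derivative_sigma_powr[OF \<rho>, of M] assms(1)[OF \<rho>]] by (simp add: algebra_simps)
  from has_vector_derivative_of_real[OF this, where ?'a = complex]
  show "((\<lambda>r. mk_spinor M f g r $ 1) has_vector_derivative
      of_real \<omega> * mk_spinor M f g \<rho> $ 2 - of_real (M / cos \<rho>) * mk_spinor M f g \<rho> $ 1) (at \<rho>)"
    unfolding p by (simp add: mk_spinor_def real_spinor_def algebra_simps)
  have "((\<lambda>r. sigma r powr (- M) * g r) has_real_derivative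
      M / cos \<rho> * sigma \<rho> powr (- M) * g \<rho> - \<omega> * (sigma \<rho> powr (2 * M) * sigma \<rho> powr (- M)) * f \<rho>) (at \<rho>)"
    using DERIV_mult[OF has_real_derivative_sigma_powr[OF \<rho>, of "- M"] assms(2)[OF \<rho>]] by (simp add: algebra_simps)
  from has_vector_derivative_of_real[OF this, where ?'a = complex]
  show "((\<lambda>r. mk_spinor M f g r $ 2) has_vector_derivative
      of_real (M / cos \<rho>) * mk_spinor M f g \<rho> $ 2 - of_real \<omega> * mk_spinor M f g \<rho> $ 1) (at \<rho>)"
    unfolding p by (simp add: mk_spinor_def real_spinor_def algebra_simps)
qed

lemma tilde_mk_spinor_tendsto:
  assumes F: "F = at_left (pi/2) \<or> F = at_right (- pi/2)"
  shows "(f \<longlongrightarrow> x) F \<Longrightarrow> (tilde 1 M (mk_spinor M f g) \<longlongrightarrow> of_real x) F"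
    "(g \<longlongrightarrow> y) F \<Longrightarrow> (tilde 2 M (mk_spinor M f g) \<longlongrightarrow> of_real y) F"
proof -
  have ev: "\<forall>\<^sub>F \<rho> in F. \<rho> \<in> rho_interval" using F eventually_rho_left eventually_rho_right by auto
  show "(tilde 1 M (mk_spinor M f g) \<longlongrightarrow> of_real x) F" if "(f \<longlongrightarrow> x) F"
    using tendsto_of_real[OF that]
    by (rule Lim_transform_eventually) (use ev in \<open>eventually_elim, simp only: tilde_mk_spinor\<close>)
  show "(tilde 2 M (mk_spinor M f g) \<longlongrightarrow> of_real y) F" if "(g \<longlongrightarrow> y) F"
    using tendsto_of_real[OF that]
    by (rule Lim_transform_eventually) (use ev in \<open>eventually_elim, simp only: tilde_mk_spinor\<close>)
qed

section \<open>Rescaled components of the modes\<close>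

lemma isCont_jacobi_P [continuous_intros]: "isCont (jacobi_P n a b) x"
  using jacobi_P_deriv by (rule DERIV_isCont)

lemma continuous_on_jacobi_P_sin: "continuous_on S (\<lambda>\<rho>. jacobi_P n a b (sin \<rho>))"
  using isCont_jacobi_P
  by (intro continuous_on_compose2[OF continuous_at_imp_continuous_on continuous_on_sin]) (auto intro: continuous_intros)

text \<open>The stated prefactor of the first component, divided by \<sigma>^M, combines to the
  single power 1/2 + M of 1 + sin \<rho>, which is continuous everywhere and vanishes at -
  \<pi>/2.\<close>

definition mode_I_1 :: "real \<Rightarrow> nat \<Rightarrow> real \<Rightarrow> real" where
  "mode_I_1 M n \<rho> = (1 + sin \<rho>) powr (1/2 + M) * jacobi_P n (- 1/2 + M) (1/2 + M) (sin \<rho>)"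

definition mode_I_2 :: "real \<Rightarrow> nat \<Rightarrow> real \<Rightarrow> real" where
  "mode_I_2 M n \<rho> = (1 - sin \<rho>) powr (1/2 + M) * jacobi_P n (1/2 + M) (- 1/2 + M) (sin \<rho>)"

text \<open>The zero-frequency mode has no first component; without the case distinction
  \<open>n - 1\<close> would be truncated to 0 and give a non-zero function.\<close>

definition mode_III_1 :: "real \<Rightarrow> nat \<Rightarrow> real \<Rightarrow> real" where
  "mode_III_1 M n \<rho> = (if n = 0 then 0 else
    (1 - sin \<rho>) powr (1/2 - M) * (1 + sin \<rho>) powr (1/2 + M) * jacobi_P (n - 1) (1/2 - M) (1/2 + M) (sin \<rho>))"

definition mode_III_2 :: "real \<Rightarrow> nat \<Rightarrow> real \<Rightarrow> real" where
  "mode_III_2 M n \<rho> = - 2 * jacobi_P n (- 1/2 - M) (- 1/2 + M) (sin \<rho>)"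

lemma DERIV_powr_sin:
  assumes "\<rho> \<in> rho_interval"
  shows "((\<lambda>r. (1 + sin r) powr a) has_real_derivative a * (1 + sin \<rho>) powr (a - 1) * cos \<rho>) (at \<rho>)"
    "((\<lambda>r. (1 - sin r) powr a) has_real_derivative - a * (1 - sin \<rho>) powr (a - 1) * cos \<rho>) (at \<rho>)"
proof -
  have "((\<lambda>r. (1 + sin r) powr a) has_real_derivative a * (1 + sin \<rho>) powr (a - of_nat 1) * cos \<rho>) (at \<rho>)"
    using sin_bounds_rho[OF assms] by (intro DERIV_fun_powr) (auto intro!: derivative_eq_intros)
  moreover have "((\<lambda>r. (1 - sin r) powr a) has_real_derivative a * (1 - sin \<rho>) powr (a - of_nat 1) * - cos \<rho>) (at \<rho>)"
    using sin_bounds_rho[OF assms] by (intro DERIV_fun_powr) (auto intro!: derivative_eq_intros)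
  ultimately show "((\<lambda>r. (1 + sin r) powr a) has_real_derivative a * (1 + sin \<rho>) powr (a - 1) * cos \<rho>) (at \<rho>)"
    "((\<lambda>r. (1 - sin r) powr a) has_real_derivative - a * (1 - sin \<rho>) powr (a - 1) * cos \<rho>) (at \<rho>)"
    by simp_all
qed

lemma DERIV_jacobi_P_sin:
  assumes "(jacobi_P n a b has_real_derivative D) (at (sin \<rho>))"
  shows "((\<lambda>r. jacobi_P n a b (sin r)) has_real_derivative D * cos \<rho>) (at \<rho>)"
  by (rule DERIV_chain2[where f = "jacobi_P n a b" and g = sin, OF assms DERIV_sin])

lemma powr_pred: "0 < x \<Longrightarrow> x * x powr (a - 1) = x powr a" for x a :: real
  by (simp add: powr_mult_base)

text \<open>After the product rule each derivative contains the left side of one of the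
  \<open>jacobi_P_relations\<close> with \<open>c = 1/2 + M\<close>. The remaining powers of 1 + sin
  \<rho> and 1 - sin \<rho> combine with \<open>cos \<rho>\<close> to the weight times the prefactor
  of the other component.\<close>

lemma mode_I_deriv:
  assumes M: "\<bar>M\<bar> < 1/2" and \<rho>: "\<rho> \<in> rho_interval"
  shows "(mode_I_1 M n has_real_derivative omega_I M n * sigma \<rho> powr (- 2 * M) * mode_I_2 M n \<rho>) (at \<rho>)"
    "(mode_I_2 M n has_real_derivative - omega_I M n * sigma \<rho> powr (2 * M) * mode_I_1 M n \<rho>) (at \<rho>)"
proof -
  define c where "c = 1/2 + M"
  have c: "0 < c" and c1: "- 1/2 + M = c - 1" "1/2 + M = c" using M by (auto simp: c_def)
  have pos: "0 < 1 + sin \<rho>" "0 < 1 - sin \<rho>" using sin_bounds_rho[OF \<rho>] by auto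
  let ?x = "sin \<rho>"
  let ?P = "jacobi_P n (c - 1) c" and ?Q = "jacobi_P n c (c - 1)"
  obtain D D' where D: "(?P has_real_derivative D) (at ?x)" "(?Q has_real_derivative D') (at ?x)"
    using jacobi_P_deriv by blast
  have om: "omega_I M n = real n + c" by (simp add: omega_I_def c_def)
  have "(mode_I_1 M n has_real_derivative
      (1 + ?x) powr c * (D * cos \<rho>) + c * (1 + ?x) powr (c - 1) * cos \<rho> * ?P ?x) (at \<rho>)"
    unfolding mode_I_1_def[abs_def] c1
    using DERIV_mult[OF DERIV_powr_sin(1)[OF \<rho>, of c] DERIV_jacobi_P_sin[OF D(1)]] by (simp add: algebra_simps)
  also have "(1 + ?x) powr c * (D * cos \<rho>) + c * (1 + ?x) powr (c - 1) * cos \<rho> * ?P ?x =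
      cos \<rho> * (1 + ?x) powr (c - 1) * (c * ?P ?x + (1 + ?x) * D)"
    unfolding powr_pred[OF pos(1), of c, symmetric] by (simp add: algebra_simps)
  also have "\<dots> = omega_I M n * (cos \<rho> * (1 + ?x) powr (c - 1)) * ?Q ?x"
    unfolding jacobi_P_relations(2)[OF c D(1)] om by simp
  also have "cos \<rho> * (1 + ?x) powr (c - 1) = sigma \<rho> powr (- 2 * M) * (1 - ?x) powr c"
    unfolding sigma_powr[OF \<rho>] cos_eq_powr_sin[OF \<rho>] c_def
    by (simp add: mult_ac flip: powr_add)
  finally show "(mode_I_1 M n has_real_derivative omega_I M n * sigma \<rho> powr (- 2 * M) * mode_I_2 M n \<rho>) (at \<rho>)"
    unfolding mode_I_2_def c1 by (simp only: mult.assoc)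
  have "(mode_I_2 M n has_real_derivative
      (1 - ?x) powr c * (D' * cos \<rho>) + - c * (1 - ?x) powr (c - 1) * cos \<rho> * ?Q ?x) (at \<rho>)"
    unfolding mode_I_2_def[abs_def] c1
    using DERIV_mult[OF DERIV_powr_sin(2)[OF \<rho>, of c] DERIV_jacobi_P_sin[OF D(2)]] by (simp add: algebra_simps)
  also have "(1 - ?x) powr c * (D' * cos \<rho>) + - c * (1 - ?x) powr (c - 1) * cos \<rho> * ?Q ?x =
      - (cos \<rho> * (1 - ?x) powr (c - 1)) * (c * ?Q ?x - (1 - ?x) * D')"
    unfolding powr_pred[OF pos(2), of c, symmetric] by (simp add: algebra_simps)
  also have "\<dots> = - omega_I M n * (cos \<rho> * (1 - ?x) powr (c - 1)) * ?P ?x"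
    unfolding jacobi_P_relations(1)[OF c D(2)] om by (simp add: algebra_simps)
  also have "cos \<rho> * (1 - ?x) powr (c - 1) = sigma \<rho> powr (2 * M) * (1 + ?x) powr c"
    unfolding sigma_powr[OF \<rho>] cos_eq_powr_sin[OF \<rho>] c_def
    by (simp add: mult_ac flip: powr_add)
  finally show "(mode_I_2 M n has_real_derivative - omega_I M n * sigma \<rho> powr (2 * M) * mode_I_1 M n \<rho>) (at \<rho>)"
    unfolding mode_I_1_def c1 by (simp only: mult.assoc)
qed

text \<open>The first equation is the Jacobi differential equation in the form
  \<open>jacobi_P_shift_back\<close>, the second the derivative formula
  \<open>jacobi_P_shift\<close>. For \<open>n = 0\<close> both components are constant.\<close>

lemma mode_III_deriv:
  assumes M: "\<bar>M\<bar> < 1/2" and \<rho>: "\<rho> \<in> rho_interval"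
  shows "(mode_III_1 M n has_real_derivative real n * sigma \<rho> powr (- 2 * M) * mode_III_2 M n \<rho>) (at \<rho>)"
    "(mode_III_2 M n has_real_derivative - real n * sigma \<rho> powr (2 * M) * mode_III_1 M n \<rho>) (at \<rho>)"
proof -
  have a: "- 1 < - 1/2 - M" "(- 1/2 - M) + (- 1/2 + M) + 1 = 0" "(- 1/2 - M) + 1 = 1/2 - M" "(- 1/2 + M) + 1 = 1/2 + M"
    using M by auto
  have pos: "0 < 1 + sin \<rho>" "0 < 1 - sin \<rho>" using sin_bounds_rho[OF \<rho>] by auto
  let ?x = "sin \<rho>"
  show "(mode_III_1 M n has_real_derivative real n * sigma \<rho> powr (- 2 * M) * mode_III_2 M n \<rho>) (at \<rho>)"
  proof (cases n)
    case 0
    then show ?thesis by (simp add: mode_III_1_def[abs_def])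
  next
    case (Suc m)
    let ?P = "jacobi_P m (1/2 - M) (1/2 + M)" and ?Q = "jacobi_P n (- 1/2 - M) (- 1/2 + M)"
    define A where "A = (1 - ?x) powr (1/2 - M - 1) * (1 + ?x) powr (1/2 + M - 1)"
    obtain D where D: "(?P has_real_derivative D) (at ?x)" using jacobi_P_deriv by blast
    have rel: "(1 - ?x\<^sup>2) * D + (2 * M - ?x) * ?P ?x = - 2 * real n * ?Q ?x"
      using jacobi_P_shift_back[OF a(1,2), of m D ?x] D unfolding a(3,4) Suc by (simp add: algebra_simps)
    have pw: "(1 - ?x) powr (1/2 - M) = (1 - ?x) * (1 - ?x) powr (1/2 - M - 1)"
      "(1 + ?x) powr (1/2 + M) = (1 + ?x) * (1 + ?x) powr (1/2 + M - 1)"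
      by (simp_all only: powr_pred[OF pos(1)] powr_pred[OF pos(2)])
    have "(mode_III_1 M n has_real_derivative
        (1 - ?x) powr (1/2 - M) * (1 + ?x) powr (1/2 + M) * (D * cos \<rho>) +
        ((1 - ?x) powr (1/2 - M) * ((1/2 + M) * (1 + ?x) powr (1/2 + M - 1) * cos \<rho>) +
         (- (1/2 - M) * (1 - ?x) powr (1/2 - M - 1) * cos \<rho>) * (1 + ?x) powr (1/2 + M)) * ?P ?x) (at \<rho>)"
      using DERIV_mult[OF DERIV_mult[OF DERIV_powr_sin(2)[OF \<rho>, of "1/2 - M"] DERIV_powr_sin(1)[OF \<rho>, of "1/2 + M"]]
          DERIV_jacobi_P_sin[OF D]]
      unfolding mode_III_1_def[abs_def] using Suc by (simp add: add.commute mult.commute)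
    also have "(1 - ?x) powr (1/2 - M) * (1 + ?x) powr (1/2 + M) * (D * cos \<rho>) +
        ((1 - ?x) powr (1/2 - M) * ((1/2 + M) * (1 + ?x) powr (1/2 + M - 1) * cos \<rho>) +
         (- (1/2 - M) * (1 - ?x) powr (1/2 - M - 1) * cos \<rho>) * (1 + ?x) powr (1/2 + M)) * ?P ?x =
        (cos \<rho> * A) * ((1 - ?x\<^sup>2) * D + (2 * M - ?x) * ?P ?x)"
      unfolding pw A_def by (simp add: field_simps power2_eq_square)
    also have "cos \<rho> * A = sigma \<rho> powr (- 2 * M)"
    proof -
      have "(1 - ?x) powr (1/2) * (1 - ?x) powr (1/2 - M - 1) = (1 - ?x) powr (- M)"
        "(1 + ?x) powr (1/2) * (1 + ?x) powr (1/2 + M - 1) = (1 + ?x) powr M"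
        by (simp_all flip: powr_add)
      moreover have "cos \<rho> * A = ((1 - ?x) powr (1/2) * (1 - ?x) powr (1/2 - M - 1)) *
          ((1 + ?x) powr (1/2) * (1 + ?x) powr (1/2 + M - 1))"
        unfolding A_def cos_eq_powr_sin[OF \<rho>] by (simp only: mult_ac)
      ultimately show ?thesis by (simp add: sigma_powr[OF \<rho>])
    qed
    finally show ?thesis unfolding rel by (simp add: mode_III_2_def algebra_simps)
  qed
  show "(mode_III_2 M n has_real_derivative - real n * sigma \<rho> powr (2 * M) * mode_III_1 M n \<rho>) (at \<rho>)"
  proof (cases n)
    case 0
    then show ?thesis using a(1) by (simp add: mode_III_2_def[abs_def] jacobi_P_0)
  next
    case (Suc m)
    have p: "sigma \<rho> powr (2 * M) * ((1 - ?x) powr (1/2 - M) * (1 + ?x) powr (1/2 + M)) = cos \<rho>"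
      unfolding sigma_powr[OF \<rho>] cos_eq_powr_sin[OF \<rho>]
      by (simp add: mult_ac flip: powr_add)
    have "(mode_III_2 M n has_real_derivative - 2 * (real n / 2 * jacobi_P m (1/2 - M) (1/2 + M) ?x * cos \<rho>)) (at \<rho>)"
      unfolding mode_III_2_def[abs_def]
      using DERIV_cmult[OF DERIV_jacobi_P_sin[OF jacobi_P_shift[OF a(1,2), of m ?x]], of "- 2"]
      unfolding a(3,4) Suc by simp
    also have "- 2 * (real n / 2 * jacobi_P m (1/2 - M) (1/2 + M) ?x * cos \<rho>) =
        - real n * (cos \<rho> * jacobi_P m (1/2 - M) (1/2 + M) ?x)" by simp
    also have "\<dots> = - real n * sigma \<rho> powr (2 * M) * mode_III_1 M n \<rho>"
      unfolding p[symmetric] using Suc by (simp add: mode_III_1_def algebra_simps)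
    finally show ?thesis .
  qed
qed

text \<open>Negating the second component negates the frequency, so modes of opposite frequency
  share the same pair of functions.\<close>

lemma mk_spinor_sign_solution:
  assumes "\<And>\<rho>. \<rho> \<in> rho_interval \<Longrightarrow> (f has_real_derivative \<omega> * sigma \<rho> powr (- 2 * M) * g \<rho>) (at \<rho>)"
    and "\<And>\<rho>. \<rho> \<in> rho_interval \<Longrightarrow> (g has_real_derivative - \<omega> * sigma \<rho> powr (2 * M) * f \<rho>) (at \<rho>)"
    and s: "s = 1 \<or> s = - 1"
  shows "radial_solution M (s * \<omega>) (mk_spinor M f (\<lambda>\<rho>. s * g \<rho>))"
proof (rule mk_spinor_solution)
  fix \<rho> assume \<rho>: "\<rho> \<in> rho_interval"
  show "(f has_real_derivative s * \<omega> * sigma \<rho> powr (- 2 * M) * (s * g \<rho>)) (at \<rho>)"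
    using assms(1)[OF \<rho>] s by auto
  show "((\<lambda>\<rho>. s * g \<rho>) has_real_derivative - (s * \<omega>) * sigma \<rho> powr (2 * M) * f \<rho>) (at \<rho>)"
    using DERIV_cmult[OF assms(2)[OF \<rho>], of s] by (simp add: mult.assoc)
qed

lemma continuous_mode:
  assumes "\<bar>M\<bar> < 1/2"
  shows "isCont (mode_I_1 M n) \<rho>" "isCont (mode_I_2 M n) \<rho>" "isCont (mode_III_1 M n) \<rho>" "isCont (mode_III_2 M n) \<rho>"
proof -
  have p: "continuous_on UNIV (\<lambda>r::real. (1 + sin r) powr a)" "continuous_on UNIV (\<lambda>r::real. (1 - sin r) powr a)"
    if "0 < a" for a
    using that sin_ge_minus_one
    by (intro continuous_on_powr'; auto intro!: continuous_intros simp: add.commute[of 1] simp flip: diff_le_eq)+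
  have a: "0 < 1/2 + M" "0 < 1/2 - M" using assms by auto
  have "continuous_on UNIV (mode_I_1 M n)" "continuous_on UNIV (mode_I_2 M n)"
    unfolding mode_I_1_def[abs_def] mode_I_2_def[abs_def]
    by (intro continuous_on_mult p a continuous_on_jacobi_P_sin)+
  moreover have "continuous_on UNIV (mode_III_1 M n)"
  proof (cases "n = 0")
    case True
    then show ?thesis by (simp add: mode_III_1_def[abs_def])
  next
    case False
    have "continuous_on UNIV (\<lambda>\<rho>. (1 - sin \<rho>) powr (1/2 - M) * (1 + sin \<rho>) powr (1/2 + M) *
        jacobi_P (n - 1) (1/2 - M) (1/2 + M) (sin \<rho>))"
      by (intro continuous_on_mult p a continuous_on_jacobi_P_sin)
    then show ?thesis by (simp only: mode_III_1_def[abs_def] False if_False)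
  qed
  moreover have "continuous_on UNIV (mode_III_2 M n)"
    unfolding mode_III_2_def[abs_def] by (intro continuous_on_mult continuous_on_const continuous_on_jacobi_P_sin)
  ultimately show "isCont (mode_I_1 M n) \<rho>" "isCont (mode_I_2 M n) \<rho>" "isCont (mode_III_1 M n) \<rho>" "isCont (mode_III_2 M n) \<rho>"
    by (simp_all add: continuous_on_eq_continuous_at)
qed

definition radial_I :: "real \<Rightarrow> real \<Rightarrow> nat \<Rightarrow> real \<Rightarrow> complex^2" where
  "radial_I M s n = mk_spinor M (mode_I_1 M n) (\<lambda>\<rho>. s * mode_I_2 M n \<rho>)"

definition radial_III :: "real \<Rightarrow> real \<Rightarrow> nat \<Rightarrow> real \<Rightarrow> complex^2" where
  "radial_III M s n = mk_spinor M (mode_III_1 M n) (\<lambda>\<rho>. s * mode_III_2 M n \<rho>)"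

lemma bvp_radial_I:
  assumes M: "\<bar>M\<bar> < 1/2" and s: "s = 1 \<or> s = - 1"
  shows "bvp_solution M (bc_gen 1 2) (s * omega_I M n) (radial_I M s n)"
proof -
  have "radial_solution M (s * omega_I M n) (radial_I M s n)"
    unfolding radial_I_def by (rule mk_spinor_sign_solution[OF mode_I_deriv[OF M] s])
  moreover have "mode_I_1 M n (- pi/2) = 0" "s * mode_I_2 M n (pi/2) = 0"
    using M by (simp_all add: mode_I_1_def mode_I_2_def)
  then have "(mode_I_1 M n \<longlongrightarrow> 0) (at_right (- pi/2))" "((\<lambda>\<rho>. s * mode_I_2 M n \<rho>) \<longlongrightarrow> 0) (at_left (pi/2))"
    using isCont_imp_tendsto_at_right[OF continuous_mode(1)[OF M], of n "- pi/2"]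
      tendsto_mult_left[OF isCont_imp_tendsto_at_left[OF continuous_mode(2)[OF M], of n "pi/2"], of s] by auto
  then have "bc_gen 1 2 M (radial_I M s n)"
    unfolding bc_gen_def zero_left_def zero_right_def radial_I_def
    using tilde_mk_spinor_tendsto(1)[of "at_right (- pi/2)" _ 0] tilde_mk_spinor_tendsto(2)[of "at_left (pi/2)" _ 0] by auto
  ultimately show ?thesis by (simp add: bvp_solution_def)
qed

lemma bvp_radial_III:
  assumes M: "\<bar>M\<bar> < 1/2" and s: "s = 1 \<or> s = - 1"
  shows "bvp_solution M (bc_gen 1 1) (s * real n) (radial_III M s n)"
proof -
  have "radial_solution M (s * real n) (radial_III M s n)"
    unfolding radial_III_def by (rule mk_spinor_sign_solution[OF mode_III_deriv[OF M] s])
  moreover have "mode_III_1 M n (- pi/2) = 0" "mode_III_1 M n (pi/2) = 0"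
    using M by (simp_all add: mode_III_1_def)
  then have "(mode_III_1 M n \<longlongrightarrow> 0) (at_right (- pi/2))" "(mode_III_1 M n \<longlongrightarrow> 0) (at_left (pi/2))"
    using isCont_imp_tendsto_at_right[OF continuous_mode(3)[OF M], of n "- pi/2"]
      isCont_imp_tendsto_at_left[OF continuous_mode(3)[OF M], of n "pi/2"] by auto
  then have "bc_gen 1 1 M (radial_III M s n)"
    unfolding bc_gen_def zero_left_def zero_right_def radial_III_def
    using tilde_mk_spinor_tendsto(1)[of "at_right (- pi/2)" _ 0] tilde_mk_spinor_tendsto(1)[of "at_left (pi/2)" _ 0] by auto
  ultimately show ?thesis by (simp add: bvp_solution_def)
qed

section \<open>Normalization\<close>

lemma radial_norm_sq_scale: "radial_norm_sq (\<lambda>\<rho>. a *s \<Phi> \<rho>) = (cmod a)\<^sup>2 * radial_norm_sq \<Phi>"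
  by (simp add: radial_norm_sq_def norm_mult power_mult_distrib flip: distrib_left)

lemma radial_norm_sq_cong:
  "(\<And>\<rho>. \<rho> \<in> rho_interval \<Longrightarrow> \<Phi> \<rho> = \<Psi> \<rho>) \<Longrightarrow> radial_norm_sq \<Phi> = radial_norm_sq \<Psi>"
  unfolding radial_norm_sq_def by (intro set_lebesgue_integral_cong) auto

text \<open>By uniqueness the raised solution is a multiple of \<open>\<Phi>'\<close>, and the factor is read off at \<open>\<pi>/2\<close>.\<close>

lemma norm_recursion:
  assumes M: "\<bar>M\<bar> < 1/2"
    and sol: "bvp_solution M (bc_gen l r) \<omega> \<Phi>" "bvp_solution M (bc_gen l r) (\<omega> + 1) \<Phi>'"
    and nz: "nonzero_spinor \<Phi>'"
    and lim: "(tilde j M \<Phi> \<longlongrightarrow> of_real x) (at_left (pi/2))" "(tilde j M \<Phi>' \<longlongrightarrow> of_real y) (at_left (pi/2))"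
  shows "((1/2 + \<omega>)\<^sup>2 - M\<^sup>2) * radial_norm_sq \<Phi> * y\<^sup>2 =
    ((chirality j * M - (1/2 + \<omega>)) * x)\<^sup>2 * radial_norm_sq \<Phi>'"
proof -
  let ?T = "radial_ladder M 1 \<omega> \<Phi>" and ?\<kappa> = "chirality j * M - (1/2 + \<omega>)"
  have T: "bvp_solution M (bc_gen l r) (\<omega> + 1) ?T" by (rule bvp_radial_ladder[OF M sol(1)]) simp
  then obtain c where c: "\<And>\<rho>. \<rho> \<in> rho_interval \<Longrightarrow> ?T \<rho> = c *s \<Phi>' \<rho>"
    using unique_up_to_scalars_bc_gen[OF M, of l r "\<omega> + 1"] sol(2) nz unfolding unique_up_to_scalars_def by blast
  have "complex_of_real (radial_norm_sq ?T) = of_real (((1/2 + \<omega>)\<^sup>2 - M\<^sup>2) * radial_norm_sq \<Phi>)"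
    using radial_ladder_norm[OF M _ sol(1), of 1] by (simp add: radial_inner_self)
  then have n1: "radial_norm_sq ?T = ((1/2 + \<omega>)\<^sup>2 - M\<^sup>2) * radial_norm_sq \<Phi>" by (simp only: of_real_eq_iff)
  have n2: "radial_norm_sq ?T = (cmod c)\<^sup>2 * radial_norm_sq \<Phi>'"
    using radial_norm_sq_cong[of ?T "\<lambda>\<rho>. c *s \<Phi>' \<rho>"] c radial_norm_sq_scale by simp
  have sin1: "(sin \<longlongrightarrow> (1::real)) (at_left (pi/2))"
    using isCont_imp_tendsto_at_left[where f = sin and x = "pi/2"] by simp
  have rs: "radial_solution M \<omega> \<Phi>" using sol(1) by (simp add: bvp_solution_def)
  have "(tilde j M ?T \<longlongrightarrow> of_real (chirality j * M - (1/2 + 1 * \<omega>) * 1) * of_real x) (at_left (pi/2))"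
    by (rule tilde_radial_ladder_tendsto[OF M rs lim(1) disjI1[OF refl] sin1])
  moreover have "(tilde j M ?T \<longlongrightarrow> c * of_real y) (at_left (pi/2))"
    by (rule Lim_transform_eventually[OF tendsto_mult_left[OF lim(2), of c]])
      (use eventually_rho_right in eventually_elim, simp add: tilde_def c)
  ultimately have "c * of_real y = of_real (chirality j * M - (1/2 + 1 * \<omega>) * 1) * of_real x"
    by (rule tendsto_unique[OF trivial_limit_at_left_real, symmetric])
  then have "cmod (c * of_real y) = cmod (complex_of_real (?\<kappa> * x))" by simp
  then have "cmod c * \<bar>y\<bar> = \<bar>?\<kappa> * x\<bar>" by (simp only: norm_mult norm_of_real)
  then have sq: "(cmod c)\<^sup>2 * y\<^sup>2 = (?\<kappa> * x)\<^sup>2"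
    by (metis power2_abs power_mult_distrib)
  have "((1/2 + \<omega>)\<^sup>2 - M\<^sup>2) * radial_norm_sq \<Phi> * y\<^sup>2 = ((cmod c)\<^sup>2 * y\<^sup>2) * radial_norm_sq \<Phi>'"
    unfolding n1[symmetric] n2 by (simp only: mult_ac)
  then show ?thesis unfolding sq .
qed

section \<open>Norms of the lowest modes\<close>

lemma mk_spinor_norm_sq:
  "radial_norm_sq (mk_spinor M f g) =
    (LINT \<rho>:rho_interval|lborel. sigma \<rho> powr (2 * M) * (f \<rho>)\<^sup>2 + sigma \<rho> powr (- 2 * M) * (g \<rho>)\<^sup>2)"
  unfolding radial_norm_sq_def
proof (intro set_lebesgue_integral_cong ballI allI impI)
  fix \<rho>
  have "sigma \<rho> powr (2 * M) = (sigma \<rho> powr M)\<^sup>2" "sigma \<rho> powr (- 2 * M) = (sigma \<rho> powr (- M))\<^sup>2"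
    by (simp_all add: power2_eq_square flip: powr_add)
  then show "(cmod (mk_spinor M f g \<rho> $ 1))\<^sup>2 + (cmod (mk_spinor M f g \<rho> $ 2))\<^sup>2 =
      sigma \<rho> powr (2 * M) * (f \<rho>)\<^sup>2 + sigma \<rho> powr (- 2 * M) * (g \<rho>)\<^sup>2"
    by (simp add: mk_spinor_def real_spinor_def norm_mult power_mult_distrib)
qed simp

lemma norm_sq_sign:
  "s = 1 \<or> s = - 1 \<Longrightarrow> radial_norm_sq (radial_I M s n) = radial_norm_sq (radial_I M 1 n)"
  "s = 1 \<or> s = - 1 \<Longrightarrow> radial_norm_sq (radial_III M s n) = radial_norm_sq (radial_III M 1 n)"
  by (auto simp: radial_I_def radial_III_def mk_spinor_norm_sq)

text \<open>The substitution t = (1 + sin \<rho>)/2 in the Beta integral: dt/d\<rho> = cos \<rho> /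
  2 is the product of the square roots of t and 1 - t, which shifts both exponents from -1 to
  -1/2.\<close>

lemma Beta_integral_sin:
  assumes "0 < a" "0 < b"
    and int: "set_integrable lborel rho_interval
      (\<lambda>\<rho>. ((1 + sin \<rho>) / 2) powr (a - 1/2) * ((1 - sin \<rho>) / 2) powr (b - 1/2))"
  shows "(LINT \<rho>:rho_interval|lborel. ((1 + sin \<rho>) / 2) powr (a - 1/2) * ((1 - sin \<rho>) / 2) powr (b - 1/2)) = Beta a b"
proof -
  let ?f = "\<lambda>t::real. t powr (a - 1) * (1 - t) powr (b - 1)"
  let ?g = "\<lambda>\<rho>::real. (1 + sin \<rho>) / 2"
  let ?h = "\<lambda>\<rho>. ((1 + sin \<rho>) / 2) powr (a - 1/2) * ((1 - sin \<rho>) / 2) powr (b - 1/2)"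
  have fg: "?f (?g \<rho>) * (cos \<rho> / 2) = ?h \<rho>" if \<rho>: "\<rho> \<in> rho_interval" for \<rho>
  proof -
    have p: "0 < 1 + sin \<rho>" "0 < 1 - sin \<rho>" using sin_bounds_rho[OF \<rho>] by auto
    have 1: "1 - ?g \<rho> = (1 - sin \<rho>) / 2" by (simp add: field_simps)
    have "cos \<rho> / 2 = ((1 + sin \<rho>) / 2) powr (1/2) * ((1 - sin \<rho>) / 2) powr (1/2)"
      unfolding cos_eq_powr_sin[OF \<rho>] using p by (simp add: powr_divide powr_half_sqrt)
    then have "?f (?g \<rho>) * (cos \<rho> / 2) = (?g \<rho> powr (a - 1) * ?g \<rho> powr (1/2)) *
        (((1 - sin \<rho>) / 2) powr (b - 1) * ((1 - sin \<rho>) / 2) powr (1/2))"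
      unfolding 1 by (simp only: mult_ac)
    also have "\<dots> = ?h \<rho>" by (simp flip: powr_add)
    finally show ?thesis .
  qed
  have int': "set_integrable lborel rho_interval (\<lambda>\<rho>. ?f (?g \<rho>) * (cos \<rho> / 2))"
    using int by (subst set_integrable_cong[OF refl refl fg])
  have gc: "isCont ?g x" for x by (intro continuous_intros) auto
  have gl: "((ereal \<circ> ?g \<circ> real_of_ereal) \<longlongrightarrow> 0) (at_right (ereal (- pi/2)))"
  proof -
    have "((\<lambda>x. ereal (?g x)) \<longlongrightarrow> ereal (?g (- pi/2))) (at_right (- pi/2))"
      using isCont_imp_tendsto_at_right[OF gc, of "- pi/2"] by (simp only: tendsto_ereal)
    then show ?thesis by (simp only: ereal_tendsto_simps) (simp add: comp_def zero_ereal_def)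
  qed
  have gr: "((ereal \<circ> ?g \<circ> real_of_ereal) \<longlongrightarrow> 1) (at_left (ereal (pi/2)))"
  proof -
    have "((\<lambda>x. ereal (?g x)) \<longlongrightarrow> ereal (?g (pi/2))) (at_left (pi/2))"
      using isCont_imp_tendsto_at_left[OF gc, of "pi/2"] by (simp only: tendsto_ereal)
    then show ?thesis by (simp only: ereal_tendsto_simps) (simp add: comp_def one_ereal_def)
  qed
  have bnd: "0 < ?g x" "?g x < 1" if "ereal (- pi/2) < ereal x" "ereal x < ereal (pi/2)" for x
    using sin_bounds_rho[of x] that by auto
  have dg: "DERIV ?g x :> cos x / 2" for x by (auto intro!: derivative_eq_intros)
  have fc: "isCont ?f (?g x)" if "ereal (- pi/2) < ereal x" "ereal x < ereal (pi/2)" for x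
    using bnd[OF that] by (intro continuous_intros) auto
  have cc: "isCont (\<lambda>x. cos x / 2) x" for x :: real by (intro continuous_intros) auto
  have cn: "0 \<le> cos x / 2" if "ereal (- pi/2) \<le> ereal x" "ereal x \<le> ereal (pi/2)" for x
    using that by (auto intro!: cos_ge_zero)
  have fn: "0 \<le> ?f x" for x by simp
  have lt: "ereal (- pi/2) < ereal (pi/2)" by simp
  note sub = interval_integral_substitution_nonneg[where g = ?g and g' = "\<lambda>x. cos x / 2" and f = ?f
      and a = "ereal (- pi/2)" and b = "ereal (pi/2)" and A = 0 and B = 1,
      OF lt dg fc cc fn cn gl gr int'[folded rho_einterval]]
  have e01: "einterval 0 1 = {0<..<1::real}"
    by (auto simp: einterval_def zero_ereal_def one_ereal_def)
  have "(LINT \<rho>:rho_interval|lborel. ?h \<rho>) = (LINT \<rho>:rho_interval|lborel. ?f (?g \<rho>) * (cos \<rho> / 2))"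
    by (rule set_lebesgue_integral_cong) (simp, use fg in metis)
  also have "\<dots> = (LINT t:{0<..<1}|lborel. ?f t)"
    using sub(2) by (simp add: interval_lebesgue_integral_def rho_einterval e01)
  also have "\<dots> = integral {0<..<1} ?f"
    using sub(1) unfolding e01 by (rule set_borel_integral_eq_integral(2))
  also have "\<dots> = Beta a b"
    using has_integral_Beta_real[OF assms(1,2)] by (intro integral_unique) (simp add: has_integral_Icc_iff_Ioo)
  finally show ?thesis .
qed

text \<open>For \<open>n = 0\<close> both Jacobi polynomials are 1, and the squared components are a
  common factor times 1 + sin \<rho> and 1 - sin \<rho>, which add up to 2.\<close>

lemma radial_I_norm_0:
  assumes M: "\<bar>M\<bar> < 1/2"
  shows "radial_norm_sq (radial_I M 1 0) = 2 powr (2 * M + 1) * Beta (1/2 + M) (1/2 + M)"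
proof -
  let ?h = "\<lambda>\<rho>. ((1 + sin \<rho>) / 2) powr (1/2 + M - 1/2) * ((1 - sin \<rho>) / 2) powr (1/2 + M - 1/2)"
  let ?d = "\<lambda>\<rho>. (cmod (radial_I M 1 0 \<rho> $ 1))\<^sup>2 + (cmod (radial_I M 1 0 \<rho> $ 2))\<^sup>2"
  have d: "?d \<rho> = 2 powr (2 * M + 1) * ?h \<rho>" if \<rho>: "\<rho> \<in> rho_interval" for \<rho>
  proof -
    have p: "0 < 1 + sin \<rho>" "0 < 1 - sin \<rho>" using sin_bounds_rho[OF \<rho>] by auto
    have J: "jacobi_P 0 (- 1/2 + M) (1/2 + M) x = 1" "jacobi_P 0 (1/2 + M) (- 1/2 + M) x = 1" for x
      using M by (auto intro!: jacobi_P_0)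
    have u: "sigma \<rho> powr M * (1 + sin \<rho>) powr (1/2 + M) = (1 - sin \<rho>) powr (M/2) * (1 + sin \<rho>) powr (1/2 + M/2)"
      "sigma \<rho> powr (- M) * (1 - sin \<rho>) powr (1/2 + M) = (1 - sin \<rho>) powr (1/2 + M/2) * (1 + sin \<rho>) powr (M/2)"
      by (simp_all add: sigma_powr[OF \<rho>] mult_ac add.commute flip: powr_add)
    have sq: "(x powr (M/2))\<^sup>2 = x powr M" "(x powr (1/2 + M/2))\<^sup>2 = x * x powr M" if "0 < x" for x :: real
      using that by (simp_all add: power2_eq_square powr_mult_base powr_add[symmetric])
    have "?d \<rho> = (sigma \<rho> powr M * (1 + sin \<rho>) powr (1/2 + M))\<^sup>2 + (sigma \<rho> powr (- M) * (1 - sin \<rho>) powr (1/2 + M))\<^sup>2"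
      unfolding radial_I_def mk_spinor_def real_spinor_def mode_I_1_def mode_I_2_def J
      by (simp add: norm_mult)
    also have "\<dots> = 2 * ((1 + sin \<rho>) powr M * (1 - sin \<rho>) powr M)"
      unfolding u power_mult_distrib sq[OF p(1)] sq[OF p(2)] by (simp add: algebra_simps)
    also have "\<dots> = 2 powr (2 * M + 1) * ?h \<rho>"
      using p by (simp add: powr_divide powr_add divide_simps) (simp add: powr_add[symmetric])
    finally show ?thesis .
  qed
  have "radial_solution M (1 * omega_I M 0) (radial_I M 1 0)"
    using bvp_radial_I[OF M, of 1 0] by (simp add: bvp_solution_def)
  from set_integrable_radial_norm_sq[OF this M]
  have "set_integrable lborel rho_interval (\<lambda>\<rho>. 2 powr (2 * M + 1) * ?h \<rho>)"
    by (subst (asm) set_integrable_cong[OF refl refl d])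
  then have "set_integrable lborel rho_interval ?h"
    by (subst (asm) set_integrable_mult_right_iff) simp_all
  then have B: "(LINT \<rho>:rho_interval|lborel. ?h \<rho>) = Beta (1/2 + M) (1/2 + M)"
    using M by (intro Beta_integral_sin) auto
  have "radial_norm_sq (radial_I M 1 0) = (LINT \<rho>:rho_interval|lborel. 2 powr (2 * M + 1) * ?h \<rho>)"
    unfolding radial_norm_sq_def by (rule set_lebesgue_integral_cong) (simp, use d in blast)
  then show ?thesis using B by simp
qed

lemma radial_III_norm_0:
  assumes M: "\<bar>M\<bar> < 1/2"
  shows "radial_norm_sq (radial_III M 1 0) = 4 * Beta (1/2 + M) (1/2 - M)"
proof -
  let ?h = "\<lambda>\<rho>. ((1 + sin \<rho>) / 2) powr (1/2 + M - 1/2) * ((1 - sin \<rho>) / 2) powr (1/2 - M - 1/2)"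
  let ?d = "\<lambda>\<rho>. (cmod (radial_III M 1 0 \<rho> $ 1))\<^sup>2 + (cmod (radial_III M 1 0 \<rho> $ 2))\<^sup>2"
  have d: "?d \<rho> = 4 * ?h \<rho>" if \<rho>: "\<rho> \<in> rho_interval" for \<rho>
  proof -
    have p: "0 < 1 + sin \<rho>" "0 < 1 - sin \<rho>" using sin_bounds_rho[OF \<rho>] by auto
    have J: "jacobi_P 0 (- 1/2 - M) (- 1/2 + M) x = 1" for x
      using M by (auto intro!: jacobi_P_0)
    have sq: "(sigma \<rho> powr (- M))\<^sup>2 = sigma \<rho> powr (- 2 * M)"
      by (simp add: power2_eq_square flip: powr_add)
    have "?d \<rho> = 4 * (sigma \<rho> powr (- M))\<^sup>2"
      unfolding radial_III_def mk_spinor_def real_spinor_def mode_III_1_def mode_III_2_def J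
      by (simp add: norm_mult power_mult_distrib)
    also have "(sigma \<rho> powr (- M))\<^sup>2 = ?h \<rho>"
      unfolding sq unfolding sigma_powr[OF \<rho>] using p by (simp add: powr_divide powr_minus divide_simps)
    finally show ?thesis .
  qed
  have "radial_solution M (1 * real 0) (radial_III M 1 0)"
    using bvp_radial_III[OF M, of 1 0] by (simp add: bvp_solution_def)
  from set_integrable_radial_norm_sq[OF this M]
  have "set_integrable lborel rho_interval (\<lambda>\<rho>. 4 * ?h \<rho>)"
    by (subst (asm) set_integrable_cong[OF refl refl d])
  then have "set_integrable lborel rho_interval ?h"
    by (subst (asm) set_integrable_mult_right_iff) simp_all
  then have B: "(LINT \<rho>:rho_interval|lborel. ?h \<rho>) = Beta (1/2 + M) (1/2 - M)"
    using M by (intro Beta_integral_sin) auto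
  have "radial_norm_sq (radial_III M 1 0) = (LINT \<rho>:rho_interval|lborel. 4 * ?h \<rho>)"
    unfolding radial_norm_sq_def by (rule set_lebesgue_integral_cong) (simp, use d in blast)
  then show ?thesis using B by simp
qed

section \<open>Norms of all modes by recursion\<close>

lemma jacobi_P_at_1_Suc:
  assumes "- 1 < a"
  shows "jacobi_P (Suc n) a b 1 = jacobi_P n a b' 1 * (real n + a + 1) / (real n + 1)"
    and "jacobi_P n a b 1 \<noteq> 0"
proof -
  have "Gamma (real (Suc n) + a + 1) = (real n + a + 1) * Gamma (real n + a + 1)"
    using assms Gamma_plus1[of "real n + a + 1"] by (auto simp: nonpos_Ints_def add_ac)
  then show "jacobi_P (Suc n) a b 1 = jacobi_P n a b' 1 * (real n + a + 1) / (real n + 1)"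
    by (simp add: jacobi_P_at_1 add.commute divide_simps mult.commute)
  have "Gamma (real n + a + 1) \<noteq> 0" using assms Gamma_nonzero[of "real n + a"] by simp
  then show "jacobi_P n a b 1 \<noteq> 0" using Gamma_nonzero[OF assms] by (simp add: jacobi_P_at_1)
qed

lemma nonzero_spinor_of_limit:
  assumes "(tilde j M \<Phi> \<longlongrightarrow> L) (at_left (pi/2))" "L \<noteq> 0"
  shows "nonzero_spinor \<Phi>"
proof (rule ccontr)
  assume "\<not> nonzero_spinor \<Phi>"
  then have z: "\<Phi> \<rho> = 0" if "\<rho> \<in> rho_interval" for \<rho> using that by (auto simp: nonzero_spinor_def)
  have "(tilde j M \<Phi> \<longlongrightarrow> 0) (at_left (pi/2))"
    by (rule Lim_transform_eventually[OF tendsto_const])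
      (use eventually_rho_right in eventually_elim, simp add: tilde_def z)
  then show False using assms tendsto_unique[OF trivial_limit_at_left_real] by blast
qed

text \<open>In case (I) component 2 vanishes at \<pi>/2, so component 1 is the one whose limit there
  is non-zero; it shows that the mode is non-zero and serves as boundary value in the norm
  recursion. In case (III) the roles are exchanged.\<close>

lemma radial_I_limit:
  assumes "\<bar>M\<bar> < 1/2"
  shows "(tilde 1 M (radial_I M s n) \<longlongrightarrow> of_real (2 powr (1/2 + M) * jacobi_P n (- 1/2 + M) (1/2 + M) 1)) (at_left (pi/2))"
  unfolding radial_I_def
  using isCont_imp_tendsto_at_left[OF continuous_mode(1)[OF assms], of n "pi/2"]
  by (intro tilde_mk_spinor_tendsto) (simp_all add: mode_I_1_def)

lemma radial_III_limit:
  assumes "\<bar>M\<bar> < 1/2"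
  shows "(tilde 2 M (radial_III M s n) \<longlongrightarrow> of_real (s * (- 2 * jacobi_P n (- 1/2 - M) (- 1/2 + M) 1))) (at_left (pi/2))"
  unfolding radial_III_def
  using tendsto_mult_left[OF isCont_imp_tendsto_at_left[OF continuous_mode(4)[OF assms], of n "pi/2"], of s]
  by (intro tilde_mk_spinor_tendsto) (simp_all add: mode_III_2_def)

lemma nonzero_radial_I: "\<bar>M\<bar> < 1/2 \<Longrightarrow> nonzero_spinor (radial_I M s n)"
  using jacobi_P_at_1_Suc(2)[of "- 1/2 + M" n "1/2 + M"]
  by (intro nonzero_spinor_of_limit[OF radial_I_limit]) auto

lemma nonzero_radial_III: "\<bar>M\<bar> < 1/2 \<Longrightarrow> s = 1 \<or> s = - 1 \<Longrightarrow> nonzero_spinor (radial_III M s n)"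
  using jacobi_P_at_1_Suc(2)[of "- 1/2 - M" n "- 1/2 + M"]
  by (intro nonzero_spinor_of_limit[OF radial_III_limit]) auto

text \<open>With A, B, C as in the induction step, \<open>norm_recursion\<close> becomes
  \<open>H' = H * C\<^sup>2 / (A * B)\<close>. By the functional equation of Gamma, this is the
  recursion of the claimed quotient.\<close>

lemma radial_I_norm:
  assumes M: "\<bar>M\<bar> < 1/2"
  shows "(N_I M n)\<^sup>2 * radial_norm_sq (radial_I M 1 n) = 1"
proof -
  have gt: "2 * M > - 1" using M by auto
  have G0: "Gamma (2 * M + 1) > 0" "Gamma (1/2 + M) > 0" using M by (auto intro!: Gamma_real_pos)
  have N2: "(N_I M n)\<^sup>2 = fact n * Gamma (real n + 2 * M + 1) / (2 powr (2 * M + 1) * (Gamma (1/2 + M + real n))\<^sup>2)"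
  proof -
    have "0 \<le> fact n * Gamma (real n + 2 * M + 1)" using gt by (intro mult_nonneg_nonneg less_imp_le[OF Gamma_real_pos]) auto
    moreover have "(2 powr (M + 1/2))\<^sup>2 = 2 powr (2 * M + 1)" by (simp add: power2_eq_square flip: powr_add)
    ultimately show ?thesis by (simp add: N_I_def power_divide power_mult_distrib)
  qed
  have "radial_norm_sq (radial_I M 1 n) =
      2 powr (2 * M + 1) * (Gamma (1/2 + M + real n))\<^sup>2 / (fact n * Gamma (real n + 2 * M + 1))"
  proof (induction n)
    case 0
    then show ?case by (simp add: radial_I_norm_0[OF M] Beta_def power2_eq_square add.commute)
  next
    case (Suc n)
    let ?H = "radial_norm_sq (radial_I M 1 n)" and ?H' = "radial_norm_sq (radial_I M 1 (Suc n))"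
    let ?x = "2 powr (1/2 + M) * jacobi_P n (- 1/2 + M) (1/2 + M) 1"
    let ?y = "2 powr (1/2 + M) * jacobi_P (Suc n) (- 1/2 + M) (1/2 + M) 1"
    let ?A = "real n + 1" and ?B = "real n + 1 + 2 * M" and ?C = "1/2 + M + real n"
    have om: "omega_I M n + 1 = omega_I M (Suc n)" by (simp add: omega_I_def)
    have rec: "((1/2 + omega_I M n)\<^sup>2 - M\<^sup>2) * ?H * ?y\<^sup>2 = ((chirality 1 * M - (1/2 + omega_I M n)) * ?x)\<^sup>2 * ?H'"
      using bvp_radial_I[OF M, of 1 n] bvp_radial_I[OF M, of 1 "Suc n"]
      by (intro norm_recursion[OF M _ _ nonzero_radial_I[OF M] radial_I_limit[OF M] radial_I_limit[OF M]])
        (auto simp: om)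
    have y: "?y = ?x * (?C / ?A)"
    proof -
      have "- 1 < - 1/2 + M" "real n + (- 1/2 + M) + 1 = ?C" using M by auto
      then show ?thesis
        using jacobi_P_at_1_Suc(1)[of "- 1/2 + M" n "1/2 + M" "1/2 + M"]
        by (simp only: times_divide_eq_right mult.assoc)
    qed
    have x: "?x \<noteq> 0" using jacobi_P_at_1_Suc(2)[of "- 1/2 + M" n "1/2 + M"] M by auto
    have e: "(1/2 + omega_I M n)\<^sup>2 - M\<^sup>2 = ?A * ?B" "chirality 1 * M - (1/2 + omega_I M n) = - ?B"
      by (simp_all add: omega_I_def power2_eq_square algebra_simps)
    have pos: "0 < ?A" "0 < ?B" "0 < ?C" using M by auto
    have "?x\<^sup>2 * (?A * ?B * ?H * (?C / ?A)\<^sup>2) = ?x\<^sup>2 * (?B\<^sup>2 * ?H')"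
      using rec unfolding e y power_mult_distrib by (simp only: power2_minus mult_ac)
    then have eq: "?A * ?B * ?H * (?C / ?A)\<^sup>2 = ?B\<^sup>2 * ?H'"
      using x by (simp only: mult_cancel_left power_eq_0_iff) blast
    have "?B\<^sup>2 * ?H' = ?B\<^sup>2 * (?H * ?C\<^sup>2 / (?A * ?B))"
      unfolding eq[symmetric] using pos by (simp add: power2_eq_square)
    then have H': "?H' = ?H * ?C\<^sup>2 / (?A * ?B)" using pos by (simp only: mult_cancel_left power_eq_0_iff) linarith
    have G: "Gamma (1/2 + M + real (Suc n)) = ?C * Gamma ?C" "Gamma (real (Suc n) + 2 * M + 1) = ?B * Gamma (real n + 2 * M + 1)"
      using Gamma_plus1[of ?C] Gamma_plus1[of "real n + 2 * M + 1"] pos by (auto simp: nonpos_Ints_def add_ac)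
    show ?case
      unfolding H' Suc.IH G by (simp add: power_mult_distrib mult_ac)
  qed
  moreover have "Gamma (real n + 2 * M + 1) > 0" "Gamma (1/2 + M + real n) > 0"
    using M by (auto intro!: Gamma_real_pos)
  ultimately show ?thesis unfolding N2 by simp
qed

text \<open>Same scheme with the second component as boundary value; here the recursion is
  \<open>H' = H * (B * C) / A\<^sup>2\<close>.\<close>

lemma radial_III_norm:
  assumes M: "\<bar>M\<bar> < 1/2"
  shows "(N_int M n)\<^sup>2 * radial_norm_sq (radial_III M 1 n) = 1"
proof -
  have Gp: "Gamma (1/2 + M + real n) > 0" "Gamma (1/2 - M + real n) > 0" for n
    using M by (auto intro!: Gamma_real_pos)
  have N2: "(N_int M n)\<^sup>2 = (fact n)\<^sup>2 / (4 * (Gamma (1/2 + M + real n) * Gamma (1/2 - M + real n)))"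
    using Gp[of n] by (simp add: N_int_def power_divide power_mult_distrib)
  have "radial_norm_sq (radial_III M 1 n) =
      4 * (Gamma (1/2 + M + real n) * Gamma (1/2 - M + real n)) / (fact n)\<^sup>2"
  proof (induction n)
    case 0
    then show ?case by (simp add: radial_III_norm_0[OF M] Beta_def)
  next
    case (Suc n)
    let ?H = "radial_norm_sq (radial_III M 1 n)" and ?H' = "radial_norm_sq (radial_III M 1 (Suc n))"
    let ?x = "1 * (- 2 * jacobi_P n (- 1/2 - M) (- 1/2 + M) 1)"
    let ?y = "1 * (- 2 * jacobi_P (Suc n) (- 1/2 - M) (- 1/2 + M) 1)"
    let ?A = "real n + 1" and ?B = "1/2 - M + real n" and ?C = "1/2 + M + real n"
    have rec: "((1/2 + real n)\<^sup>2 - M\<^sup>2) * ?H * ?y\<^sup>2 = ((chirality 2 * M - (1/2 + real n)) * ?x)\<^sup>2 * ?H'"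
      using bvp_radial_III[OF M, of 1 n] bvp_radial_III[OF M, of 1 "Suc n"]
      by (intro norm_recursion[OF M _ _ nonzero_radial_III[OF M] radial_III_limit[OF M] radial_III_limit[OF M]])
        (auto simp: add.commute)
    have y: "?y = ?x * (?B / ?A)"
    proof -
      have "- 1 < - 1/2 - M" "real n + (- 1/2 - M) + 1 = ?B" using M by auto
      then show ?thesis
        using jacobi_P_at_1_Suc(1)[of "- 1/2 - M" n "- 1/2 + M" "- 1/2 + M"]
        by (simp only: times_divide_eq_right mult.assoc)
    qed
    have x: "?x \<noteq> 0" using jacobi_P_at_1_Suc(2)[of "- 1/2 - M" n "- 1/2 + M"] M by auto
    have e: "(1/2 + real n)\<^sup>2 - M\<^sup>2 = ?B * ?C" "chirality 2 * M - (1/2 + real n) = - ?B"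
      by (simp_all add: power2_eq_square algebra_simps)
    have pos: "0 < ?A" "0 < ?B" "0 < ?C" using M by auto
    have "?x\<^sup>2 * (?B * ?C * ?H * (?B / ?A)\<^sup>2) = ?x\<^sup>2 * (?B\<^sup>2 * ?H')"
      using rec unfolding e y power_mult_distrib by (simp only: power2_minus mult_ac)
    then have eq: "?B * ?C * ?H * (?B / ?A)\<^sup>2 = ?B\<^sup>2 * ?H'"
      using x by (simp only: mult_cancel_left power_eq_0_iff) blast
    have "?B\<^sup>2 * ?H' = ?B\<^sup>2 * (?H * (?B * ?C) / ?A\<^sup>2)"
      unfolding eq[symmetric] using pos by (simp add: power2_eq_square)
    then have H': "?H' = ?H * (?B * ?C) / ?A\<^sup>2" using pos by (simp only: mult_cancel_left power_eq_0_iff) linarith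
    have G: "Gamma (1/2 + M + real (Suc n)) = ?C * Gamma ?C" "Gamma (1/2 - M + real (Suc n)) = ?B * Gamma ?B"
      using Gamma_plus1[of ?C] Gamma_plus1[of ?B] pos by (auto simp: nonpos_Ints_def add_ac)
    show ?case
      unfolding H' Suc.IH G by (simp add: power_mult_distrib mult_ac add.commute)
  qed
  then show ?thesis unfolding N2 using Gp[of n] by simp
qed

section \<open>The frequencies\<close>

text \<open>The leading coefficient contains \<open>pochhammer (real n + a + b + 1) n\<close>. In
  case (III) the first parameter is 0 for \<open>n = 0\<close>, but the empty product is still 1;
  hence the separate alternative.\<close>

lemma degree_jacobi_poly:
  assumes "- 1 < a" "n = 0 \<or> 0 < real n + a + b + 1"
  shows "degree (jacobi_poly n a b) = n" "jacobi_poly n a b \<noteq> 0"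
proof -
  have "pochhammer (real n + a + b + 1) n \<noteq> 0"
    using assms(2) pochhammer_pos[of "real n + a + b + 1" n] by auto
  moreover have "pochhammer (- real n) n \<noteq> 0" by (simp add: pochhammer_eq_0_iff)
  moreover have "pochhammer (a + 1) n \<noteq> 0" using assms(1) pochhammer_pos[of "a + 1" n] by auto
  moreover have "Gamma (real n + a + 1) \<noteq> 0" using assms(1) Gamma_nonzero[of "real n + a"] by simp
  ultimately have c: "coeff (jacobi_poly n a b) n \<noteq> 0"
    using Gamma_nonzero[OF assms(1)] by (simp add: coeff_jacobi_poly jacobi_coeff_def)
  have "degree (jacobi_poly n a b) \<le> n"
    by (rule degree_le) (simp add: coeff_jacobi_poly jacobi_coeff_eq_0)
  with le_degree[OF c] show "degree (jacobi_poly n a b) = n" by simp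
  show "jacobi_poly n a b \<noteq> 0" using c by auto
qed

text \<open>\<open>X\<close> and \<open>Y\<close> stand for modes of opposite frequency; the sum and
  the difference of the two orthogonality relations isolate the components.\<close>

lemma orthogonal_components:
  assumes M: "\<bar>M\<bar> < 1/2"
    and sol: "radial_solution M \<omega>1 X" "radial_solution M \<omega>2 Y" "radial_solution M \<omega> \<Phi>"
    and XY: "\<And>\<rho>. Y \<rho> $ 1 = X \<rho> $ 1" "\<And>\<rho>. Y \<rho> $ 2 = - X \<rho> $ 2"
    and orth: "radial_inner X \<Phi> = 0" "radial_inner Y \<Phi> = 0"
  shows "(LINT \<rho>:rho_interval|lborel. cnj (X \<rho> $ j) * \<Phi> \<rho> $ j) = 0"
proof -
  let ?A = "LINT \<rho>:rho_interval|lborel. cnj (X \<rho> $ 1) * \<Phi> \<rho> $ 1"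
  let ?B = "LINT \<rho>:rho_interval|lborel. cnj (X \<rho> $ 2) * \<Phi> \<rho> $ 2"
  note i = set_integrable_component_product[OF sol(1,3) M]
  have "?A + ?B = 0"
    using orth(1) set_integral_add(2)[OF i[of 1 1] i[of 2 2]]
    by (simp add: radial_inner_def spinor_density_def sum_2)
  moreover have "?A - ?B = 0"
    using orth(2) set_integral_diff(2)[OF i[of 1 1] i[of 2 2]]
    by (simp add: radial_inner_def spinor_density_def sum_2 XY)
  ultimately have "?A = 0" "?B = 0" by (simp_all add: add_eq_0_iff)
  then show ?thesis using exhaust_2[of j] by auto
qed

text \<open>The function \<open>cnj (X 1 0 \<rho> $ j) * \<Phi> \<rho> $ j\<close> has vanishing
  moments against all \<open>Q n\<close>, hence is zero, and the lowest mode has a non-zero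
  component there. The two components are concluded separately because only one of them may have
  polynomials of every degree.\<close>

lemma component_eq_0_of_orthogonal:
  assumes M: "\<bar>M\<bar> < 1/2"
    and bvp: "\<And>s n. s = 1 \<or> s = - 1 \<Longrightarrow> bvp_solution M (bc_gen l r) (s * w n) (mk_spinor M (f n) (\<lambda>\<rho>. s * g n \<rho>))"
    and \<Phi>: "bvp_solution M (bc_gen l r) \<omega> \<Phi>" and \<omega>: "\<And>s n. s = 1 \<or> s = - 1 \<Longrightarrow> \<omega> \<noteq> s * w n"
    and Q: "\<And>n. degree (Q n) = n" "\<And>n. Q n \<noteq> 0" and \<rho>: "\<rho> \<in> rho_interval"
  shows "(\<And>n \<rho>. f n \<rho> = poly (Q n) ((1 - sin \<rho>) / 2) * f 0 \<rho>) \<Longrightarrow> f 0 \<rho> \<noteq> 0 \<Longrightarrow> \<Phi> \<rho> $ 1 = 0"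
    "(\<And>n \<rho>. g n \<rho> = poly (Q n) ((1 - sin \<rho>) / 2) * g 0 \<rho>) \<Longrightarrow> g 0 \<rho> \<noteq> 0 \<Longrightarrow> \<Phi> \<rho> $ 2 = 0"
proof -
  define X where "X s n = mk_spinor M (f n) (\<lambda>\<rho>. s * g n \<rho>)" for s n
  note bvp' = bvp[folded X_def]
  have sol: "radial_solution M (s * w n) (X s n)" if "s = 1 \<or> s = - 1" for s n
    using bvp'[OF that] by (simp add: bvp_solution_def)
  have sol\<Phi>: "radial_solution M \<omega> \<Phi>" using \<Phi> by (simp add: bvp_solution_def)
  have orth: "radial_inner (X s n) \<Phi> = 0" if "s = 1 \<or> s = - 1" for s n
    using \<omega>[OF that, of n] by (intro radial_orthogonal[OF M bvp'[OF that] \<Phi>]) auto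
  have int: "(LINT \<rho>:rho_interval|lborel. cnj (X 1 n \<rho> $ j) * \<Phi> \<rho> $ j) = 0" for n j
    by (rule orthogonal_components[OF M sol[of 1 n] sol[of "- 1" n] sol\<Phi> _ _ orth[of 1 n] orth[of "- 1" n]])
      (simp_all add: X_def mk_spinor_def real_spinor_def)
  have main: "\<Phi> \<rho> $ j = 0"
    if XQ: "\<And>n \<rho>. X 1 n \<rho> $ j = of_real (poly (Q n) ((1 - sin \<rho>) / 2)) * X 1 0 \<rho> $ j" and nz: "X 1 0 \<rho> $ j \<noteq> 0" for j
  proof -
    let ?h = "\<lambda>\<rho>. cnj (X 1 0 \<rho> $ j) * \<Phi> \<rho> $ j"
    have sol0: "radial_solution M (1 * w 0) (X 1 0)" by (rule sol) simp
    have "?h \<rho> = 0"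
    proof (rule moment_vanishing_imp_0[of ?h Q])
      show "continuous_on rho_interval ?h"
        by (intro continuous_on_mult continuous_on_cnj radial_solution_continuous_on[OF sol0] radial_solution_continuous_on[OF sol\<Phi>])
      show "set_integrable lborel rho_interval ?h"
        by (rule set_integrable_component_product[OF sol0 sol\<Phi> M])
      show "(LINT \<rho>:rho_interval|lborel. ?h \<rho> * of_real (poly (Q n) ((1 - sin \<rho>) / 2))) = 0" for n
        using int[of n j] by (simp add: XQ[of n] mult_ac)
    qed (use Q \<rho> in simp_all)
    then show ?thesis using nz by simp
  qed
  have "sigma \<rho> > 0" by (rule sigma_pos[OF \<rho>])
  then have X0: "X 1 0 \<rho> $ 1 \<noteq> 0 \<longleftrightarrow> f 0 \<rho> \<noteq> 0" "X 1 0 \<rho> $ 2 \<noteq> 0 \<longleftrightarrow> g 0 \<rho> \<noteq> 0"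
    by (simp_all add: X_def mk_spinor_def real_spinor_def)
  have X: "X 1 n \<rho> $ 1 = of_real (sigma \<rho> powr M * f n \<rho>)" "X 1 n \<rho> $ 2 = of_real (sigma \<rho> powr (- M) * g n \<rho>)" for n \<rho>
    by (simp_all add: X_def mk_spinor_def real_spinor_def)
  show "\<Phi> \<rho> $ 1 = 0" if f: "\<And>n \<rho>. f n \<rho> = poly (Q n) ((1 - sin \<rho>) / 2) * f 0 \<rho>" "f 0 \<rho> \<noteq> 0"
    using f(2) unfolding X0[symmetric] by (rule main[rotated]) (unfold X, subst f(1), simp)
  show "\<Phi> \<rho> $ 2 = 0" if g: "\<And>n \<rho>. g n \<rho> = poly (Q n) ((1 - sin \<rho>) / 2) * g 0 \<rho>" "g 0 \<rho> \<noteq> 0"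
    using g(2) unfolding X0[symmetric] by (rule main[rotated]) (unfold X, subst g(1), simp)
qed

lemma frequencies_I:
  assumes M: "\<bar>M\<bar> < 1/2"
  shows "frequencies M (bc_gen 1 2) = {s * omega_I M n | s n. s \<in> {1, - 1}}"
proof (intro equalityI subsetI)
  fix \<omega> assume "\<omega> \<in> {s * omega_I M n | s n. s \<in> {1, - 1}}"
  then show "\<omega> \<in> frequencies M (bc_gen 1 2)"
    unfolding frequencies_def using bvp_radial_I[OF M] nonzero_radial_I[OF M] by blast
next
  fix \<omega> assume "\<omega> \<in> frequencies M (bc_gen 1 2)"
  then obtain \<Phi> where \<Phi>: "bvp_solution M (bc_gen 1 2) \<omega> \<Phi>" and nz: "nonzero_spinor \<Phi>"
    by (auto simp: frequencies_def)
  show "\<omega> \<in> {s * omega_I M n | s n. s \<in> {1, - 1}}"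
  proof (rule ccontr)
    assume "\<omega> \<notin> {s * omega_I M n | s n. s \<in> {1, - 1}}"
    then have no: "\<omega> \<noteq> s * omega_I M n" if "s = 1 \<or> s = - 1" for s n using that by blast
    have a: "- 1 < - 1/2 + M" "- 1 < 1/2 + M" using M by auto
    have deg: "degree (jacobi_poly n (- 1/2 + M) (1/2 + M)) = n" "jacobi_poly n (- 1/2 + M) (1/2 + M) \<noteq> 0"
      "degree (jacobi_poly n (1/2 + M) (- 1/2 + M)) = n" "jacobi_poly n (1/2 + M) (- 1/2 + M) \<noteq> 0" for n
      using M by (intro degree_jacobi_poly a; auto)+
    have poly: "mode_I_1 M n \<rho> = poly (jacobi_poly n (- 1/2 + M) (1/2 + M)) ((1 - sin \<rho>) / 2) * mode_I_1 M 0 \<rho>"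
      "mode_I_2 M n \<rho> = poly (jacobi_poly n (1/2 + M) (- 1/2 + M)) ((1 - sin \<rho>) / 2) * mode_I_2 M 0 \<rho>" for n \<rho>
      unfolding mode_I_1_def mode_I_2_def jacobi_P_0[OF a(1)] jacobi_P_0[OF a(2)] by (simp_all add: jacobi_P_eq_poly)
    have "\<Phi> \<rho> $ 1 = 0" "\<Phi> \<rho> $ 2 = 0" if \<rho>: "\<rho> \<in> rho_interval" for \<rho>
    proof -
      note comp = component_eq_0_of_orthogonal[where w = "omega_I M" and f = "mode_I_1 M" and g = "mode_I_2 M",
          OF M bvp_radial_I[OF M, unfolded radial_I_def] \<Phi> no _ _ \<rho>]
      have "mode_I_1 M 0 \<rho> \<noteq> 0" "mode_I_2 M 0 \<rho> \<noteq> 0"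
        unfolding mode_I_1_def mode_I_2_def jacobi_P_0[OF a(1)] jacobi_P_0[OF a(2)] using sin_bounds_rho[OF \<rho>] by auto
      then show "\<Phi> \<rho> $ 1 = 0" "\<Phi> \<rho> $ 2 = 0" using comp(1)[OF _ _ deg(1,2) poly(1)] comp(2)[OF _ _ deg(3,4) poly(2)] by blast+
    qed
    then show False using nz by (auto simp: nonzero_spinor_def vec_eq_iff forall_2)
  qed
qed

text \<open>The first components of the modes involve Jacobi polynomials of degree
  \<open>n - 1\<close>, with none for \<open>n = 0\<close>, so the moment argument is applied to the
  second component. Once this vanishes identically, its equation gives that \<omega> times the first
  component is zero, and \<omega> is not an integer, in particular not 0.\<close>

lemma frequencies_III:
  assumes M: "\<bar>M\<bar> < 1/2"
  shows "frequencies M (bc_gen 1 1) = \<int>"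
proof (intro equalityI subsetI)
  fix \<omega> :: real assume "\<omega> \<in> \<int>"
  then obtain k :: int where k: "\<omega> = of_int k" by (elim Ints_cases)
  define s :: real where "s = (if k < 0 then - 1 else 1)"
  have "\<omega> = s * real (nat \<bar>k\<bar>)" "s = 1 \<or> s = - 1" by (auto simp: k s_def)
  then show "\<omega> \<in> frequencies M (bc_gen 1 1)"
    unfolding frequencies_def using bvp_radial_III[OF M] nonzero_radial_III[OF M] by blast
next
  fix \<omega> assume "\<omega> \<in> frequencies M (bc_gen 1 1)"
  then obtain \<Phi> where \<Phi>: "bvp_solution M (bc_gen 1 1) \<omega> \<Phi>" and nz: "nonzero_spinor \<Phi>"
    by (auto simp: frequencies_def)
  show "\<omega> \<in> \<int>"
  proof (rule ccontr)
    assume no: "\<omega> \<notin> \<int>"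
    then have no': "\<omega> \<noteq> s * real n" if "s = 1 \<or> s = - 1" for s n using that by auto
    have a: "- 1 < - 1/2 - M" using M by auto
    have deg: "degree (jacobi_poly n (- 1/2 - M) (- 1/2 + M)) = n" "jacobi_poly n (- 1/2 - M) (- 1/2 + M) \<noteq> 0" for n
      by (intro degree_jacobi_poly a; auto)+
    have c2: "\<Phi> \<rho> $ 2 = 0" if \<rho>: "\<rho> \<in> rho_interval" for \<rho>
    proof -
      have poly: "mode_III_2 M n \<rho> = poly (jacobi_poly n (- 1/2 - M) (- 1/2 + M)) ((1 - sin \<rho>) / 2) * mode_III_2 M 0 \<rho>" for n \<rho>
        unfolding mode_III_2_def jacobi_P_0[OF a] by (simp add: jacobi_P_eq_poly)
      have "mode_III_2 M 0 \<rho> \<noteq> 0" unfolding mode_III_2_def jacobi_P_0[OF a] by simp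
      then show ?thesis
        using component_eq_0_of_orthogonal(2)[where w = real and f = "mode_III_1 M" and g = "mode_III_2 M",
            OF M bvp_radial_III[OF M, unfolded radial_III_def] \<Phi> no' deg \<rho> poly] by blast
    qed
    have sol: "radial_solution M \<omega> \<Phi>" using \<Phi> by (simp add: bvp_solution_def)
    have "\<Phi> \<rho> $ 1 = 0" if \<rho>: "\<rho> \<in> rho_interval" for \<rho>
    proof -
      have "((\<lambda>r. \<Phi> r $ 2) has_vector_derivative 0) (at \<rho>)"
        by (rule has_vector_derivative_transform_within_open[OF has_vector_derivative_const[of 0] open_greaterThanLessThan \<rho>])
          (simp add: c2)
      from vector_derivative_unique_at[OF this radial_solution_deriv(2)[OF sol \<rho>]]
      show ?thesis using no c2[OF \<rho>] by auto
    qed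
    then show False using nz c2 by (auto simp: nonzero_spinor_def vec_eq_iff forall_2)
  qed
qed


section \<open>Exchanging the two components\<close>

definition flip_spinor :: "(real \<Rightarrow> complex^2) \<Rightarrow> real \<Rightarrow> complex^2" where
  "flip_spinor \<Phi> \<rho> = vector [\<Phi> \<rho> $ 2, - \<Phi> \<rho> $ 1]"

lemma radial_solution_flip:
  assumes "radial_solution M \<omega> \<Phi>"
  shows "radial_solution (- M) \<omega> (flip_spinor \<Phi>)"
proof (rule radial_solutionI)
  fix \<rho> assume \<rho>: "\<rho> \<in> rho_interval"
  note d = radial_solution_deriv[OF assms \<rho>]
  show "((\<lambda>r. flip_spinor \<Phi> r $ 1) has_vector_derivative
      of_real \<omega> * flip_spinor \<Phi> \<rho> $ 2 - of_real (- M / cos \<rho>) * flip_spinor \<Phi> \<rho> $ 1) (at \<rho>)"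
    using d(2) by (simp add: flip_spinor_def)
  show "((\<lambda>r. flip_spinor \<Phi> r $ 2) has_vector_derivative
      of_real (- M / cos \<rho>) * flip_spinor \<Phi> \<rho> $ 2 - of_real \<omega> * flip_spinor \<Phi> \<rho> $ 1) (at \<rho>)"
    using has_vector_derivative_minus[OF d(1)] by (simp add: flip_spinor_def)
qed

lemma bc_gen_flip: "bc_gen l r M \<Phi> \<Longrightarrow> bc_gen (3 - l) (3 - r) (- M) (flip_spinor \<Phi>)"
proof -
  have t: "tilde 1 (- M) (flip_spinor \<Phi>) = tilde 2 M \<Phi>" "tilde 2 (- M) (flip_spinor \<Phi>) = (\<lambda>\<rho>. - tilde 1 M \<Phi> \<rho>)"
    by (simp_all add: fun_eq_iff tilde_def flip_spinor_def)
  have "(tilde j M \<Phi> \<longlongrightarrow> 0) F \<Longrightarrow> (tilde (3 - j) (- M) (flip_spinor \<Phi>) \<longlongrightarrow> 0) F" for j F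
    using exhaust_2[of j] tendsto_minus[of "tilde j M \<Phi>" 0 F] by (auto simp: t)
  then show "bc_gen l r M \<Phi> \<Longrightarrow> bc_gen (3 - l) (3 - r) (- M) (flip_spinor \<Phi>)"
    by (simp add: bc_gen_def zero_left_def zero_right_def)
qed

lemma bvp_flip:
  "bvp_solution M (bc_gen l r) \<omega> \<Phi> \<Longrightarrow> bvp_solution (- M) (bc_gen (3 - l) (3 - r)) \<omega> (flip_spinor \<Phi>)"
  by (simp add: bvp_solution_def radial_solution_flip bc_gen_flip)

lemma nonzero_flip: "nonzero_spinor (flip_spinor \<Phi>) \<longleftrightarrow> nonzero_spinor \<Phi>"
  by (auto simp: nonzero_spinor_def flip_spinor_def vec_eq_iff forall_2)

lemma radial_norm_sq_flip: "radial_norm_sq (flip_spinor \<Phi>) = radial_norm_sq \<Phi>"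
  by (simp add: radial_norm_sq_def flip_spinor_def add.commute)

text \<open>The change of parameters is an involution, so the inclusion for arbitrary parameters
  gives the equality.\<close>

lemma frequencies_flip: "frequencies (- M) (bc_gen (3 - l) (3 - r)) = frequencies M (bc_gen l r)"
proof -
  have sub: "frequencies M (bc_gen l r) \<subseteq> frequencies (- M) (bc_gen (3 - l) (3 - r))" for M l r
    unfolding frequencies_def using bvp_flip nonzero_flip by blast
  have "3 - (3 - j) = j" for j :: 2 by simp
  then have "frequencies (- M) (bc_gen (3 - l) (3 - r)) \<subseteq> frequencies M (bc_gen l r)"
    using sub[of "- M" "3 - l" "3 - r"] by simp
  with sub show ?thesis by blast
qed


section \<open>The modes as normalized solutions\<close>

lemma bvp_scale:
  assumes "bvp_solution M (bc_gen l r) \<omega> \<Phi>"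
  shows "bvp_solution M (bc_gen l r) \<omega> (\<lambda>\<rho>. a *s \<Phi> \<rho>)"
proof -
  have "radial_solution M \<omega> (\<lambda>\<rho>. a *s \<Phi> \<rho> + 0 *s \<Phi> \<rho>)"
    using assms by (intro radial_solution_lincomb) (auto simp: bvp_solution_def)
  moreover have t: "tilde j M (\<lambda>\<rho>. a *s \<Phi> \<rho>) = (\<lambda>\<rho>. a * tilde j M \<Phi> \<rho>)" for j
    by (simp add: fun_eq_iff tilde_def)
  have "bc_gen l r M (\<lambda>\<rho>. a *s \<Phi> \<rho>)"
    using assms unfolding bvp_solution_def bc_gen_def zero_left_def zero_right_def t
    by (auto intro: tendsto_mult_right_zero)
  ultimately show ?thesis by (simp add: bvp_solution_def)
qed

lemma normalized_mode_stationary: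
  assumes M: "\<bar>M\<bar> < 1/2" and sol: "bvp_solution M (bc_gen l r) \<omega> \<Phi>" and norm: "radial_norm_sq \<Phi> = 1"
  shows "normalized_mode M (bc_gen l r) \<omega> (stationary \<omega> \<Phi>)"
  unfolding normalized_mode_def
proof (intro conjI allI impI)
  fix \<Phi>' assume \<Phi>': "bvp_solution M (bc_gen l r) \<omega> \<Phi>' \<and> nonzero_spinor \<Phi>'"
  then obtain c where c: "\<And>\<rho>. \<rho> \<in> rho_interval \<Longrightarrow> \<Phi> \<rho> = c *s \<Phi>' \<rho>"
    using unique_up_to_scalars_bc_gen[OF M, of l r \<omega>] sol unfolding unique_up_to_scalars_def by blast
  have "radial_norm_sq \<Phi> = (cmod c)\<^sup>2 * radial_norm_sq \<Phi>'"
    using radial_norm_sq_cong[of \<Phi> "\<lambda>\<rho>. c *s \<Phi>' \<rho>"] c radial_norm_sq_scale by simp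
  then have "c \<noteq> 0" using norm by auto
  moreover have "stationary \<omega> \<Phi> = c *\<^sub>\<Psi> stationary \<omega> \<Phi>'"
    by (auto simp: fun_eq_iff stationary_def on_strip_def spinor_scale_def c vec_eq_iff)
  ultimately show "\<exists>c. c \<noteq> 0 \<and> stationary \<omega> \<Phi> = c *\<^sub>\<Psi> stationary \<omega> \<Phi>'" by blast
qed (simp add: spinor_inner_stationary radial_inner_self norm)

lemma stationary_cong:
  "(\<And>\<rho>. \<rho> \<in> rho_interval \<Longrightarrow> \<Phi> \<rho> = \<Psi> \<rho>) \<Longrightarrow> stationary \<omega> \<Phi> = stationary \<omega> \<Psi>"
  by (auto simp: stationary_def on_strip_def fun_eq_iff)

text \<open>With \<mu> = M this serves case (I), with \<mu> = - M case (II). The sign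
  \<open>s\<close> is encoded in the index set, the half-line of integers with
  \<open>0 \<le> i * k\<close>, so that raising is always k to k + 1; the ladder stops at
  \<open>k = 0\<close>, where its coefficient is \<open>\<mu>\<^sup>2 - M\<^sup>2\<close>.\<close>

lemma discrete_series_family:
  assumes M: "\<bar>M\<bar> < 1/2" and \<mu>: "\<mu>\<^sup>2 = M\<^sup>2" and s: "s \<in> {1, - 1}"
    and sol: "\<And>n. bvp_solution M (bc_gen l r) (s * (1/2 + \<mu> + real n)) (\<phi> n)"
    and norm: "\<And>n. radial_norm_sq (\<phi> n) = 1"
    and \<Psi>: "\<And>n. \<Psi> n = stationary (s * (1/2 + \<mu> + real n)) (\<phi> n)"
  shows "invariant (spinor.span (range \<Psi>))" "discrete_series s (1/2 + \<mu>) (spinor.span (range \<Psi>))"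
proof -
  obtain i :: int where i: "i \<in> {1, - 1}" "s = of_int i"
    using s by (metis empty_iff insert_iff of_int_1 of_int_minus)
  have \<mu>': "\<bar>\<mu>\<bar> < 1/2" using M \<mu> by (metis power2_eq_iff abs_minus_cancel)
  define K where "K = {k. 0 \<le> i * k}"
  have Kn: "of_int k = s * real (nat (i * k))" if "k \<in> K" for k
    using that i by (auto simp: K_def)
  interpret mode_family M "s * (1/2 + \<mu>)" l r K "\<lambda>k. \<phi> (nat (i * k))"
  proof
    fix k assume k: "k \<in> K"
    have "s * (1/2 + \<mu>) + of_int k = s * (1/2 + \<mu> + real (nat (i * k)))"
      unfolding Kn[OF k] by (simp add: distrib_left)
    then show "bvp_solution M (bc_gen l r) (s * (1/2 + \<mu>) + of_int k) (\<phi> (nat (i * k)))"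
      using sol[of "nat (i * k)"] by simp
    show "radial_inner (\<phi> (nat (i * k))) (\<phi> (nat (i * k))) = 1"
      by (simp add: radial_inner_self norm)
    have K0: "0 \<le> real_of_int i * of_int k"
      using k unfolding K_def by (metis mem_Collect_eq of_int_0_le_iff of_int_mult)
    show "(s * (1/2 + \<mu>) + of_int k + 1/2)\<^sup>2 \<noteq> M\<^sup>2" if k1: "k + 1 \<in> K"
    proof
      assume "(s * (1/2 + \<mu>) + of_int k + 1/2)\<^sup>2 = M\<^sup>2"
      then have "s * (1/2 + \<mu>) + of_int k + 1/2 = \<mu> \<or> s * (1/2 + \<mu>) + of_int k + 1/2 = - \<mu>"
        unfolding \<mu>[symmetric] power2_eq_iff .
      moreover have "0 \<le> real_of_int i * (of_int k + 1)"
        using k1 unfolding K_def by (metis mem_Collect_eq of_int_0_le_iff of_int_mult of_int_add of_int_1)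
      ultimately show False using i \<mu>' K0 by auto
    qed
    show "(s * (1/2 + \<mu>) + of_int k + 1/2)\<^sup>2 = M\<^sup>2" if "k + 1 \<notin> K"
    proof -
      have "i = - 1" "k = 0" using that k i by (auto simp: K_def)
      then show ?thesis using i by (simp add: \<mu>)
    qed
    show "(s * (1/2 + \<mu>) + of_int k - 1/2)\<^sup>2 = M\<^sup>2" if "k - 1 \<notin> K"
    proof -
      have "i = 1" "k = 0" using that k i by (auto simp: K_def)
      then show ?thesis using i by (simp add: \<mu>)
    qed
  next
    show "K \<noteq> {}" unfolding K_def by (metis (mono_tags) empty_iff mem_Collect_eq mult_zero_right order_refl)
    show "k \<in> K" if "a \<in> K" "b \<in> K" "a \<le> k" "k \<le> b" for a b k
      using that i by (auto simp: K_def)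
  qed (use M in simp)
  have idx: "i * (i * k) = k" for k using i by auto
  have modeK: "mode (i * int n) = \<Psi> n" for n
  proof -
    have e: "s * (1/2 + \<mu>) + real_of_int (i * int n) = s * (1/2 + \<mu> + real n)" by (simp add: i(2) algebra_simps)
    show ?thesis unfolding mode_def \<Psi> idx e nat_int ..
  qed
  have "mode ` K = range \<Psi>"
  proof (intro equalityI subsetI)
    fix x assume "x \<in> mode ` K"
    then obtain k where k: "0 \<le> i * k" "x = mode k" by (auto simp: K_def)
    then have "x = \<Psi> (nat (i * k))" using modeK[of "nat (i * k)"] idx by simp
    then show "x \<in> range \<Psi>" by simp
  next
    fix x assume "x \<in> range \<Psi>"
    then obtain n where "x = mode (i * int n)" using modeK by auto
    moreover have "i * int n \<in> K" by (simp add: K_def idx)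
    ultimately show "x \<in> mode ` K" by blast
  qed
  then have V: "V = spinor.span (range \<Psi>)" by (simp add: V_def)
  have spec: "(\<lambda>k. of_real (s * (1/2 + \<mu>) + of_int k)) ` K = range (\<lambda>n::nat. complex_of_real (s * (1/2 + \<mu> + real n)))"
  proof (intro equalityI subsetI)
    fix x assume "x \<in> (\<lambda>k. complex_of_real (s * (1/2 + \<mu>) + of_int k)) ` K"
    then obtain k where k: "k \<in> K" "x = of_real (s * (1/2 + \<mu>) + of_int k)" by blast
    have "x = of_real (s * (1/2 + \<mu> + real (nat (i * k))))" unfolding k(2) Kn[OF k(1)] by (simp add: distrib_left)
    then show "x \<in> range (\<lambda>n::nat. complex_of_real (s * (1/2 + \<mu> + real n)))" by blast
  next
    fix x assume "x \<in> range (\<lambda>n::nat. complex_of_real (s * (1/2 + \<mu> + real n)))"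
    then obtain n :: nat where n: "x = of_real (s * (1/2 + \<mu> + real n))" by blast
    have "i * int n \<in> K" by (simp add: K_def idx)
    moreover have "x = of_real (s * (1/2 + \<mu>) + of_int (i * int n))" unfolding n by (simp add: i distrib_left)
    ultimately show "x \<in> (\<lambda>k. complex_of_real (s * (1/2 + \<mu>) + of_int k)) ` K" by blast
  qed
  have lam: "M\<^sup>2 - 1/4 = (1/2 + \<mu>) * (1/2 + \<mu> - 1)"
    unfolding \<mu>[symmetric] by (simp add: power2_eq_square algebra_simps)
  show "invariant (spinor.span (range \<Psi>))" using invariant_V unfolding V .
  show "discrete_series s (1/2 + \<mu>) (spinor.span (range \<Psi>))"
    unfolding discrete_series_def
    using irreducible_V unitary_V spectrum_V casimir_V unfolding V spec lam by blast
qed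

text \<open>The ladder runs through all integers: \<open>k + 1/2\<close> has modulus at least 1/2,
  which exceeds \<open>\<bar>M\<bar>\<close>, so no coefficient vanishes.\<close>

lemma complementary_series_family:
  assumes M: "\<bar>M\<bar> < 1/2"
    and sol: "\<And>k. bvp_solution M (bc_gen l r) (of_int k) (\<phi> k)"
    and norm: "\<And>k. radial_norm_sq (\<phi> k) = 1"
    and \<Psi>: "\<And>k. \<Psi> k = stationary (of_int k) (\<phi> k)"
  defines "V \<equiv> spinor.span (range \<Psi>)"
  shows "complementary_series M V" "\<not> invariant (positive_frequency_part V)"
    "\<not> invariant (negative_frequency_part V)" "\<not> splits_by_frequency V"
proof -
  interpret F: mode_family M 0 l r UNIV \<phi>
  proof
    fix k :: int
    show "(0 + real_of_int k + 1/2)\<^sup>2 \<noteq> M\<^sup>2"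
    proof
      assume "(0 + real_of_int k + 1/2)\<^sup>2 = M\<^sup>2"
      then have "\<bar>real_of_int k + 1/2\<bar> = \<bar>M\<bar>" by (simp add: power2_eq_iff abs_eq_iff)
      moreover have "1/2 \<le> \<bar>real_of_int k + 1/2\<bar>"
      proof (cases "0 \<le> k")
        case False
        then have "real_of_int k \<le> - 1" by simp
        then show ?thesis by simp
      qed simp
      ultimately show False using M by simp
    qed
  qed (use M sol norm in \<open>simp_all add: radial_inner_self\<close>)
  have "F.mode = \<Psi>" by (simp add: fun_eq_iff F.mode_def \<Psi>)
  then have V: "F.V = V" by (simp add: F.V_def V_def)
  have spec: "(\<lambda>k. complex_of_real (0 + of_int k)) ` UNIV = \<int>"
    by (simp add: Ints_def)
  show "complementary_series M V"
    unfolding complementary_series_def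
    using F.irreducible_V F.unitary_V F.spectrum_V F.casimir_V unfolding V spec by blast
  show "\<not> invariant (positive_frequency_part V)" "\<not> invariant (negative_frequency_part V)" "\<not> splits_by_frequency V"
    using F.no_frequency_splitting[OF refl refl] unfolding V by blast+
qed

section \<open>Normalized radial modes and the stated formulas\<close>

definition unit_I :: "real \<Rightarrow> real \<Rightarrow> nat \<Rightarrow> real \<Rightarrow> complex^2" where
  "unit_I M s n = (\<lambda>\<rho>. of_real (N_I M n) *s radial_I M s n \<rho>)"

text \<open>Frequency 0 is given the sign 1, which produces the second component -2 of the stated
  zero mode.\<close>

definition unit_III :: "real \<Rightarrow> int \<Rightarrow> real \<Rightarrow> complex^2" where
  "unit_III M k = (\<lambda>\<rho>. of_real (N_int M (nat \<bar>k\<bar>)) *s radial_III M (if k < 0 then - 1 else 1) (nat \<bar>k\<bar>) \<rho>)"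

lemma unit_I_props:
  assumes "\<bar>M\<bar> < 1/2" "s \<in> {1, - 1}"
  shows "bvp_solution M (bc_gen 1 2) (s * omega_I M n) (unit_I M s n)" "radial_norm_sq (unit_I M s n) = 1"
proof -
  have s: "s = 1 \<or> s = - 1" using assms(2) by simp
  show "bvp_solution M (bc_gen 1 2) (s * omega_I M n) (unit_I M s n)"
    unfolding unit_I_def by (rule bvp_scale[OF bvp_radial_I[OF assms(1) s]])
  show "radial_norm_sq (unit_I M s n) = 1"
    unfolding unit_I_def radial_norm_sq_scale norm_sq_sign(1)[OF s] using radial_I_norm[OF assms(1), of n] by simp
qed

lemma unit_III_props:
  assumes "\<bar>M\<bar> < 1/2"
  shows "bvp_solution M (bc_gen 1 1) (of_int k) (unit_III M k)" "radial_norm_sq (unit_III M k) = 1"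
proof -
  let ?s = "if k < 0 then - 1 else 1 :: real"
  have s: "?s = 1 \<or> ?s = - 1" by simp
  have k: "of_int k = ?s * real (nat \<bar>k\<bar>)" by auto
  show "bvp_solution M (bc_gen 1 1) (of_int k) (unit_III M k)"
    unfolding unit_III_def k by (rule bvp_scale[OF bvp_radial_III[OF assms s]])
  show "radial_norm_sq (unit_III M k) = 1"
    unfolding unit_III_def radial_norm_sq_scale norm_sq_sign(2)[OF s] using radial_III_norm[OF assms, of "nat \<bar>k\<bar>"] by simp
qed

lemma mode_I_prefactor:
  assumes "\<rho> \<in> rho_interval"
  shows "cos \<rho> powr M * (1 + sin \<rho>) powr (1/2) = sigma \<rho> powr M * (1 + sin \<rho>) powr (1/2 + M)"
    "cos \<rho> powr M * (1 - sin \<rho>) powr (1/2) = sigma \<rho> powr (- M) * (1 - sin \<rho>) powr (1/2 + M)"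
proof -
  have "cos \<rho> powr M = (1 - sin \<rho>) powr (M/2) * (1 + sin \<rho>) powr (M/2)"
    using sin_bounds_rho[OF assms] by (simp add: cos_eq_powr_sin[OF assms] powr_mult powr_powr)
  moreover have "(1 + sin \<rho>) powr (M/2) * (1 + sin \<rho>) powr (1/2) = (1 + sin \<rho>) powr (- M/2) * (1 + sin \<rho>) powr (1/2 + M)"
    "(1 - sin \<rho>) powr (M/2) * (1 - sin \<rho>) powr (1/2) = (1 - sin \<rho>) powr (- M/2) * (1 - sin \<rho>) powr (1/2 + M)"
    by (simp_all flip: powr_add)
  ultimately show "cos \<rho> powr M * (1 + sin \<rho>) powr (1/2) = sigma \<rho> powr M * (1 + sin \<rho>) powr (1/2 + M)"
    "cos \<rho> powr M * (1 - sin \<rho>) powr (1/2) = sigma \<rho> powr (- M) * (1 - sin \<rho>) powr (1/2 + M)"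
    by (simp_all add: sigma_powr[OF assms] mult_ac add.commute)
qed

lemma mode_III_prefactor:
  assumes "\<rho> \<in> rho_interval"
  shows "((1 + sin \<rho>) / (1 - sin \<rho>)) powr (M/2) = sigma \<rho> powr (- M)"
    "((1 + sin \<rho>) / (1 - sin \<rho>)) powr (M/2) * cos \<rho> =
      sigma \<rho> powr M * ((1 - sin \<rho>) powr (1/2 - M) * (1 + sin \<rho>) powr (1/2 + M))"
proof -
  show 1: "((1 + sin \<rho>) / (1 - sin \<rho>)) powr (M/2) = sigma \<rho> powr (- M)"
    using sin_bounds_rho[OF assms] by (simp add: sigma_powr[OF assms] powr_divide powr_minus divide_simps)
  have "(1 - sin \<rho>) powr (1/2 + - M/2) = (1 - sin \<rho>) powr (M/2) * (1 - sin \<rho>) powr (1/2 - M)"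
    "(1 + sin \<rho>) powr (1/2 - - M/2) = (1 + sin \<rho>) powr (- M/2) * (1 + sin \<rho>) powr (1/2 + M)"
    by (simp_all add: add.commute flip: powr_add)
  then show "((1 + sin \<rho>) / (1 - sin \<rho>)) powr (M/2) * cos \<rho> =
      sigma \<rho> powr M * ((1 - sin \<rho>) powr (1/2 - M) * (1 + sin \<rho>) powr (1/2 + M))"
    unfolding 1 using cos_sigma_powr[OF assms, of "- M"] by (simp add: sigma_powr[OF assms, of M] mult_ac add.commute)
qed

lemma Psi_I_eq: "Psi_I M s n = stationary (s * omega_I M n) (unit_I M s n)"
  unfolding Psi_I_def
proof (rule stationary_cong)
  fix \<rho> assume \<rho>: "\<rho> \<in> rho_interval"
  have "(N_I M n * cos \<rho> powr M) * ((1 + sin \<rho>) powr (1/2) * P) = N_I M n * (cos \<rho> powr M * (1 + sin \<rho>) powr (1/2)) * P"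
    "(N_I M n * cos \<rho> powr M) * (s * ((1 - sin \<rho>) powr (1/2) * P)) = N_I M n * s * (cos \<rho> powr M * (1 - sin \<rho>) powr (1/2)) * P" for P
    by (simp_all only: mult_ac)
  note e = this[unfolded mode_I_prefactor[OF \<rho>]]
  show "of_real (N_I M n * cos \<rho> powr M) *s real_spinor
      ((1 + sin \<rho>) powr (1/2) * jacobi_P n (- 1/2 + M) (1/2 + M) (sin \<rho>))
      (s * ((1 - sin \<rho>) powr (1/2) * jacobi_P n (1/2 + M) (- 1/2 + M) (sin \<rho>))) = unit_I M s n \<rho>"
    unfolding vec_eq_iff forall_2 unit_I_def radial_I_def mk_spinor_def real_spinor_def vector_smult_component vector_2
      of_real_mult[symmetric] e mode_I_1_def mode_I_2_def
    by (simp only: mult_ac)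
qed

text \<open>Exchanging the components leaves the sign \<open>s\<close> in the first one; the scalar
  \<open>s\<close> of modulus one moves it to the second, as in the stated modes.\<close>

lemma Psi_II_eq:
  assumes "s \<in> {1, - 1}"
  shows "Psi_II M s n = stationary (s * omega_II M n) (\<lambda>\<rho>. of_real s *s flip_spinor (unit_I (- M) s n) \<rho>)"
  unfolding Psi_II_def
proof (rule stationary_cong)
  fix \<rho> assume \<rho>: "\<rho> \<in> rho_interval"
  have N: "N_II M n = N_I (- M) n" by (simp add: N_I_def N_II_def)
  have s: "s * s = 1" using assms by auto
  have "(N_I (- M) n * cos \<rho> powr (- M)) * ((1 - sin \<rho>) powr (1/2) * P) =
      (s * s) * (N_I (- M) n * (cos \<rho> powr (- M) * (1 - sin \<rho>) powr (1/2)) * P)"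
    "(N_I (- M) n * cos \<rho> powr (- M)) * (- s * ((1 + sin \<rho>) powr (1/2) * P)) =
      - s * (N_I (- M) n * (cos \<rho> powr (- M) * (1 + sin \<rho>) powr (1/2)) * P)" for P
    unfolding s by (simp_all only: mult_ac mult_1_left)
  note e = this[unfolded mode_I_prefactor[OF \<rho>]]
  show "of_real (N_II M n * cos \<rho> powr (- M)) *s real_spinor
      ((1 - sin \<rho>) powr (1/2) * jacobi_P n (1/2 - M) (- 1/2 - M) (sin \<rho>))
      (- s * ((1 + sin \<rho>) powr (1/2) * jacobi_P n (- 1/2 - M) (1/2 - M) (sin \<rho>))) =
      of_real s *s flip_spinor (unit_I (- M) s n) \<rho>"
    unfolding vec_eq_iff forall_2 flip_spinor_def unit_I_def radial_I_def mk_spinor_def real_spinor_def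
      vector_smult_component vector_2 of_real_mult[symmetric] of_real_minus[symmetric] N e mode_I_1_def mode_I_2_def
    by (simp add: mult_ac)
qed

lemma Psi_III_eq:
  assumes "\<bar>M\<bar> < 1/2"
  shows "Psi_III M k = stationary (of_int k) (unit_III M k)"
  unfolding Psi_III_def Let_def
proof (rule stationary_cong)
  fix \<rho> assume \<rho>: "\<rho> \<in> rho_interval"
  let ?n = "nat \<bar>k\<bar>" and ?r = "((1 + sin \<rho>) / (1 - sin \<rho>)) powr (M/2)"
  show "of_real (N_int M ?n * ?r) *s (if k = 0 then real_spinor 0 (- 2) else real_spinor
       (cos \<rho> * jacobi_P (?n - 1) (1/2 - M) (1/2 + M) (sin \<rho>))
       (- of_int (sgn k) * 2 * jacobi_P ?n (- 1/2 - M) (- 1/2 + M) (sin \<rho>))) = unit_III M k \<rho>"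
  proof (cases "k = 0")
    case True
    have "- 1 < - 1/2 - M" using assms by auto
    note J = jacobi_P_0[OF this]
    show ?thesis
      using True unfolding unit_III_def radial_III_def mk_spinor_def mode_III_1_def mode_III_2_def
      by (simp add: J[simplified] mode_III_prefactor[OF \<rho>] vec_eq_iff forall_2 real_spinor_def J)
  next
    case False
    have "(N_int M ?n * ?r) * (cos \<rho> * P) = N_int M ?n * (?r * cos \<rho>) * P" for P by (simp only: mult_ac)
    note e = this[unfolded mode_III_prefactor(2)[OF \<rho>]]
    have sg: "real_of_int (sgn k) = (if k < 0 then - 1 else 1)" using False by (simp add: sgn_if)
    show ?thesis
      using False unfolding unit_III_def radial_III_def mk_spinor_def mode_III_1_def mode_III_2_def real_spinor_def
        vec_eq_iff forall_2 vector_smult_component vector_2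
      by (simp only: if_False vector_smult_component vector_2 of_real_mult[symmetric] e sg)
        (simp add: mult_ac mode_III_prefactor(1)[OF \<rho>])
  qed
qed

text \<open>The exchange turns the second component, with factor \<open>-2\<close> for
  \<open>k \<ge> 0\<close> and \<open>2\<close> for \<open>k < 0\<close>, into the first. The scalar
  makes it positive in both cases.\<close>

lemma Psi_IV_eq:
  assumes "\<bar>M\<bar> < 1/2"
  shows "Psi_IV M k = stationary (of_int k) (\<lambda>\<rho>. of_real (if 0 \<le> k then - 1 else 1) *s flip_spinor (unit_III (- M) k) \<rho>)"
proof -
  let ?n = "nat \<bar>k\<bar>" and ?e = "if 0 \<le> k then - 1 else 1 :: real"
  define A where "A \<rho> = (if k = 0 then real_spinor 0 (- 2) else real_spinor
       (cos \<rho> * jacobi_P (?n - 1) (1/2 - - M) (1/2 + - M) (sin \<rho>))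
       (- of_int (sgn k) * 2 * jacobi_P ?n (- 1/2 - - M) (- 1/2 + - M) (sin \<rho>)))" for \<rho>
  have M': "\<bar>- M\<bar> < 1/2" using assms by simp
  have III: "stationary (of_int k) (\<lambda>\<rho>. of_real (N_int (- M) ?n * ((1 + sin \<rho>) / (1 - sin \<rho>)) powr (- M/2)) *s A \<rho>) =
      stationary (of_int k) (unit_III (- M) k)"
    using Psi_III_eq[OF M', of k] unfolding Psi_III_def Let_def A_def .
  \<comment> \<open>The pointwise identity is recovered from the equality of fields at time 0, where
    the phase is 1.\<close>
  have pt: "of_real (N_int (- M) ?n * ((1 + sin \<rho>) / (1 - sin \<rho>)) powr (- M/2)) *s A \<rho> = unit_III (- M) k \<rho>"
    if "\<rho> \<in> rho_interval" for \<rho>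
    using fun_cong[OF fun_cong[OF III, of 0], of \<rho>] that by (simp add: stationary_def on_strip_def)
  have N: "N_int (- M) ?n = N_int M ?n" by (simp add: N_int_def mult.commute)
  show ?thesis
    unfolding Psi_IV_def Let_def
  proof (rule stationary_cong)
    fix \<rho> assume \<rho>: "\<rho> \<in> rho_interval"
    have r: "((1 + sin \<rho>) / (1 - sin \<rho>)) powr (- M/2) = ((1 - sin \<rho>) / (1 + sin \<rho>)) powr (M/2)"
      using sin_bounds_rho[OF \<rho>] by (simp add: powr_divide powr_minus divide_simps)
    show "of_real (N_int M ?n * ((1 - sin \<rho>) / (1 + sin \<rho>)) powr (M/2)) *s
        (if k = 0 then real_spinor 2 0 else real_spinor
         (2 * jacobi_P ?n (- 1/2 + M) (- 1/2 - M) (sin \<rho>))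
         (of_int (sgn k) * (cos \<rho> * jacobi_P (?n - 1) (1/2 + M) (1/2 - M) (sin \<rho>)))) =
        of_real ?e *s flip_spinor (unit_III (- M) k) \<rho>"
    proof -
      have a: "1/2 - - M = 1/2 + M" "1/2 + - M = 1/2 - M" "- 1/2 - - M = - 1/2 + M" "- 1/2 + - M = - 1/2 - M"
        by simp_all
      define P where "P = jacobi_P ?n (- 1/2 + M) (- 1/2 - M) (sin \<rho>)"
      define Q where "Q = cos \<rho> * jacobi_P (?n - 1) (1/2 + M) (1/2 - M) (sin \<rho>)"
      define R where "R = complex_of_real (N_int M ?n * ((1 - sin \<rho>) / (1 + sin \<rho>)) powr (M/2))"
      have "R *s (if k = 0 then real_spinor 2 0 else real_spinor (2 * P) (of_int (sgn k) * Q)) =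
          of_real ?e *s vector [(R *s (if k = 0 then real_spinor 0 (- 2) else real_spinor Q (- of_int (sgn k) * 2 * P))) $ 2,
            - (R *s (if k = 0 then real_spinor 0 (- 2) else real_spinor Q (- of_int (sgn k) * 2 * P))) $ 1]"
        by (cases k "0 :: int" rule: linorder_cases) (simp_all add: vec_eq_iff forall_2 real_spinor_def)
      then show ?thesis
        unfolding flip_spinor_def pt[OF \<rho>, symmetric] N r A_def a P_def Q_def R_def .
    qed
  qed
qed

theorem mainTheorem5:
  fixes M :: real
  assumes "0 < M" and "M < 1 / 2"
  shows
    "(frequencies M bc_I = {s * omega_I M n | s n. s \<in> {1, - 1}} \<and>
      (\<forall>\<omega>\<in>frequencies M bc_I. unique_up_to_scalars M bc_I \<omega>) \<and>
      (\<forall>s\<in>{1, - 1}. \<forall>n. normalized_mode M bc_I (s * omega_I M n) (Psi_I M s n)) \<and>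
      (\<forall>s\<in>{1, - 1}. invariant (spinor.span (range (Psi_I M s))) \<and>
         discrete_series s (1 / 2 + M) (spinor.span (range (Psi_I M s)))))
     \<and>
     (frequencies M bc_II = {s * omega_II M n | s n. s \<in> {1, - 1}} \<and>
      (\<forall>\<omega>\<in>frequencies M bc_II. unique_up_to_scalars M bc_II \<omega>) \<and>
      (\<forall>s\<in>{1, - 1}. \<forall>n. normalized_mode M bc_II (s * omega_II M n) (Psi_II M s n)) \<and>
      (\<forall>s\<in>{1, - 1}. invariant (spinor.span (range (Psi_II M s))) \<and>
         discrete_series s (1 / 2 - M) (spinor.span (range (Psi_II M s)))))
     \<and>
     (frequencies M bc_III = \<int> \<and>
      (\<forall>\<omega>\<in>frequencies M bc_III. unique_up_to_scalars M bc_III \<omega>) \<and>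
      (\<forall>k. normalized_mode M bc_III (of_int k) (Psi_III M k)) \<and>
      complementary_series M (spinor.span (range (Psi_III M))) \<and>
      \<not> invariant (positive_frequency_part (spinor.span (range (Psi_III M)))) \<and>
      \<not> invariant (negative_frequency_part (spinor.span (range (Psi_III M)))) \<and>
      \<not> splits_by_frequency (spinor.span (range (Psi_III M))))
     \<and>
     (frequencies M bc_IV = \<int> \<and>
      (\<forall>\<omega>\<in>frequencies M bc_IV. unique_up_to_scalars M bc_IV \<omega>) \<and>
      (\<forall>k. normalized_mode M bc_IV (of_int k) (Psi_IV M k)) \<and>
      complementary_series M (spinor.span (range (Psi_IV M))) \<and>
      \<not> invariant (positive_frequency_part (spinor.span (range (Psi_IV M)))) \<and>
      \<not> invariant (negative_frequency_part (spinor.span (range (Psi_IV M)))) \<and>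
      \<not> splits_by_frequency (spinor.span (range (Psi_IV M))))"
proof -
  have M: "\<bar>M\<bar> < 1/2" and M': "\<bar>- M\<bar> < 1/2" using assms by auto
  have om: "omega_I M n = 1/2 + M + real n" "omega_I (- M) n = omega_II M n" "omega_II M n = 1/2 + - M + real n" for n
    by (simp_all add: omega_I_def omega_II_def)
  have three: "3 - 1 = (2 :: 2)" "3 - 2 = (1 :: 2)" by simp_all
  have II: "bvp_solution M (bc_gen 2 1) (s * omega_II M n) (\<lambda>\<rho>. of_real s *s flip_spinor (unit_I (- M) s n) \<rho>)"
    "radial_norm_sq (\<lambda>\<rho>. of_real s *s flip_spinor (unit_I (- M) s n) \<rho>) = 1" if s: "s \<in> {1, - 1}" for s n
    using bvp_scale[OF bvp_flip[OF unit_I_props(1)[OF M' s, of n]], of "of_real s"] s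
    by (auto simp: three om radial_norm_sq_scale radial_norm_sq_flip unit_I_props(2)[OF M'])
  have IV: "bvp_solution M (bc_gen 2 2) (of_int k) (\<lambda>\<rho>. of_real (if 0 \<le> k then - 1 else 1) *s flip_spinor (unit_III (- M) k) \<rho>)"
    "radial_norm_sq (\<lambda>\<rho>. of_real (if 0 \<le> k then - 1 else 1) *s flip_spinor (unit_III (- M) k) \<rho>) = 1" for k
    using bvp_scale[OF bvp_flip[OF unit_III_props(1)[OF M', of k]], of "of_real (if 0 \<le> k then - 1 else 1)"]
    by (auto simp: three radial_norm_sq_scale radial_norm_sq_flip unit_III_props(2)[OF M'])
  have freq: "frequencies M (bc_gen 2 1) = {s * omega_II M n | s n. s \<in> {1, - 1}}" "frequencies M (bc_gen 2 2) = \<int>"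
    using frequencies_flip[of "- M" 1 2] frequencies_flip[of "- M" 1 1] frequencies_I[OF M'] frequencies_III[OF M']
    by (simp_all add: three om(2))
  have repI: "invariant (spinor.span (range (Psi_I M s)))" "discrete_series s (1 / 2 + M) (spinor.span (range (Psi_I M s)))"
    if s: "s \<in> {1, - 1}" for s
    by (rule discrete_series_family[OF M refl s unit_I_props[OF M s, unfolded om(1)] Psi_I_eq[of M, unfolded om(1)]])+
  have repII: "invariant (spinor.span (range (Psi_II M s)))" "discrete_series s (1 / 2 - M) (spinor.span (range (Psi_II M s)))"
    if s: "s \<in> {1, - 1}" for s
  proof -
    \<comment> \<open>The radial operator keeps the mass \<open>M\<close> here; the sign change
      enters only through \<mu> = - M, and the ladder coefficients depend on
      \<open>M\<^sup>2\<close> alone.\<close>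
    have sq: "(- M)\<^sup>2 = M\<^sup>2" by simp
    note * = discrete_series_family[OF M sq s II(1)[OF s, unfolded om(3)] II(2)[OF s] Psi_II_eq[OF s, of M, unfolded om(3)]]
    show "invariant (spinor.span (range (Psi_II M s)))" by (rule *(1))
    show "discrete_series s (1 / 2 - M) (spinor.span (range (Psi_II M s)))" using *(2) by simp
  qed
  have nI: "normalized_mode M (bc_gen 1 2) (s * omega_I M n) (Psi_I M s n)" if "s \<in> {1, - 1}" for s n
    unfolding Psi_I_eq by (rule normalized_mode_stationary[OF M unit_I_props[OF M that]])
  have nII: "normalized_mode M (bc_gen 2 1) (s * omega_II M n) (Psi_II M s n)" if "s \<in> {1, - 1}" for s n
    unfolding Psi_II_eq[OF that] by (rule normalized_mode_stationary[OF M II[OF that]])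
  have nIII: "normalized_mode M (bc_gen 1 1) (of_int k) (Psi_III M k)" for k
    unfolding Psi_III_eq[OF M] by (rule normalized_mode_stationary[OF M unit_III_props[OF M]])
  have nIV: "normalized_mode M (bc_gen 2 2) (of_int k) (Psi_IV M k)" for k
    unfolding Psi_IV_eq[OF M] by (rule normalized_mode_stationary[OF M IV])
  note uniq = unique_up_to_scalars_bc_gen[OF M]
  note repIII = complementary_series_family[OF M unit_III_props[OF M] Psi_III_eq[OF M]]
  note repIV = complementary_series_family[OF M IV Psi_IV_eq[OF M]]
  show ?thesis
    unfolding bc_eq_bc_gen
    by (intro conjI ballI allI frequencies_I[OF M] frequencies_III[OF M] freq uniq nI nII nIII nIV repI repII repIII repIV)
qed

end
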